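(* Let $S$ be a set of abstract vector variables and $x\in S$. On $R_{\mathbb B}(S)_{\Omega_x}$, every $F$ satisfies $$F=\partial^{\mathrm R}_{x,q}(\mathcal C_x\mathcal G_{x,q}F)+\mathcal C_x(\partial^{\mathrm R}_{x,q}\mathcal G_{x,q}F).$$ The operators $$P_\partial:=\partial^{\mathrm R}_{x,q}\mathcal C_x\mathcal G_{x,q},\qquad P_{\mathcal C}:=\mathcal C_x\partial^{\mathrm R}_{x,q}\mathcal G_{x,q}$$ are complementary projections. Hence $$R_{\mathbb B}(S)_{\Omega_x}=\operatorname{im}P_\partial\oplus\operatorname{im}P_{\mathcal C},\qquad \operatorname{im}P_\partial\subseteq\operatorname{im}\partial^{\mathrm R}_{x,q},\quad \operatorname{im}P_{\mathcal C}\subseteq\operatorname{im}\mathcal C_x .$$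
   Context: **Radial algebra.** For a set $S$ of abstract vector variables, $R(S)$ is the associative unital $\mathbb R$-algebra generated by $S$ subject to $[\{u,v\},w]=0$ for all $u,v,w\in S$, where $\{a,b\}=ab+ba$, $[a,b]=ab-ba$. The wedge is the antisymmetrized product $u_1\wedge\cdots\wedge u_p=\frac1{p!}\sum_{\pi}\operatorname{sgn}(\pi)u_{\pi(1)}\cdots u_{\pi(p)}$ (empty wedge $=1$). **Coefficients.** $q,Q$ are algebraically independent indeterminates, $\mathbb B=\mathbb R[q,q^{-1},Q,(1-q)^{-1}]$, $R_{\mathbb B}(S)=\mathbb B\otimes_{\mathbb R}R(S)$. For integers $n,a$: $[n]_q=\frac{1-q^n}{1-q}$, $q^{m+a}:=Qq^a$, $[m+a]_q:=\frac{1-Qq^a}{1-q}$ ($m$ is only a formal symbol). For a multiplicative set $\Omega$ of central coefficients, $\mathcal M_\Omega=\Omega^{-1}\mathcal M$. **Scalars.** For finite $Y=\{y_1,\dots,y_N\}\subset S\setminus\{x\}$: $r=x^2$, $s_i=\{x,y_i\}$, $c_{ij}=\{y_i,y_j\}=c_{ji}$ are central and $\mathcal A_x(Y)=\mathbb B[r,s_1,\dots,s_N,c_{ij}:1\le i\le j\le N]$ is a polynomial algebra. For $I=\{i_1<\cdots<i_p\}\subset\{1,\dots,N\}$, $y_I=y_{i_1}\wedge\cdots\wedge y_{i_p}$, $y_\varnothing=1$. It is known that $R_{\mathbb B}(\{x\}\cup Y)=\bigoplus_I y_I\mathcal A_x(Y)\oplus\bigoplus_I(x\wedge y_I)\mathcal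 A_x(Y)$, free over $\mathcal A_x(Y)$ on the elements $y_I,\ x\wedge y_I$. **Jackson operators.** For a scalar variable $u$ and parameter $P$: $\delta^{(u)}_Pf=\frac{f(u)-f(Pu)}{(1-P)u}$, $T^{(u)}_Pf(u)=f(Pu)$. For $A\in\mathcal A_x(Y)$, $$\partial^{\mathrm{sc},Y}_{x,q}A=(1+q)\,x\,\delta^{(r)}_{q^2}A+2\sum_{i=1}^N y_i\,T^{(r)}_{q^2}\delta^{(s_i)}_qA.$$ **Right $q$-vector derivatives.** $\partial^{Y,\mathrm R}_{x,q}$ is the $\mathbb B$-linear operator on $R_{\mathbb B}(\{x\}\cup Y)$ with, for $p=|I|$ and $A,B\in\mathcal A_x(Y)$, $$\partial^{Y,\mathrm R}_{x,q}(y_IA)=y_I\,\partial^{\mathrm{sc},Y}_{x,q}(A),\qquad \partial^{Y,\mathrm R}_{x,q}((x\wedge y_I)B)=(-1)^p[m-p]_q\,y_IB+q^{m-p}(x\wedge y_I)\,\partial^{\mathrm{sc},Y}_{x,q}(B).$$ These are compatible under $Y\subset Z$ and define $\partial^{\mathrm R}_{x,q}$ on $R_{\mathbb B}(S)$, restricting to $\partial^{Y,\mathrm R}_{x,q}$ on each $R_{\mathbb B}(\{x\}\cup Y)$. **Exterior creation.** $\mathcal C^Y_x(y_IA)=(x\wedge y_I)A$, $\mathcal C^Y_x((x\wedge y_I)B)=0$, extended additively; compatible under enlargement of $Y$, defining $\mathcal C_x$ on $R_{\mathbb B}(S)$. **Localization and Green operator.** $\Omega_x\subset\mathbb B$ is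 the multiplicative set generated by all $$\lambda_{p,a,\beta}=[m-p]_q+q^{m-p}\Bigl([2a]_q+q^{2a}\sum_{i=1}^N[\beta_i]_q\Bigr),$$ over all finite $Y\subset S\setminus\{x\}$ ($N=|Y|$), $0\le p\le N$, $a\ge0$, $\beta\in\mathbb Z_{\ge0}^N$. The operator $\mathcal H_{x,q}:=\partial^{\mathrm R}_{x,q}\mathcal C_x+\mathcal C_x\partial^{\mathrm R}_{x,q}$ is invertible on $R_{\mathbb B}(S)_{\Omega_x}$, and $\mathcal G_{x,q}$ denotes its inverse there. All operators are $\mathbb B$-linear and are extended to the localization. *)

theory Defs
  imports
    Complex_Main
    "HOL-Library.Poly_Mapping"
    "HOL-Computational_Algebra.Polynomial"
    "HOL-Computational_Algebra.Fraction_Field"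
    "HOL-Combinatorics.Permutations"
    "HOL-Algebra.Module"
    "HOL-Algebra.Algebraic_Closure_Type"
begin

section \<open>Presentations of rings\<close>

inductive_set two_sided_ideal :: "'a::ring_1 set \<Rightarrow> 'a set" for G where
  zero: "0 \<in> two_sided_ideal G"
| gen: "g \<in> G \<Longrightarrow> a * g * b \<in> two_sided_ideal G"
| add: "u \<in> two_sided_ideal G \<Longrightarrow> v \<in> two_sided_ideal G \<Longrightarrow> u + v \<in> two_sided_ideal G"

lemma two_sided_ideal_mult_left: "u \<in> two_sided_ideal G \<Longrightarrow> c * u \<in> two_sided_ideal G"
proof (induction rule: two_sided_ideal.induct)
  case (gen g a b)
  then show ?case using two_sided_ideal.gen[of g G "c * a" b] by (simp add: mult.assoc)
qed (auto simp: distrib_left intro: two_sided_ideal.intros)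

lemma two_sided_ideal_mult_right: "u \<in> two_sided_ideal G \<Longrightarrow> u * c \<in> two_sided_ideal G"
proof (induction rule: two_sided_ideal.induct)
  case (gen g a b)
  then show ?case using two_sided_ideal.gen[of g G a "b * c"] by (simp add: mult.assoc)
qed (auto simp: distrib_right intro: two_sided_ideal.intros)

lemma two_sided_ideal_uminus: "u \<in> two_sided_ideal G \<Longrightarrow> - u \<in> two_sided_ideal G"
  using two_sided_ideal_mult_left[of u G "-1"] by simp

lemma two_sided_ideal_diff:
  "u \<in> two_sided_ideal G \<Longrightarrow> v \<in> two_sided_ideal G \<Longrightarrow> u - v \<in> two_sided_ideal G"
  using two_sided_ideal.add[of u G "- v"] two_sided_ideal_uminus[of v G] by simp

lemma equivp_two_sided_ideal: "equivp (\<lambda>a b. a - b \<in> two_sided_ideal G)"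
proof (rule equivpI)
  show "reflp (\<lambda>a b. a - b \<in> two_sided_ideal G)"
    by (auto intro!: reflpI two_sided_ideal.zero)
  show "symp (\<lambda>a b. a - b \<in> two_sided_ideal G)"
    using two_sided_ideal_uminus by (fastforce intro!: sympI)
  show "transp (\<lambda>a b. a - b \<in> two_sided_ideal G)"
    using two_sided_ideal.add by (fastforce intro!: transpI)
qed

lemma two_sided_ideal_cong_mult:
  assumes "a - b \<in> two_sided_ideal G" "c - d \<in> two_sided_ideal G"
  shows "a * c - b * d \<in> two_sided_ideal G"
proof -
  have "a * c - b * d = (a - b) * c + b * (c - d)" by (simp add: algebra_simps)
  then show ?thesis
    using assms by (auto intro: two_sided_ideal.add two_sided_ideal_mult_left two_sided_ideal_mult_right)
qed

lemma two_sided_ideal_cong_add: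
  assumes "a - b \<in> two_sided_ideal G" "c - d \<in> two_sided_ideal G"
  shows "a + c - (b + d) \<in> two_sided_ideal G"
  using two_sided_ideal.add[OF assms] by (simp add: algebra_simps)

lemma two_sided_ideal_cong_diff:
  assumes "a - b \<in> two_sided_ideal G" "c - d \<in> two_sided_ideal G"
  shows "a - c - (b - d) \<in> two_sided_ideal G"
  using two_sided_ideal_diff[OF assms] by (simp add: algebra_simps)

lemma two_sided_ideal_cong_uminus:
  assumes "a - b \<in> two_sided_ideal G"
  shows "- a - - b \<in> two_sided_ideal G"
  using two_sided_ideal_uminus[OF assms] by (simp add: algebra_simps)

lemma two_sided_ideal_kernel:
  fixes \<phi> :: "'a::ring_1 \<Rightarrow> 'b::ring_1"
  assumes "u \<in> two_sided_ideal G" "\<phi> 0 = 0" "\<And>a b. \<phi> (a + b) = \<phi> a + \<phi> b"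
    "\<And>a b. \<phi> (a * b) = \<phi> a * \<phi> b" "\<And>g. g \<in> G \<Longrightarrow> \<phi> g = 0"
  shows "\<phi> u = 0"
  using assms(1) by induction (use assms(2-) in auto)

text \<open>The linear extension to a monoid ring of a map on the monoid; used only to see that the
  quotients below are not the zero ring.\<close>

definition monoid_ring_ext :: "('c::zero \<Rightarrow> 'd::ring_1) \<Rightarrow> ('m \<Rightarrow> 'd) \<Rightarrow> ('m \<Rightarrow>\<^sub>0 'c) \<Rightarrow> 'd" where
  "monoid_ring_ext c h p = (\<Sum>k\<in>Poly_Mapping.keys p. c (Poly_Mapping.lookup p k) * h k)"

lemma monoid_ring_ext_super:
  assumes "finite A" "Poly_Mapping.keys p \<subseteq> A" "c 0 = 0"
  shows "monoid_ring_ext c h p = (\<Sum>k\<in>A. c (Poly_Mapping.lookup p k) * h k)"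
  unfolding monoid_ring_ext_def
  by (rule sum.mono_neutral_left) (use assms in \<open>auto simp: in_keys_iff\<close>)

lemma monoid_ring_ext_add:
  fixes p p' :: "'m \<Rightarrow>\<^sub>0 'c::ring_1"
  assumes "c 0 = 0" "\<And>a b. c (a + b) = c a + c b"
  shows "monoid_ring_ext c h (p + p') = monoid_ring_ext c h p + monoid_ring_ext c h p'"
proof -
  let ?A = "Poly_Mapping.keys p \<union> Poly_Mapping.keys p'"
  have "monoid_ring_ext c h q = (\<Sum>k\<in>?A. c (Poly_Mapping.lookup q k) * h k)"
    if "Poly_Mapping.keys q \<subseteq> ?A" for q
    by (rule monoid_ring_ext_super) (use that assms in auto)
  then show ?thesis
    by (simp add: Poly_Mapping.keys_add lookup_add assms(2) distrib_right sum.distrib)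
qed

lemma monoid_ring_ext_single: "c 0 = 0 \<Longrightarrow> monoid_ring_ext c h (Poly_Mapping.single k a) = c a * h k"
  by (cases "a = 0") (auto simp: monoid_ring_ext_def)

lemma poly_mapping_single_induct [case_names zero single_add]:
  fixes p :: "'m \<Rightarrow>\<^sub>0 'c::comm_monoid_add"
  assumes "P 0" "\<And>k a q. P q \<Longrightarrow> P (Poly_Mapping.single k a + q)"
  shows "P p"
proof (induction p rule: Poly_Mapping.update_induct)
  case const
  show ?case by (rule assms)
next
  case (update f a b)
  have "Poly_Mapping.update a b f = Poly_Mapping.single a b + f"
    using update by (intro poly_mapping_eqI) (auto simp: lookup_update lookup_add lookup_single when_def in_keys_iff)
  with update assms show ?case by simp
qed

lemma monoid_ring_ext_mult:
  fixes p p' :: "'m::monoid_add \<Rightarrow>\<^sub>0 'c::ring_1" and c :: "'c \<Rightarrow> 'd::comm_ring_1"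
  assumes c: "c 0 = 0" "\<And>a b. c (a + b) = c a + c b" "\<And>a b. c (a * b) = c a * c b"
    and h: "\<And>k l. h (k + l) = h k * h l"
  shows "monoid_ring_ext c h (p * p') = monoid_ring_ext c h p * monoid_ring_ext c h p'"
proof (induction p rule: poly_mapping_single_induct)
  case zero
  then show ?case by (simp add: monoid_ring_ext_def)
next
  case (single_add k a q)
  have "monoid_ring_ext c h (Poly_Mapping.single k a * p') = c a * h k * monoid_ring_ext c h p'"
  proof (induction p' rule: poly_mapping_single_induct)
    case zero
    then show ?case by (simp add: monoid_ring_ext_def)
  next
    case (single_add l b q')
    then show ?case
      by (simp add: distrib_left monoid_ring_ext_add c h mult_single monoid_ring_ext_single algebra_simps)
  qed
  with single_add show ?case
    by (simp add: distrib_right monoid_ring_ext_add c monoid_ring_ext_single)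
qed

section \<open>The radial algebra over the reals\<close>

text \<open>The set of abstract vector variables is the type \<^typ>\<open>'v\<close>. The free algebra is the monoid
  algebra of the free monoid, written additively because that is how \<^type>\<open>poly_mapping\<close>
  forms monoid algebras.\<close>

datatype 'v word = Word "'v list"

instantiation word :: (type) monoid_add
begin
definition zero_word :: "'v word" where "zero_word = Word []"
fun plus_word :: "'v word \<Rightarrow> 'v word \<Rightarrow> 'v word" where
  "plus_word (Word us) (Word vs) = Word (us @ vs)"
instance
proof
  fix a b c :: "'v word"
  show "a + b + c = a + (b + c)" by (cases a; cases b; cases c) simp
  show "0 + a = a" by (cases a) (simp add: zero_word_def)
  show "a + 0 = a" by (cases a) (simp add: zero_word_def)
qed
end

definition commutator :: "'a::ring \<Rightarrow> 'a \<Rightarrow> 'a" where "commutator a b = a * b - b * a"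

definition anticommutator :: "'a::ring \<Rightarrow> 'a \<Rightarrow> 'a" where "anticommutator a b = a * b + b * a"

definition free_gen :: "'v \<Rightarrow> 'v word \<Rightarrow>\<^sub>0 real" where
  "free_gen v = Poly_Mapping.single (Word [v]) 1"

definition radial_relators :: "('v word \<Rightarrow>\<^sub>0 real) set" where
  "radial_relators =
    {commutator (anticommutator (free_gen u) (free_gen v)) (free_gen w) | u v w. True}"

definition free_augmentation :: "('v word \<Rightarrow>\<^sub>0 real) \<Rightarrow> real" where
  "free_augmentation = monoid_ring_ext (\<lambda>c. c) (\<lambda>k. if k = 0 then 1 else 0)"

lemma free_augmentation_simps:
  "free_augmentation 0 = 0" "free_augmentation 1 = 1"
  "free_augmentation (a + b) = free_augmentation a + free_augmentation b"
  "free_augmentation (a * b) = free_augmentation a * free_augmentation b"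
  "free_augmentation (free_gen v) = 0"
proof -
  have plus0: "k + l = 0 \<longleftrightarrow> k = 0 \<and> l = 0" for k l :: "'v word"
    by (cases k; cases l) (auto simp: zero_word_def)
  show "free_augmentation 0 = 0" "free_augmentation 1 = 1"
    unfolding free_augmentation_def by (auto simp: monoid_ring_ext_def)
  show "free_augmentation (a + b) = free_augmentation a + free_augmentation b"
    unfolding free_augmentation_def by (rule monoid_ring_ext_add) auto
  show "free_augmentation (a * b) = free_augmentation a * free_augmentation b"
    unfolding free_augmentation_def by (rule monoid_ring_ext_mult) (auto simp: plus0)
  show "free_augmentation (free_gen v) = 0"
    unfolding free_augmentation_def free_gen_def
    by (simp add: monoid_ring_ext_single zero_word_def)
qed

lemma free_augmentation_ideal: "u \<in> two_sided_ideal radial_relators \<Longrightarrow> free_augmentation u = 0"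
proof (erule two_sided_ideal_kernel)
  fix g :: "'v word \<Rightarrow>\<^sub>0 real" assume "g \<in> radial_relators"
  then obtain u v w where g: "g = commutator (anticommutator (free_gen u) (free_gen v)) (free_gen w)"
    by (auto simp: radial_relators_def)
  have m: "free_augmentation (a - b) = free_augmentation a - free_augmentation b"
    for a b :: "'v word \<Rightarrow>\<^sub>0 real"
    using free_augmentation_simps(3)[of "a - b" b] by simp
  show "free_augmentation g = 0"
    by (simp add: g commutator_def anticommutator_def free_augmentation_simps m)
qed (simp_all add: free_augmentation_simps)

quotient_type 'v radial = "'v word \<Rightarrow>\<^sub>0 real" / "\<lambda>a b. a - b \<in> two_sided_ideal radial_relators"
  by (rule equivp_two_sided_ideal)

instantiation radial :: (type) real_algebra_1
begin
lift_definition zero_radial :: "'v radial" is 0 .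
lift_definition one_radial :: "'v radial" is 1 .
lift_definition plus_radial :: "'v radial \<Rightarrow> 'v radial \<Rightarrow> 'v radial" is "(+)"
  by (rule two_sided_ideal_cong_add)
lift_definition minus_radial :: "'v radial \<Rightarrow> 'v radial \<Rightarrow> 'v radial" is "(-)"
  by (rule two_sided_ideal_cong_diff)
lift_definition uminus_radial :: "'v radial \<Rightarrow> 'v radial" is uminus
  by (rule two_sided_ideal_cong_uminus)
lift_definition times_radial :: "'v radial \<Rightarrow> 'v radial \<Rightarrow> 'v radial" is "(*)"
  by (rule two_sided_ideal_cong_mult)
lift_definition scaleR_radial :: "real \<Rightarrow> 'v radial \<Rightarrow> 'v radial"
  is "\<lambda>c p. Poly_Mapping.single 0 c * p"
  by (auto simp: right_diff_distrib [symmetric] intro: two_sided_ideal_mult_left)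
instance
proof
  fix a b c :: "'v radial" and s t :: real
  have central: "p * Poly_Mapping.single 0 t = Poly_Mapping.single 0 t * p" for t and p :: "'v word \<Rightarrow>\<^sub>0 real"
    by (induction p rule: poly_mapping_single_induct)
      (simp_all add: distrib_left distrib_right mult_single mult.commute[where 'a=real])
  have eqI: "p - q \<in> two_sided_ideal radial_relators" if "p = q" for p q :: "'v word \<Rightarrow>\<^sub>0 real"
    using that by (simp add: two_sided_ideal.zero)
  show "a + b + c = a + (b + c)" by transfer (rule eqI, simp add: algebra_simps)
  show "a + b = b + a" by transfer (rule eqI, simp add: algebra_simps)
  show "0 + a = a" by transfer (rule eqI, simp)
  show "- a + a = 0" by transfer (rule eqI, simp)
  show "a - b = a + - b" by transfer (rule eqI, simp)
  show "a * b * c = a * (b * c)" by transfer (rule eqI, simp add: mult.assoc)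
  show "1 * a = a" by transfer (rule eqI, simp)
  show "a * 1 = a" by transfer (rule eqI, simp)
  show "(a + b) * c = a * c + b * c" by transfer (rule eqI, simp add: algebra_simps)
  show "a * (b + c) = a * b + a * c" by transfer (rule eqI, simp add: algebra_simps)
  show "(0::'v radial) \<noteq> 1"
  proof (transfer, rule notI)
    assume "(0::'v word \<Rightarrow>\<^sub>0 real) - 1 \<in> two_sided_ideal radial_relators"
    then have "- (0 - 1 :: 'v word \<Rightarrow>\<^sub>0 real) \<in> two_sided_ideal radial_relators"
      by (rule two_sided_ideal_uminus)
    then have "free_augmentation (1 :: 'v word \<Rightarrow>\<^sub>0 real) = 0"
      using free_augmentation_ideal by force
    then show False by (simp add: free_augmentation_simps)
  qed
  show "s *\<^sub>R (a + b) = s *\<^sub>R a + s *\<^sub>R b" by transfer (rule eqI, simp add: algebra_simps)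
  show "(s + t) *\<^sub>R a = s *\<^sub>R a + t *\<^sub>R a"
    by transfer (rule eqI, simp add: distrib_right [symmetric] single_add)
  show "s *\<^sub>R t *\<^sub>R a = (s * t) *\<^sub>R a"
    by transfer (rule eqI, simp add: mult.assoc [symmetric] mult_single)
  show "1 *\<^sub>R a = a" by transfer (rule eqI, simp)
  show "s *\<^sub>R a * b = s *\<^sub>R (a * b)" by transfer (rule eqI, simp add: mult.assoc)
  show "a * s *\<^sub>R b = s *\<^sub>R (a * b)"
    by transfer (rule eqI, simp only: mult.assoc [symmetric] central)
qed
end

lift_definition radial_var :: "'v \<Rightarrow> 'v radial" is free_gen .

section \<open>The coefficient ring\<close>

text \<open>The ring of coefficients is realised inside the field of fractions of the polynomials in
  \<open>Q\<close> (outer variable) over the polynomials in \<open>q\<close> (inner variable).\<close>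

abbreviation q_fract :: "real poly poly fract" where
  "q_fract \<equiv> Fraction_Field.Fract [:[:0, 1:]:] 1"

abbreviation Q_fract :: "real poly poly fract" where
  "Q_fract \<equiv> Fraction_Field.Fract [:0, 1:] 1"

inductive_set coeff_set :: "real poly poly fract set" where
  real: "Fraction_Field.Fract [:[:c:]:] 1 \<in> coeff_set"
| q: "q_fract \<in> coeff_set"
| q_inv: "inverse q_fract \<in> coeff_set"
| Q: "Q_fract \<in> coeff_set"
| one_minus_q_inv: "inverse (1 - q_fract) \<in> coeff_set"
| add: "a \<in> coeff_set \<Longrightarrow> b \<in> coeff_set \<Longrightarrow> a + b \<in> coeff_set"
| mult: "a \<in> coeff_set \<Longrightarrow> b \<in> coeff_set \<Longrightarrow> a * b \<in> coeff_set"

lemma coeff_set_0: "0 \<in> coeff_set"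
  using coeff_set.real[of 0] by (simp add: Zero_fract_def)

lemma coeff_set_1: "1 \<in> coeff_set"
  using coeff_set.real[of 1] by (simp add: One_fract_def flip: one_pCons)

lemma coeff_set_uminus: "a \<in> coeff_set \<Longrightarrow> - a \<in> coeff_set"
proof -
  have "Fraction_Field.Fract [:[:- 1:]:] 1 = (- 1 :: real poly poly fract)"
    by (simp add: One_fract_def one_pCons)
  then have "- 1 \<in> coeff_set"
    using coeff_set.real[of "- 1"] by simp
  then show "a \<in> coeff_set \<Longrightarrow> - a \<in> coeff_set"
    using coeff_set.mult[of "- 1" a] by simp
qed

lemma coeff_set_diff: "a \<in> coeff_set \<Longrightarrow> b \<in> coeff_set \<Longrightarrow> a - b \<in> coeff_set"
  using coeff_set.add[of a "- b"] coeff_set_uminus[of b] by simp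

typedef coeff = coeff_set
  using coeff_set_0 by blast

setup_lifting type_definition_coeff

instantiation coeff :: "{idom, real_algebra_1}"
begin
lift_definition zero_coeff :: coeff is 0 by (rule coeff_set_0)
lift_definition one_coeff :: coeff is 1 by (rule coeff_set_1)
lift_definition plus_coeff :: "coeff \<Rightarrow> coeff \<Rightarrow> coeff" is "(+)" by (rule coeff_set.add)
lift_definition minus_coeff :: "coeff \<Rightarrow> coeff \<Rightarrow> coeff" is "(-)" by (rule coeff_set_diff)
lift_definition uminus_coeff :: "coeff \<Rightarrow> coeff" is uminus by (rule coeff_set_uminus)
lift_definition times_coeff :: "coeff \<Rightarrow> coeff \<Rightarrow> coeff" is "(*)" by (rule coeff_set.mult)
lift_definition scaleR_coeff :: "real \<Rightarrow> coeff \<Rightarrow> coeff"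
  is "\<lambda>c a. Fraction_Field.Fract [:[:c:]:] 1 * a"
  by (intro coeff_set.intros)
instance
proof
  fix a b c :: coeff and s t :: real
  have real_add: "Fraction_Field.Fract [:[:s + t:]:] 1 =
      Fraction_Field.Fract [:[:s:]:] 1 + Fraction_Field.Fract [:[:t:]:] (1 :: real poly poly)" for s t
    by simp
  have real_mult: "Fraction_Field.Fract [:[:s * t:]:] 1 =
      Fraction_Field.Fract [:[:s:]:] 1 * Fraction_Field.Fract [:[:t:]:] (1 :: real poly poly)" for s t
    by simp
  have real_one: "Fraction_Field.Fract [:[:1:]:] 1 = (1 :: real poly poly fract)"
    by (simp add: One_fract_def one_pCons)
  show "a + b + c = a + (b + c)" by transfer (rule add.assoc)
  show "a + b = b + a" by transfer (rule add.commute)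
  show "0 + a = a" by transfer (rule add_0)
  show "- a + a = 0" by transfer (rule left_minus)
  show "a - b = a + - b" by transfer (rule diff_conv_add_uminus)
  show "a * b * c = a * (b * c)" by transfer (rule mult.assoc)
  show "a * b = b * a" by transfer (rule mult.commute)
  show "1 * a = a" by transfer (rule mult_1)
  show "(a + b) * c = a * c + b * c" by transfer (rule distrib_right)
  show "a * (b + c) = a * b + a * c" by transfer (rule distrib_left)
  show "a * 1 = a" by transfer (rule mult_1_right)
  show "0 * a = 0" by transfer (rule mult_zero_left)
  show "a * 0 = 0" by transfer (rule mult_zero_right)
  show "(0::coeff) \<noteq> 1" by transfer (rule zero_neq_one)
  show "a * b \<noteq> 0" if "a \<noteq> 0" "b \<noteq> 0"
    using that by transfer (rule no_zero_divisors)
  show "s *\<^sub>R (a + b) = s *\<^sub>R a + s *\<^sub>R b" by transfer (rule distrib_left)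
  show "(s + t) *\<^sub>R a = s *\<^sub>R a + t *\<^sub>R a"
    by transfer (simp only: real_add distrib_right)
  show "s *\<^sub>R t *\<^sub>R a = (s * t) *\<^sub>R a"
    by transfer (simp only: real_mult mult.assoc)
  show "1 *\<^sub>R a = a"
    by transfer (simp only: real_one mult_1)
  show "s *\<^sub>R a * b = s *\<^sub>R (a * b)" by transfer (rule mult.assoc)
  show "a * s *\<^sub>R b = s *\<^sub>R (a * b)" by transfer (rule mult.left_commute)
qed
end

lift_definition q :: coeff is q_fract by (rule coeff_set.q)
lift_definition q_inv :: coeff is "inverse q_fract" by (rule coeff_set.q_inv)
lift_definition Q :: coeff is Q_fract by (rule coeff_set.Q)
lift_definition one_minus_q_inv :: coeff is "inverse (1 - q_fract)"
  by (rule coeff_set.one_minus_q_inv)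

definition q_pow :: "int \<Rightarrow> coeff" where
  "q_pow n = (if 0 \<le> n then q ^ nat n else q_inv ^ nat (- n))"

definition q_num :: "int \<Rightarrow> coeff" where
  "q_num n = (1 - q_pow n) * one_minus_q_inv"

text \<open>The powers \<open>q\<^bsup>m+a\<^esup>\<close> and \<open>q\<close>-numbers \<open>[m+a]\<^sub>q\<close> for the formal symbol \<open>m\<close> with \<open>q\<^sup>m = Q\<close>.\<close>

definition q_pow_m :: "int \<Rightarrow> coeff" where
  "q_pow_m a = Q * q_pow a"

definition q_num_m :: "int \<Rightarrow> coeff" where
  "q_num_m a = (1 - Q * q_pow a) * one_minus_q_inv"

section \<open>Extension of scalars\<close>

text \<open>The tensor product over the reals of the coefficient ring and the radial algebra: the integral
  monoid ring of the multiplicative monoid of pairs, modulo the relations that make a pair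
  \<open>\<real>\<close>-bilinear. These relations span an additive subgroup that is stable under multiplication by
  pairs, so this is the usual tensor product together with its usual ring structure.\<close>

datatype 'v tensor_pair = Pair_Mon coeff "'v radial"

instantiation tensor_pair :: (type) monoid_add
begin
definition zero_tensor_pair :: "'v tensor_pair" where "zero_tensor_pair = Pair_Mon 1 1"
fun plus_tensor_pair :: "'v tensor_pair \<Rightarrow> 'v tensor_pair \<Rightarrow> 'v tensor_pair" where
  "plus_tensor_pair (Pair_Mon b F) (Pair_Mon c G) = Pair_Mon (b * c) (F * G)"
instance
proof
  fix a b c :: "'v tensor_pair"
  show "a + b + c = a + (b + c)" by (cases a; cases b; cases c) (simp add: mult.assoc)
  show "0 + a = a" by (cases a) (simp add: zero_tensor_pair_def)
  show "a + 0 = a" by (cases a) (simp add: zero_tensor_pair_def)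
qed
end

definition free_tensor :: "coeff \<Rightarrow> 'v radial \<Rightarrow> 'v tensor_pair \<Rightarrow>\<^sub>0 int" where
  "free_tensor b F = Poly_Mapping.single (Pair_Mon b F) 1"

definition tensor_relators :: "('v tensor_pair \<Rightarrow>\<^sub>0 int) set" where
  "tensor_relators =
     {free_tensor (b + c) F - free_tensor b F - free_tensor c F | b c F. True} \<union>
     {free_tensor b (F + G) - free_tensor b F - free_tensor b G | b F G. True} \<union>
     {free_tensor (t *\<^sub>R b) F - free_tensor b (t *\<^sub>R F) | t b F. True}"

lift_definition radial_augmentation :: "'v radial \<Rightarrow> real" is free_augmentation
proof -
  fix a b :: "'v word \<Rightarrow>\<^sub>0 real"
  assume "a - b \<in> two_sided_ideal radial_relators"
  then have "free_augmentation (a - b) = 0" by (rule free_augmentation_ideal)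
  then show "free_augmentation a = free_augmentation b"
    using free_augmentation_simps(3)[of "a - b" b] by simp
qed

lemma radial_augmentation_simps:
  "radial_augmentation 1 = 1"
  "radial_augmentation (a + b) = radial_augmentation a + radial_augmentation b"
  "radial_augmentation (a * b) = radial_augmentation a * radial_augmentation b"
  "radial_augmentation (t *\<^sub>R a) = t * radial_augmentation a"
proof -
  show "radial_augmentation 1 = 1"
    "radial_augmentation (a + b) = radial_augmentation a + radial_augmentation b"
    "radial_augmentation (a * b) = radial_augmentation a * radial_augmentation b"
    by (transfer, simp add: free_augmentation_simps)+
  have const: "free_augmentation (Poly_Mapping.single 0 t :: 'v word \<Rightarrow>\<^sub>0 real) = t" for t
    by (simp add: free_augmentation_def monoid_ring_ext_single)
  show "radial_augmentation (t *\<^sub>R a) = t * radial_augmentation a"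
    by transfer (simp add: free_augmentation_simps const)
qed

definition tensor_augmentation :: "('v tensor_pair \<Rightarrow>\<^sub>0 int) \<Rightarrow> coeff" where
  "tensor_augmentation =
     monoid_ring_ext of_int (\<lambda>k. case k of Pair_Mon b F \<Rightarrow> radial_augmentation F *\<^sub>R b)"

lemma tensor_augmentation_simps:
  "tensor_augmentation 0 = 0" "tensor_augmentation 1 = 1"
  "tensor_augmentation (a + b) = tensor_augmentation a + tensor_augmentation b"
  "tensor_augmentation (a * b) = tensor_augmentation a * tensor_augmentation b"
  "tensor_augmentation (free_tensor c F) = radial_augmentation F *\<^sub>R c"
proof -
  show "tensor_augmentation 0 = 0" "tensor_augmentation 1 = 1"
    unfolding tensor_augmentation_def
    by (auto simp: monoid_ring_ext_def lookup_one zero_tensor_pair_def radial_augmentation_simps)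
  show "tensor_augmentation (a + b) = tensor_augmentation a + tensor_augmentation b"
    unfolding tensor_augmentation_def by (rule monoid_ring_ext_add) auto
  show "tensor_augmentation (a * b) = tensor_augmentation a * tensor_augmentation b"
    unfolding tensor_augmentation_def
  proof (rule monoid_ring_ext_mult)
    fix k l :: "'v tensor_pair"
    show "(case k + l of Pair_Mon b F \<Rightarrow> radial_augmentation F *\<^sub>R b) =
      (case k of Pair_Mon b F \<Rightarrow> radial_augmentation F *\<^sub>R b) *
      (case l of Pair_Mon b F \<Rightarrow> radial_augmentation F *\<^sub>R b)"
      by (cases k; cases l) (simp add: radial_augmentation_simps)
  qed auto
  show "tensor_augmentation (free_tensor c F) = radial_augmentation F *\<^sub>R c"
    unfolding tensor_augmentation_def free_tensor_def by (simp add: monoid_ring_ext_single)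
qed

lemma tensor_augmentation_ideal:
  "u \<in> two_sided_ideal tensor_relators \<Longrightarrow> tensor_augmentation u = 0"
proof (erule two_sided_ideal_kernel)
  fix g :: "'v tensor_pair \<Rightarrow>\<^sub>0 int" assume "g \<in> tensor_relators"
  moreover have m: "tensor_augmentation (a - b) = tensor_augmentation a - tensor_augmentation b"
    for a b :: "'v tensor_pair \<Rightarrow>\<^sub>0 int"
    using tensor_augmentation_simps(3)[of "a - b" b] by simp
  ultimately show "tensor_augmentation g = 0"
    by (auto simp: tensor_relators_def m tensor_augmentation_simps radial_augmentation_simps
        scaleR_add_left scaleR_add_right mult.commute)
qed (simp_all add: tensor_augmentation_simps)

quotient_type 'v radialB = "'v tensor_pair \<Rightarrow>\<^sub>0 int" / "\<lambda>a b. a - b \<in> two_sided_ideal tensor_relators"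
  by (rule equivp_two_sided_ideal)

instantiation radialB :: (type) ring_1
begin
lift_definition zero_radialB :: "'v radialB" is 0 .
lift_definition one_radialB :: "'v radialB" is 1 .
lift_definition plus_radialB :: "'v radialB \<Rightarrow> 'v radialB \<Rightarrow> 'v radialB" is "(+)"
  by (rule two_sided_ideal_cong_add)
lift_definition minus_radialB :: "'v radialB \<Rightarrow> 'v radialB \<Rightarrow> 'v radialB" is "(-)"
  by (rule two_sided_ideal_cong_diff)
lift_definition uminus_radialB :: "'v radialB \<Rightarrow> 'v radialB" is uminus
  by (rule two_sided_ideal_cong_uminus)
lift_definition times_radialB :: "'v radialB \<Rightarrow> 'v radialB \<Rightarrow> 'v radialB" is "(*)"
  by (rule two_sided_ideal_cong_mult)
instance
proof
  fix a b c :: "'v radialB"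
  have eqI: "p - q \<in> two_sided_ideal tensor_relators" if "p = q" for p q :: "'v tensor_pair \<Rightarrow>\<^sub>0 int"
    using that by (simp add: two_sided_ideal.zero)
  show "a + b + c = a + (b + c)" by transfer (rule eqI, simp add: algebra_simps)
  show "a + b = b + a" by transfer (rule eqI, simp add: algebra_simps)
  show "0 + a = a" by transfer (rule eqI, simp)
  show "- a + a = 0" by transfer (rule eqI, simp)
  show "a - b = a + - b" by transfer (rule eqI, simp)
  show "a * b * c = a * (b * c)" by transfer (rule eqI, simp add: mult.assoc)
  show "1 * a = a" by transfer (rule eqI, simp)
  show "a * 1 = a" by transfer (rule eqI, simp)
  show "(a + b) * c = a * c + b * c" by transfer (rule eqI, simp add: algebra_simps)
  show "a * (b + c) = a * b + a * c" by transfer (rule eqI, simp add: algebra_simps)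
  show "(0::'v radialB) \<noteq> 1"
  proof (transfer, rule notI)
    assume "(0::'v tensor_pair \<Rightarrow>\<^sub>0 int) - 1 \<in> two_sided_ideal tensor_relators"
    then have "- (0 - 1 :: 'v tensor_pair \<Rightarrow>\<^sub>0 int) \<in> two_sided_ideal tensor_relators"
      by (rule two_sided_ideal_uminus)
    then have "tensor_augmentation (1 :: 'v tensor_pair \<Rightarrow>\<^sub>0 int) = 0"
      using tensor_augmentation_ideal by force
    then show False by (simp add: tensor_augmentation_simps)
  qed
qed
end

lift_definition tensor :: "coeff \<Rightarrow> 'v radial \<Rightarrow> 'v radialB" is free_tensor .

definition scal :: "coeff \<Rightarrow> 'v radialB" where "scal b = tensor b 1"

definition vec :: "'v \<Rightarrow> 'v radialB" where "vec v = tensor 1 (radial_var v)"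

definition wedge :: "'v list \<Rightarrow> 'v radialB" where
  "wedge us = tensor 1
     ((1 / fact (length us)) *\<^sub>R
       (\<Sum>\<pi> | \<pi> permutes {..<length us}.
          of_int (sign \<pi>) * prod_list (map (\<lambda>i. radial_var (us ! \<pi> i)) [0..<length us])))"

section \<open>Scalar polynomials and Jackson operators\<close>

text \<open>A finite set \<open>Y\<close> of variables is given by a list \<open>ys\<close> without repetitions, so indices start
  at 0. The indeterminates \<open>Rvar\<close>, \<open>Svar i\<close> and \<open>Cvar i j\<close> (where \<open>i \<le> j\<close>) stand for
  \<open>r\<close>, \<open>s\<^sub>i\<close> and \<open>c\<^sub>i\<^sub>j\<close>.\<close>

datatype svar = Rvar | Svar nat | Cvar nat nat

type_synonym spoly = "(svar \<Rightarrow>\<^sub>0 nat) \<Rightarrow>\<^sub>0 coeff"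

definition svars :: "nat \<Rightarrow> svar list" where
  "svars N = Rvar # map Svar [0..<N] @ concat (map (\<lambda>j. map (\<lambda>i. Cvar i j) [0..<Suc j]) [0..<N])"

definition spolys :: "nat \<Rightarrow> spoly set" where
  "spolys N = {f. \<forall>m\<in>Poly_Mapping.keys f. Poly_Mapping.keys m \<subseteq> set (svars N)}"

fun sval :: "'v \<Rightarrow> 'v list \<Rightarrow> svar \<Rightarrow> 'v radialB" where
  "sval x ys Rvar = vec x ^ 2"
| "sval x ys (Svar i) = anticommutator (vec x) (vec (ys ! i))"
| "sval x ys (Cvar i j) = anticommutator (vec (ys ! i)) (vec (ys ! j))"

text \<open>The isomorphism from the formal polynomials in \<^term>\<open>spolys (length ys)\<close> to the subalgebra
  \<open>\<A>\<^sub>x(Y)\<close>.\<close>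

definition seval :: "'v \<Rightarrow> 'v list \<Rightarrow> spoly \<Rightarrow> 'v radialB" where
  "seval x ys f =
     (\<Sum>m\<in>Poly_Mapping.keys f.
        scal (Poly_Mapping.lookup f m) *
        prod_list (map (\<lambda>v. sval x ys v ^ Poly_Mapping.lookup m v) (svars (length ys))))"

text \<open>Substituting \<open>P u\<close> for \<open>u\<close> multiplies the coefficient of a monomial of degree \<open>k\<close> in \<open>u\<close>
  by \<open>P\<^sup>k\<close>.\<close>

definition jackson_shift :: "svar \<Rightarrow> coeff \<Rightarrow> spoly \<Rightarrow> spoly" where
  "jackson_shift u P f = Poly_Mapping.mapp (\<lambda>m c. P ^ Poly_Mapping.lookup m u * c) f"

definition jackson_deriv :: "svar \<Rightarrow> coeff \<Rightarrow> spoly \<Rightarrow> spoly" where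
  "jackson_deriv u P f =
     (THE g. Poly_Mapping.single 0 (1 - P) * Poly_Mapping.single (Poly_Mapping.single u 1) 1 * g
        = f - jackson_shift u P f)"

definition scalar_deriv :: "'v \<Rightarrow> 'v list \<Rightarrow> spoly \<Rightarrow> 'v radialB" where
  "scalar_deriv x ys A =
     scal (1 + q) * vec x * seval x ys (jackson_deriv Rvar (q\<^sup>2) A) +
     2 * (\<Sum>i<length ys. vec (ys ! i) *
            seval x ys (jackson_shift Rvar (q\<^sup>2) (jackson_deriv (Svar i) q A)))"

section \<open>The operators on the radial algebra\<close>

definition B_linear :: "('v radialB \<Rightarrow> 'v radialB) \<Rightarrow> bool" where
  "B_linear T \<longleftrightarrow> (\<forall>F G. T (F + G) = T F + T G) \<and> (\<forall>b F. T (scal b * F) = scal b * T F)"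

text \<open>The defining formulas are imposed simultaneously for all finite \<open>Y\<close> not containing \<open>x\<close>
  and all enumerations of \<open>Y\<close>: the operator on the whole algebra is the one that restricts to the
  prescribed operator on each subalgebra generated by \<open>x\<close> and \<open>Y\<close>. The parameter \<open>I\<close> is a set
  of positions in the enumeration, and \<^term>\<open>nths ys I\<close> lists \<open>Y\<close> at these positions in
  increasing order.\<close>

definition is_right_q_deriv :: "'v \<Rightarrow> ('v radialB \<Rightarrow> 'v radialB) \<Rightarrow> bool" where
  "is_right_q_deriv x D \<longleftrightarrow> B_linear D \<and>
     (\<forall>ys I. distinct ys \<and> x \<notin> set ys \<and> I \<subseteq> {..<length ys} \<longrightarrow>
       (let y\<^sub>I = wedge (nths ys I); xy\<^sub>I = wedge (x # nths ys I); p = card I in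
         (\<forall>A\<in>spolys (length ys). D (y\<^sub>I * seval x ys A) = y\<^sub>I * scalar_deriv x ys A) \<and>
         (\<forall>B\<in>spolys (length ys). D (xy\<^sub>I * seval x ys B) =
            (-1) ^ p * scal (q_num_m (- int p)) * y\<^sub>I * seval x ys B +
            scal (q_pow_m (- int p)) * xy\<^sub>I * scalar_deriv x ys B)))"

definition right_q_deriv :: "'v \<Rightarrow> 'v radialB \<Rightarrow> 'v radialB" where
  "right_q_deriv x = (THE D. is_right_q_deriv x D)"

definition is_creation :: "'v \<Rightarrow> ('v radialB \<Rightarrow> 'v radialB) \<Rightarrow> bool" where
  "is_creation x C \<longleftrightarrow> (\<forall>F G. C (F + G) = C F + C G) \<and>
     (\<forall>ys I. distinct ys \<and> x \<notin> set ys \<and> I \<subseteq> {..<length ys} \<longrightarrow>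
       (\<forall>A\<in>spolys (length ys).
          C (wedge (nths ys I) * seval x ys A) = wedge (x # nths ys I) * seval x ys A \<and>
          C (wedge (x # nths ys I) * seval x ys A) = 0))"

definition creation :: "'v \<Rightarrow> 'v radialB \<Rightarrow> 'v radialB" where
  "creation x = (THE C. is_creation x C)"

section \<open>Localization\<close>

definition green_factor :: "'v set \<Rightarrow> nat \<Rightarrow> nat \<Rightarrow> ('v \<Rightarrow> nat) \<Rightarrow> coeff" where
  "green_factor Y p a \<beta> =
     q_num_m (- int p) +
     q_pow_m (- int p) * (q_num (2 * int a) + q_pow (2 * int a) * (\<Sum>y\<in>Y. q_num (int (\<beta> y))))"

inductive_set Omega :: "'v \<Rightarrow> coeff set" for x where
  one: "1 \<in> Omega x"
| factor: "w \<in> Omega x \<Longrightarrow> finite Y \<Longrightarrow> x \<notin> Y \<Longrightarrow> p \<le> card Y \<Longrightarrow> green_factor Y p a \<beta> * w \<in> Omega x"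

text \<open>The multiplicative set depends on \<open>x\<close>, so the localization is a carrier set of classes of
  pairs rather than a type. Its operations, and the extension of an operator from the algebra to
  its localization, are given by the usual formulas on representatives.\<close>

definition frac_rel :: "'v \<Rightarrow> (('v radialB \<times> coeff) \<times> ('v radialB \<times> coeff)) set" where
  "frac_rel x = {((F, w), (G, v)). w \<in> Omega x \<and> v \<in> Omega x \<and>
     (\<exists>u\<in>Omega x. scal u * (scal v * F - scal w * G) = 0)}"

definition frac :: "'v \<Rightarrow> 'v radialB \<Rightarrow> coeff \<Rightarrow> ('v radialB \<times> coeff) set" where
  "frac x F w = frac_rel x `` {(F, w)}"

definition localized :: "'v \<Rightarrow> (coeff, ('v radialB \<times> coeff) set) module" where
  "localized x =
     \<lparr> carrier = (UNIV \<times> Omega x) // frac_rel x,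
       monoid.mult = (\<lambda>\<xi> \<eta>. \<Union>(F, w)\<in>\<xi>. \<Union>(G, v)\<in>\<eta>. frac x (F * G) (w * v)),
       monoid.one = frac x 1 1,
       ring.zero = frac x 0 1,
       ring.add = (\<lambda>\<xi> \<eta>. \<Union>(F, w)\<in>\<xi>. \<Union>(G, v)\<in>\<eta>. frac x (scal v * F + scal w * G) (w * v)),
       module.smult = (\<lambda>b \<xi>. \<Union>(F, w)\<in>\<xi>. frac x (scal b * F) w) \<rparr>"

definition extend :: "'v \<Rightarrow> ('v radialB \<Rightarrow> 'v radialB) \<Rightarrow>
    ('v radialB \<times> coeff) set \<Rightarrow> ('v radialB \<times> coeff) set" where
  "extend x T \<xi> = (\<Union>(F, w)\<in>\<xi>. frac x (T F) w)"

abbreviation right_q_deriv_loc where "right_q_deriv_loc x \<equiv> extend x (right_q_deriv x)"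

abbreviation creation_loc where "creation_loc x \<equiv> extend x (creation x)"

definition q_laplacian :: "'v \<Rightarrow> 'v radialB \<Rightarrow> 'v radialB" where
  "q_laplacian x F = right_q_deriv x (creation x F) + creation x (right_q_deriv x F)"

definition green :: "'v \<Rightarrow> ('v radialB \<times> coeff) set \<Rightarrow> ('v radialB \<times> coeff) set" where
  "green x = the_inv_into (carrier (localized x)) (extend x (q_laplacian x))"

definition P_deriv :: "'v \<Rightarrow> ('v radialB \<times> coeff) set \<Rightarrow> ('v radialB \<times> coeff) set" where
  "P_deriv x = right_q_deriv_loc x \<circ> creation_loc x \<circ> green x"

definition P_creation :: "'v \<Rightarrow> ('v radialB \<times> coeff) set \<Rightarrow> ('v radialB \<times> coeff) set" where
  "P_creation x = creation_loc x \<circ> right_q_deriv_loc x \<circ> green x"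

section \<open>Projections and direct sums of modules\<close>

definition module_endo :: "'r ring \<Rightarrow> ('r, 'm) module \<Rightarrow> ('m \<Rightarrow> 'm) \<Rightarrow> bool" where
  "module_endo R M T \<longleftrightarrow> T ` carrier M \<subseteq> carrier M \<and>
     (\<forall>F\<in>carrier M. \<forall>G\<in>carrier M. T (F \<oplus>\<^bsub>M\<^esub> G) = T F \<oplus>\<^bsub>M\<^esub> T G) \<and>
     (\<forall>b\<in>carrier R. \<forall>F\<in>carrier M. T (b \<odot>\<^bsub>M\<^esub> F) = b \<odot>\<^bsub>M\<^esub> T F)"

definition complementary_projections ::
    "'r ring \<Rightarrow> ('r, 'm) module \<Rightarrow> ('m \<Rightarrow> 'm) \<Rightarrow> ('m \<Rightarrow> 'm) \<Rightarrow> bool" where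
  "complementary_projections R M P P' \<longleftrightarrow> module_endo R M P \<and> module_endo R M P' \<and>
     (\<forall>F\<in>carrier M. P (P F) = P F \<and> P' (P' F) = P' F \<and>
        P (P' F) = \<zero>\<^bsub>M\<^esub> \<and> P' (P F) = \<zero>\<^bsub>M\<^esub> \<and> P F \<oplus>\<^bsub>M\<^esub> P' F = F)"

definition direct_sum_decomp :: "'r ring \<Rightarrow> ('r, 'm) module \<Rightarrow> 'm set \<Rightarrow> 'm set \<Rightarrow> bool" where
  "direct_sum_decomp R M U V \<longleftrightarrow> submodule U R M \<and> submodule V R M \<and>
     (\<forall>F\<in>carrier M. \<exists>!w. w \<in> U \<times> V \<and> F = fst w \<oplus>\<^bsub>M\<^esub> snd w)"

end

(*
  Both operators have descriptions that do not mention bases, so that their existence needs no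
  freeness theorem. With the grade involution F |-> F', exterior creation is F |-> (x F + F' x) / 2.
  For the derivative, the algebra acts on polynomials over itself in independent variables X_{u,v},
  a vector u acting by exterior multiplication with u plus the skew derivation v |-> X_{u,v} / 2.
  These operators satisfy the Clifford relations with Gram matrix X, so the action on 1 sends y_I A
  to y_I times the formal polynomial A, and the Jackson operators can be applied to the latter.
  Uniqueness only needs that the products y_I A and (x ^ y_I) A span.

  The Laplacian H = D C + C D maps (x ^ y_I) times a monomial to a multiple of itself, and y_I times
  a monomial to a multiple of itself plus an element of the image of C. The factors are, up to sign,
  the lambda_{p,a,beta}, so every F satisfies w F = H (K F), where w is a denominator and K lies in
  the bicommutant of H. Hence H is bijective after localization. As C C = 0, the operator C commutes
  with H and with its inverse G, so C G (D C G) = G (C D C) G = C G (H G) = C G, which makes D C G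
  idempotent; C D G is the complementary projection since D C + C D = H.
*)
theory Submission
  imports Defs "HOL-Library.Product_Plus"
begin

section \<open>Universal property of the radial algebra\<close>

text \<open>A map out of the radial algebra can only be prescribed on vectors and scalars, and it
  must then be a ring homomorphism. Everything else is extracted from an action on a larger module:
  a skew derivation is the corner of a triangular matrix, the symbol is the orbit of
  \<open>1\<close>. Formal indeterminates are named by sets of vectors and not by positions in a
  list. One symbol map therefore serves every finite Y and every enumeration of it at once, and the
  compatibility of the operators under enlargement of Y is built in. The elements y_I A and (x ^
  y_I) A are only known to span. Bijectivity of H can thus not be read off from its diagonal
  factors. The identity w F = H (K F) gives surjectivity, and injectivity follows from K H = H K,
  since w F = K (H F). The denominator w and the operator K depend on F, so solutions for two
  elements must be combined: if w - H K kills F and v - H L kills G, then the product of these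
  operators kills F + G and has the form w v - H M. This needs H, K and L to commute, which is why K
  is sought in the bicommutant and not merely as some operator.\<close>

class nonzero_ab_group = ab_group_add +
  assumes ex_nonzero: "\<exists>a. a \<noteq> 0"

instance prod :: (nonzero_ab_group, nonzero_ab_group) nonzero_ab_group
proof
  obtain a :: 'a where "a \<noteq> 0" using ex_nonzero by blast
  then show "\<exists>a::'a \<times> 'b. a \<noteq> 0" by (intro exI[of _ "(a, 0)"]) (simp add: zero_prod_def)
qed

instance poly_mapping :: (type, nonzero_ab_group) nonzero_ab_group
proof
  obtain a :: 'b where "a \<noteq> 0" using ex_nonzero by blast
  then have "Poly_Mapping.lookup (Poly_Mapping.single k a) k \<noteq> 0" for k :: 'a by simp
  then show "\<exists>a::'a \<Rightarrow>\<^sub>0 'b. a \<noteq> 0" by (metis lookup_zero)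
qed

instance radialB :: (type) nonzero_ab_group
  by standard (rule exI[of _ 1], simp)

text \<open>Target ring for actions of the algebra on a module. The type class \<open>ring_1\<close>
  demands \<open>0 \<noteq> 1\<close>, so the underlying group has to be nonzero; this is the
  purpose of \<open>nonzero_ab_group\<close>.\<close>

typedef (overloaded) 'a endo = "{f :: 'a::nonzero_ab_group \<Rightarrow> 'a. \<forall>a b. f (a + b) = f a + f b}"
  morphisms app Endo
  by (rule exI[of _ id]) simp

setup_lifting type_definition_endo

instantiation endo :: (nonzero_ab_group) ring_1
begin
lift_definition zero_endo :: "'a endo" is "\<lambda>_. 0" by simp
lift_definition one_endo :: "'a endo" is "\<lambda>a. a" by simp
lift_definition plus_endo :: "'a endo \<Rightarrow> 'a endo \<Rightarrow> 'a endo" is "\<lambda>f g a. f a + g a"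
  by (simp add: algebra_simps)
lift_definition minus_endo :: "'a endo \<Rightarrow> 'a endo \<Rightarrow> 'a endo" is "\<lambda>f g a. f a - g a"
  by (simp add: algebra_simps)
lift_definition uminus_endo :: "'a endo \<Rightarrow> 'a endo" is "\<lambda>f a. - f a"
  by simp
lift_definition times_endo :: "'a endo \<Rightarrow> 'a endo \<Rightarrow> 'a endo" is "\<lambda>f g a. f (g a)"
  by simp
instance
proof
  show "(0::'a endo) \<noteq> 1" by transfer (metis ex_nonzero)
qed (transfer; simp add: fun_eq_iff algebra_simps)+
end

lemma app_simps [simp]:
  "app 0 a = 0" "app 1 a = a" "app (f + g) a = app f a + app g a" "app (f - g) a = app f a - app g a"
  "app (f * g) a = app f (app g a)" "app (- f) a = - app f a"
  by (transfer; simp)+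

lemma endo_eqI: "(\<And>a. app f a = app g a) \<Longrightarrow> f = g"
  by transfer auto

lemma app_Endo: "(\<And>a b. f (a + b) = f a + f b) \<Longrightarrow> app (Endo f) = f"
  by (rule Endo_inverse) simp

lemma additive_props:
  fixes f :: "'a::ab_group_add \<Rightarrow> 'b::ab_group_add"
  assumes "\<And>a b. f (a + b) = f a + f b"
  shows "f 0 = 0" "f (- a) = - f a" "f (a - b) = f a - f b" "f (sum g A) = (\<Sum>i\<in>A. f (g i))"
proof -
  show z: "f 0 = 0" using assms[of 0 0] by simp
  show m: "f (- a) = - f a" for a using assms[of a "- a"] z by (simp add: eq_neg_iff_add_eq_0 add.commute)
  show "f (a - b) = f a - f b" using assms[of a "- b"] m by simp
  show "f (sum g A) = (\<Sum>i\<in>A. f (g i))"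
    by (induction A rule: infinite_finite_induct) (simp_all add: assms z)
qed

lemma additive_diff_kernel:
  fixes f :: "'a::ab_group_add \<Rightarrow> 'b::ab_group_add"
  assumes "\<And>a b. f (a + b) = f a + f b" "f (a - b) = 0"
  shows "f a = f b"
  using assms(2) additive_props(3)[of f a b, OF assms(1)] by simp

text \<open>For a target that is not commutative it is enough that the images of coefficients
  commute with the images of monoid elements. Endomorphism rings require this generality.\<close>

lemma monoid_ring_ext_mult_commuting:
  fixes p p' :: "'m::monoid_add \<Rightarrow>\<^sub>0 'c::ring_1" and c :: "'c \<Rightarrow> 'd::ring_1"
  assumes c: "c 0 = 0" "\<And>a b. c (a + b) = c a + c b" "\<And>a b. c (a * b) = c a * c b"
    and h: "\<And>k l. h (k + l) = h k * h l" and ch: "\<And>a k. h k * c a = c a * h k"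
  shows "monoid_ring_ext c h (p * p') = monoid_ring_ext c h p * monoid_ring_ext c h p'"
proof (induction p rule: poly_mapping_single_induct)
  case zero
  then show ?case by (simp add: monoid_ring_ext_def)
next
  case (single_add k a q)
  have "monoid_ring_ext c h (Poly_Mapping.single k a * p') = c a * h k * monoid_ring_ext c h p'"
  proof (induction p' rule: poly_mapping_single_induct)
    case zero
    then show ?case by (simp add: monoid_ring_ext_def)
  next
    case (single_add l b q')
    have "c a * c b * (h k * h l) = c a * h k * (c b * h l)"
      by (metis ch mult.assoc)
    with single_add show ?case
      by (simp add: distrib_left monoid_ring_ext_add c h mult_single monoid_ring_ext_single)
  qed
  with single_add show ?case
    by (simp add: distrib_right monoid_ring_ext_add c monoid_ring_ext_single)
qed

fun letters :: "'v word \<Rightarrow> 'v list" where "letters (Word us) = us"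

lemma letters_simps [simp]: "letters (k + l) = letters k @ letters l" "letters 0 = []"
  by (cases k; cases l; simp) (simp add: zero_word_def)

lemma commute_prod_list:
  fixes a :: "'a::monoid_mult"
  shows "(\<And>b. b \<in> set bs \<Longrightarrow> b * a = a * b) \<Longrightarrow> prod_list bs * a = a * prod_list bs"
proof (induction bs)
  case (Cons b bs)
  then have "prod_list (b # bs) * a = b * (a * prod_list bs)" by (simp add: mult.assoc)
  also have "\<dots> = a * prod_list (b # bs)" using Cons.prems[of b] by (simp flip: mult.assoc)
  finally show ?case .
qed simp

lemma radial_abs_cases: obtains a where "F = abs_radial a"
  by (induction F rule: radial.abs_induct) blast

lemma radialB_abs_cases: obtains a where "F = abs_radialB a"
  by (induction F rule: radialB.abs_induct) blast

text \<open>The last clause, on elements that commute with all generators, is what later lets the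
  images of the coefficients commute with the whole image of the real algebra when the tensor
  product is formed.\<close>

lemma radial_universal:
  fixes c :: "real \<Rightarrow> 'e::ring_1" and h :: "'v \<Rightarrow> 'e"
  assumes c: "c 1 = 1" "\<And>a b. c (a + b) = c a + c b" "\<And>a b. c (a * b) = c a * c b"
    and ch: "\<And>a v. h v * c a = c a * h v"
    and rel: "\<And>u v w. commutator (anticommutator (h u) (h v)) (h w) = 0"
  obtains \<Phi> :: "'v radial \<Rightarrow> 'e" where
    "\<And>F G. \<Phi> (F + G) = \<Phi> F + \<Phi> G" "\<And>F G. \<Phi> (F * G) = \<Phi> F * \<Phi> G"
    "\<And>v. \<Phi> (radial_var v) = h v" "\<And>t. \<Phi> (t *\<^sub>R 1) = c t"
    "\<And>F a. (\<And>v. a * h v = h v * a) \<Longrightarrow> (\<And>t. a * c t = c t * a) \<Longrightarrow> a * \<Phi> F = \<Phi> F * a"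
proof -
  define \<Psi> where "\<Psi> = monoid_ring_ext c (\<lambda>k. prod_list (map h (letters k)))"
  have c0: "c 0 = 0" using additive_props(1)[of c] c(2) by blast
  have add: "\<Psi> (a + b) = \<Psi> a + \<Psi> b" for a b
    unfolding \<Psi>_def by (rule monoid_ring_ext_add) (use c0 c in auto)
  have mult: "\<Psi> (a * b) = \<Psi> a * \<Psi> b" for a b
    unfolding \<Psi>_def
    by (rule monoid_ring_ext_mult_commuting) (use c0 c ch in \<open>auto intro!: commute_prod_list\<close>)
  have single: "\<Psi> (Poly_Mapping.single k a) = c a * prod_list (map h (letters k))" for k a
    unfolding \<Psi>_def by (simp add: monoid_ring_ext_single c0)
  have gen: "\<Psi> (free_gen v) = h v" for v
    by (simp add: free_gen_def single c)
  have kern: "\<Psi> u = 0" if "u \<in> two_sided_ideal radial_relators" for u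
  proof (rule two_sided_ideal_kernel[OF that])
    fix g :: "'v word \<Rightarrow>\<^sub>0 real" assume "g \<in> radial_relators"
    then obtain u v w where g: "g = commutator (anticommutator (free_gen u) (free_gen v)) (free_gen w)"
      by (auto simp: radial_relators_def)
    show "\<Psi> g = 0"
      using rel[of u v w] unfolding g commutator_def anticommutator_def
      by (simp add: additive_props(3)[of \<Psi>, OF add] add mult gen)
  qed (use additive_props(1)[of \<Psi>, OF add] add mult in auto)
  have resp: "\<Psi> a = \<Psi> b" if "a - b \<in> two_sided_ideal radial_relators" for a b
    by (rule additive_diff_kernel[of \<Psi>, OF add kern[OF that]])
  \<comment> \<open>The map depends on the local \<open>c\<close> and \<open>h\<close>, so it is
    defined through representatives; \<open>resp\<close> makes the choice immaterial.\<close>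
  define \<Phi> where "\<Phi> F = \<Psi> (rep_radial F)" for F
  have abs: "\<Phi> (abs_radial p) = \<Psi> p" for p
    unfolding \<Phi>_def by (rule resp) (simp flip: radial.abs_eq_iff add: Quotient3_abs_rep[OF Quotient3_radial])
  show thesis
  proof (rule that[of \<Phi>])
    fix F G :: "'v radial" and v t
    obtain a b where F: "F = abs_radial a" and G: "G = abs_radial b"
      by (metis radial_abs_cases)
    show "\<Phi> (F + G) = \<Phi> F + \<Phi> G" by (simp add: F G abs plus_radial.abs_eq add)
    show "\<Phi> (F * G) = \<Phi> F * \<Phi> G" by (simp add: F G abs times_radial.abs_eq mult)
    show "\<Phi> (radial_var v) = h v" by (simp add: radial_var.abs_eq abs gen)
    show "\<Phi> (t *\<^sub>R 1) = c t" by (simp add: one_radial.abs_eq scaleR_radial.abs_eq abs single)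
  next
    fix F :: "'v radial" and e
    assume e: "\<And>v. e * h v = h v * e" "\<And>t. e * c t = c t * e"
    obtain a where F: "F = abs_radial a"
      by (rule radial_abs_cases)
    have "e * \<Psi> a = \<Psi> a * e"
    proof (induction a rule: poly_mapping_single_induct)
      case zero
      then show ?case using additive_props(1)[of \<Psi>, OF add] by simp
    next
      case (single_add k a p)
      have "prod_list (map h (letters k)) * e = e * prod_list (map h (letters k))"
        by (rule commute_prod_list) (use e in auto)
      then have "e * \<Psi> (Poly_Mapping.single k a) = \<Psi> (Poly_Mapping.single k a) * e"
        unfolding single by (metis e(2) mult.assoc)
      with single_add show ?case by (simp add: add distrib_left distrib_right)
    qed
    then show "e * \<Phi> F = \<Phi> F * e" by (simp add: F abs)
  qed
qed

lemma tensor_add_left: "tensor (b + c) F = tensor b F + tensor c F"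
  and tensor_add_right: "tensor b (F + G) = tensor b F + tensor b G"
  and tensor_scaleR: "tensor (t *\<^sub>R b) F = tensor b (t *\<^sub>R F)"
proof -
  have gen: "g \<in> two_sided_ideal tensor_relators" if "g \<in> tensor_relators" for g :: "'v tensor_pair \<Rightarrow>\<^sub>0 int"
    using two_sided_ideal.gen[OF that, of 1 1] by simp
  show "tensor (b + c) F = tensor b F + tensor c F"
    unfolding tensor.abs_eq plus_radialB.abs_eq radialB.abs_eq_iff
    by (subst diff_diff_eq[symmetric], rule gen) (unfold tensor_relators_def, blast)
  show "tensor b (F + G) = tensor b F + tensor b G"
    unfolding tensor.abs_eq plus_radialB.abs_eq radialB.abs_eq_iff
    by (subst diff_diff_eq[symmetric], rule gen) (unfold tensor_relators_def, blast)
  show "tensor (t *\<^sub>R b) F = tensor b (t *\<^sub>R F)"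
    unfolding tensor.abs_eq radialB.abs_eq_iff
    by (rule gen) (unfold tensor_relators_def, blast)
qed

lemma tensor_mult: "tensor b F * tensor c G = tensor (b * c) (F * G)"
  by (simp add: tensor.abs_eq times_radialB.abs_eq free_tensor_def mult_single)

lemma tensor_1_1: "tensor 1 1 = 1"
  by (simp add: tensor.abs_eq one_radialB.abs_eq free_tensor_def zero_tensor_pair_def flip: single_one)

text \<open>Source of the grade involution, of \<open>q_rescale\<close>, of all skew derivations and
  of the Clifford action. The existential form fits definitions by \<open>SOME\<close>, whose
  properties then come from \<open>someI_ex\<close>.\<close>

lemma radialB_universal:
  fixes \<beta> :: "coeff \<Rightarrow> 'e::ring_1" and h :: "'v \<Rightarrow> 'e"
  assumes c: "\<beta> 1 = 1" "\<And>a b. \<beta> (a + b) = \<beta> a + \<beta> b" "\<And>a b. \<beta> (a * b) = \<beta> a * \<beta> b"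
    and ch: "\<And>a v. h v * \<beta> a = \<beta> a * h v"
    and rel: "\<And>u v w. commutator (anticommutator (h u) (h v)) (h w) = 0"
  shows "\<exists>\<Phi> :: 'v radialB \<Rightarrow> 'e.
    (\<forall>F G. \<Phi> (F + G) = \<Phi> F + \<Phi> G) \<and> (\<forall>F G. \<Phi> (F * G) = \<Phi> F * \<Phi> G) \<and>
    (\<forall>v. \<Phi> (vec v) = h v) \<and> (\<forall>b. \<Phi> (scal b) = \<beta> b)"
proof -
  obtain \<phi> :: "'v radial \<Rightarrow> 'e" where \<phi>:
    "\<And>F G. \<phi> (F + G) = \<phi> F + \<phi> G" "\<And>F G. \<phi> (F * G) = \<phi> F * \<phi> G"
    "\<And>v. \<phi> (radial_var v) = h v" "\<And>t. \<phi> (t *\<^sub>R 1) = \<beta> (t *\<^sub>R 1)"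
    and \<phi>_comm: "\<And>F a. (\<And>v. a * h v = h v * a) \<Longrightarrow> (\<And>t. a * \<beta> (t *\<^sub>R 1) = \<beta> (t *\<^sub>R 1) * a)
      \<Longrightarrow> a * \<phi> F = \<phi> F * a"
  proof (rule radial_universal[of "\<lambda>t. \<beta> (t *\<^sub>R 1)" h])
    show "\<beta> ((a * b) *\<^sub>R 1) = \<beta> (a *\<^sub>R 1) * \<beta> (b *\<^sub>R 1)" for a b
      by (subst c(3)[symmetric]) (simp add: mult.commute)
  qed (use c ch rel in \<open>auto simp: scaleR_add_left\<close>)
  have \<beta>\<phi>: "\<beta> b * \<phi> F = \<phi> F * \<beta> b" for b F
    by (rule \<phi>_comm) (simp add: ch, simp only: c(3)[symmetric] mult.commute)
  define \<Psi> where "\<Psi> = monoid_ring_ext (of_int :: int \<Rightarrow> 'e) (\<lambda>k. case k of Pair_Mon b F \<Rightarrow> \<beta> b * \<phi> F)"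
  have add: "\<Psi> (a + b) = \<Psi> a + \<Psi> b" for a b
    unfolding \<Psi>_def by (rule monoid_ring_ext_add) auto
  have mult: "\<Psi> (a * b) = \<Psi> a * \<Psi> b" for a b
    unfolding \<Psi>_def
  proof (rule monoid_ring_ext_mult_commuting)
    fix k l :: "'v tensor_pair" and n :: int
    obtain b F b' F' where [simp]: "k = Pair_Mon b F" "l = Pair_Mon b' F'" by (metis tensor_pair.exhaust)
    have "\<beta> b * \<beta> b' * (\<phi> F * \<phi> F') = \<beta> b * \<phi> F * (\<beta> b' * \<phi> F')"
      by (metis \<beta>\<phi> mult.assoc)
    then show "(case k + l of Pair_Mon b F \<Rightarrow> \<beta> b * \<phi> F) =
        (case k of Pair_Mon b F \<Rightarrow> \<beta> b * \<phi> F) * (case l of Pair_Mon b F \<Rightarrow> \<beta> b * \<phi> F)"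
      by (simp add: c \<phi>)
    show "(case k of Pair_Mon b F \<Rightarrow> \<beta> b * \<phi> F) * of_int n = of_int n * (case k of Pair_Mon b F \<Rightarrow> \<beta> b * \<phi> F)"
      by (rule mult_of_int_commute[symmetric])
  qed auto
  have gen: "\<Psi> (free_tensor b F) = \<beta> b * \<phi> F" for b F
    unfolding \<Psi>_def free_tensor_def by (simp add: monoid_ring_ext_single)
  note diff = additive_props(3)[of \<Psi>, OF add]
  have kern: "\<Psi> u = 0" if "u \<in> two_sided_ideal tensor_relators" for u
  proof (rule two_sided_ideal_kernel[OF that])
    have t: "\<beta> (t *\<^sub>R b) * \<phi> F = \<beta> b * \<phi> (t *\<^sub>R F)" for t b F
    proof -
      have "\<beta> (t *\<^sub>R b) = \<beta> b * \<beta> (t *\<^sub>R 1)" by (subst c(3)[symmetric]) simp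
      moreover have "\<phi> (t *\<^sub>R F) = \<beta> (t *\<^sub>R 1) * \<phi> F" using \<phi>(2)[of "t *\<^sub>R 1" F] by (simp add: \<phi>(4))
      ultimately show ?thesis by (simp add: mult.assoc)
    qed
    fix g :: "'v tensor_pair \<Rightarrow>\<^sub>0 int" assume "g \<in> tensor_relators"
    then show "\<Psi> g = 0"
      by (auto simp: tensor_relators_def diff gen c \<phi> t distrib_left distrib_right)
  qed (use additive_props(1)[of \<Psi>, OF add] add mult in auto)
  have resp: "\<Psi> a = \<Psi> b" if "a - b \<in> two_sided_ideal tensor_relators" for a b
    by (rule additive_diff_kernel[of \<Psi>, OF add kern[OF that]])
  define \<Phi> where "\<Phi> F = \<Psi> (rep_radialB F)" for F
  have abs: "\<Phi> (abs_radialB p) = \<Psi> p" for p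
    unfolding \<Phi>_def by (rule resp) (simp flip: radialB.abs_eq_iff add: Quotient3_abs_rep[OF Quotient3_radialB])
  have ten: "\<Phi> (tensor b F) = \<beta> b * \<phi> F" for b F
    by (simp add: tensor.abs_eq abs gen)
  show ?thesis
  proof (intro exI[of _ \<Phi>] conjI allI)
    fix F G :: "'v radialB" and v b
    obtain x y where F: "F = abs_radialB x" and G: "G = abs_radialB y"
      by (metis radialB_abs_cases)
    show "\<Phi> (F + G) = \<Phi> F + \<Phi> G" by (simp add: F G abs plus_radialB.abs_eq add)
    show "\<Phi> (F * G) = \<Phi> F * \<Phi> G" by (simp add: F G abs times_radialB.abs_eq mult)
    show "\<Phi> (vec v) = h v" by (simp add: vec_def ten c \<phi>)
    show "\<Phi> (scal b) = \<beta> b" using \<phi>(4)[of 1] by (simp add: scal_def ten c)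
  qed
qed

section \<open>The coefficients inside the algebra, and induction along left multiplication\<close>

lemma scal_simps [simp]: "scal 0 = 0" "scal 1 = 1"
  and scal_add: "scal (b + c) = scal b + scal c" and scal_mult: "scal (b * c) = scal b * scal c"
  and scal_uminus: "scal (- b) = - scal b" and scal_diff: "scal (b - c) = scal b - scal c"
  and scal_power: "scal (b ^ k) = scal b ^ k"
proof -
  show add: "scal (b + c) = scal b + scal c" for b c by (simp add: scal_def tensor_add_left)
  show mult: "scal (b * c) = scal b * scal c" for b c by (simp add: scal_def tensor_mult)
  show one: "scal 1 = 1" by (simp add: scal_def tensor_1_1)
  show "scal (b ^ k) = scal b ^ k" by (induction k) (simp_all add: mult one)
  show "scal 0 = 0" "scal (- b) = - scal b" "scal (b - c) = scal b - scal c"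
    using additive_props[of scal, OF add] by blast+
qed

lemma radial_induct [case_names one add scaleR var]:
  assumes "P 1" "\<And>F G. P F \<Longrightarrow> P G \<Longrightarrow> P (F + G)" "\<And>t F. P F \<Longrightarrow> P (t *\<^sub>R F)"
    "\<And>v F. P F \<Longrightarrow> P (radial_var v * F)"
  shows "P F"
proof -
  obtain p where F: "F = abs_radial p"
    by (rule radial_abs_cases)
  have word: "P (abs_radial (Poly_Mapping.single k 1))" for k
  proof (induction k)
    case (Word us)
    show ?case
    proof (induction us)
      case Nil
      have "Poly_Mapping.single (Word ([]::'a list)) (1::real) = 1"
        by (simp add: zero_word_def flip: single_one)
      then show ?case using assms(1) by (simp add: one_radial.abs_eq)
    next
      case (Cons u us)
      have "Poly_Mapping.single (Word (u # us)) (1::real) = free_gen u * Poly_Mapping.single (Word us) 1"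
        by (simp add: free_gen_def mult_single)
      then show ?case using assms(4)[OF Cons, of u]
        by (simp add: radial_var.abs_eq times_radial.abs_eq)
    qed
  qed
  show ?thesis unfolding F
  proof (induction p rule: poly_mapping_single_induct)
    case zero
    show ?case using assms(3)[OF assms(1), of 0] by (simp add: zero_radial.abs_eq)
  next
    case (single_add k a p)
    have "Poly_Mapping.single k a = Poly_Mapping.single 0 a * Poly_Mapping.single k 1"
      by (simp add: mult_single)
    then have "abs_radial (Poly_Mapping.single k a + p) =
        a *\<^sub>R abs_radial (Poly_Mapping.single k 1) + abs_radial p"
      by (simp add: plus_radial.abs_eq scaleR_radial.abs_eq)
    with single_add show ?case using assms(2,3) word by simp
  qed
qed

lemma radialB_induct [case_names one add scal vec]:
  assumes one: "P 1" and add: "\<And>F G. P F \<Longrightarrow> P G \<Longrightarrow> P (F + G)"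
    and scal: "\<And>b F. P F \<Longrightarrow> P (scal b * F)" and vec: "\<And>v F. P F \<Longrightarrow> P (vec v * F)"
  shows "P F"
proof -
  obtain p where F: "F = abs_radialB p"
    by (rule radialB_abs_cases)
  have P0: "P 0" using scal[OF one, of 0] by simp
  have P_minus: "P (- F)" if "P F" for F
    using scal[OF that, of "- 1"] by (simp add: scal_uminus)
  have P1: "P (tensor 1 G)" for G
  proof (induction G rule: radial_induct)
    case one
    then show ?case using assms(1) by (simp add: tensor_1_1)
  next
    case (add F G)
    then show ?case using assms(2) by (simp add: tensor_add_right)
  next
    case (scaleR t F)
    have "tensor 1 (t *\<^sub>R F) = scal (t *\<^sub>R 1) * tensor 1 F"
      by (simp add: scal_def tensor_mult tensor_scaleR)
    then show ?case using scal scaleR by simp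
  next
    case (var v F)
    then show ?case using vec[of "tensor 1 F" v] by (simp add: vec_def tensor_mult)
  qed
  have ten: "P (tensor b G)" for b G
    using scal[OF P1, of b G] by (simp add: scal_def tensor_mult)
  have single: "P (abs_radialB (Poly_Mapping.single k n))" for k n
  proof (cases k)
    case k: (Pair_Mon b G)
    \<comment> \<open>The tensor product is presented with integer coefficients, so a coefficient is
      reached by repeated addition and then by a sign.\<close>
    have nat: "P (abs_radialB (Poly_Mapping.single k (int i)))" for i
    proof (induction i)
      case 0
      then show ?case using P0 by (simp add: zero_radialB.abs_eq)
    next
      case (Suc i)
      have "abs_radialB (Poly_Mapping.single k (int (Suc i))) =
        tensor b G + abs_radialB (Poly_Mapping.single k (int i))"
        by (simp add: k tensor.abs_eq free_tensor_def plus_radialB.abs_eq flip: single_add)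
      then show ?case using add[OF ten Suc] by simp
    qed
    show ?thesis
    proof (cases n rule: int_cases)
      case (nonneg i)
      then show ?thesis using nat by simp
    next
      case (neg i)
      then have "abs_radialB (Poly_Mapping.single k n) = - abs_radialB (Poly_Mapping.single k (int (Suc i)))"
        by (simp add: uminus_radialB.abs_eq single_uminus del: of_nat_Suc)
      then show ?thesis using P_minus[OF nat] by (simp del: of_nat_Suc)
    qed
  qed
  show ?thesis unfolding F
  proof (induction p rule: poly_mapping_single_induct)
    case zero
    show ?case using P0 by (simp add: zero_radialB.abs_eq)
  next
    case (single_add k a p)
    then show ?case using add[OF single[of k a] single_add] by (simp add: plus_radialB.abs_eq)
  qed
qed

section \<open>Exterior and interior multiplication\<close>

lemma commute_left:
  fixes a :: "'a::semigroup_mult"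
  assumes "a * b = b * a" shows "a * (b * c) = b * (a * c)"
  by (simp only: mult.assoc[symmetric] assms)

lemma scal_central: "F * scal b = scal b * F"
proof (induction F rule: radialB_induct)
  case (vec v F)
  have v: "vec v * scal b = scal b * vec v" by (simp add: scal_def vec_def tensor_mult)
  show ?case by (simp only: mult.assoc vec commute_left[OF v])
next
  case (scal c F)
  have c: "scal c * scal b = scal b * scal c" by (simp add: mult.commute flip: scal_mult)
  show ?case by (simp only: mult.assoc scal commute_left[OF c])
qed (simp_all add: distrib_left distrib_right)

lemmas scal_left_commute = commute_left[OF scal_central]

lemma anticommutator_vec_central: "F * anticommutator (vec u) (vec v) = anticommutator (vec u) (vec v) * F"
proof (induction F rule: radialB_induct)
  case (vec w F)
  let ?f = "free_gen :: 'a \<Rightarrow> _"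
  have "commutator (anticommutator (?f u) (?f v)) (?f w) \<in> two_sided_ideal radial_relators"
    using two_sided_ideal.gen[of "commutator (anticommutator (?f u) (?f v)) (?f w)" radial_relators 1 1]
    unfolding radial_relators_def by auto
  then have "abs_radial (commutator (anticommutator (?f u) (?f v)) (?f w)) = abs_radial 0"
    by (simp add: radial.abs_eq_iff)
  then have "commutator (anticommutator (radial_var u) (radial_var v)) (radial_var w :: 'a radial) = 0"
    by (simp add: commutator_def anticommutator_def radial_var.abs_eq zero_radial.abs_eq
        flip: minus_radial.abs_eq times_radial.abs_eq plus_radial.abs_eq)
  then have "anticommutator (radial_var u) (radial_var v) * radial_var w =
      radial_var w * (anticommutator (radial_var u) (radial_var v) :: 'a radial)"
    by (simp add: commutator_def)
  then have "anticommutator (vec u) (vec v) * vec w = vec w * anticommutator (vec u) (vec v :: 'a radialB)"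
    by (simp add: anticommutator_def vec_def tensor_mult flip: tensor_add_right)
  then show ?case by (simp only: mult.assoc vec commute_left[of "vec w"])
next
  case (scal c F)
  show ?case by (simp only: mult.assoc scal commute_left[OF scal_central[of _ c, symmetric]])
qed (simp_all add: distrib_left distrib_right)

lemma anticommutator_commute: "anticommutator a b = anticommutator b a"
  by (simp add: anticommutator_def add.commute)

text \<open>An element, because \<open>radialB\<close> is set up as a ring and not as a real vector
  space. It is central, even and splits \<open>1\<close> into two equal summands, which also rules
  out 2-torsion.\<close>

definition half :: "'v radialB" where "half = scal ((1 / 2) *\<^sub>R 1)"

lemma half_add_half: "half + half = 1"
  by (simp add: half_def flip: scal_add scaleR_add_left)

lemma half_mult_add: "half * F + half * F = F"
  by (simp add: half_add_half flip: distrib_right)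

lemma half_mult_2: "half * (2 * F) = F" "2 * (half * F) = F"
  using half_mult_add[of F] by (simp_all add: mult_2 distrib_left)

lemma half_central: "F * half = half * F" "F * (half * G) = half * (F * G)"
  unfolding half_def by (rule scal_central, rule scal_left_commute)

text \<open>The involution exists because every relator is homogeneous of degree three: changing the
  sign of all vectors only changes the sign of the relator.\<close>

definition grade_inv :: "'v radialB \<Rightarrow> 'v radialB" where
  "grade_inv = (SOME \<Phi>. (\<forall>F G. \<Phi> (F + G) = \<Phi> F + \<Phi> G) \<and> (\<forall>F G. \<Phi> (F * G) = \<Phi> F * \<Phi> G) \<and>
    (\<forall>v. \<Phi> (vec v) = - vec v) \<and> (\<forall>b. \<Phi> (scal b) = scal b))"

lemma
  fixes F G :: "'v radialB" and v :: 'v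
  shows grade_inv_add: "grade_inv (F + G) = grade_inv F + grade_inv G"
  and grade_inv_mult: "grade_inv (F * G) = grade_inv F * grade_inv G"
  and grade_inv_vec [simp]: "grade_inv (vec v) = - vec v"
  and grade_inv_scal [simp]: "grade_inv (scal b :: 'v radialB) = scal b"
proof -
  have "\<exists>\<Phi> :: 'v radialB \<Rightarrow> 'v radialB.
    (\<forall>F G. \<Phi> (F + G) = \<Phi> F + \<Phi> G) \<and> (\<forall>F G. \<Phi> (F * G) = \<Phi> F * \<Phi> G) \<and>
    (\<forall>v. \<Phi> (vec v) = - vec v) \<and> (\<forall>b. \<Phi> (scal b) = scal b)"
  proof (rule radialB_universal)
    show "commutator (anticommutator (- vec u) (- vec v)) (- vec w :: 'v radialB) = 0" for u v w
      using anticommutator_vec_central[of "vec w" u v] by (simp add: commutator_def anticommutator_def)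
  qed (simp_all add: scal_add scal_mult scal_central[of "vec _"])
  from someI_ex[OF this, folded grade_inv_def]
  show "grade_inv (F + G) = grade_inv F + grade_inv G" "grade_inv (F * G) = grade_inv F * grade_inv G"
    "grade_inv (vec v) = - vec v" "grade_inv (scal b :: 'v radialB) = scal b" by blast+
qed

lemmas grade_inv_additive = additive_props[of grade_inv, OF grade_inv_add]

lemma grade_inv_1 [simp]: "grade_inv 1 = 1" and grade_inv_half [simp]: "grade_inv half = half"
  by (simp_all add: half_def flip: scal_simps)

lemma grade_inv_grade_inv [simp]: "grade_inv (grade_inv F) = F"
  by (induction F rule: radialB_induct)
    (simp_all add: grade_inv_add grade_inv_mult grade_inv_additive)

text \<open>Homogeneity of the relators also permits scaling of all vectors. This detects the number
  of factors of an exterior product without a grading being defined.\<close>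

definition q_rescale :: "'v radialB \<Rightarrow> 'v radialB" where
  "q_rescale = (SOME \<Phi>. (\<forall>F G. \<Phi> (F + G) = \<Phi> F + \<Phi> G) \<and> (\<forall>F G. \<Phi> (F * G) = \<Phi> F * \<Phi> G) \<and>
    (\<forall>v. \<Phi> (vec v) = scal q_inv * vec v) \<and> (\<forall>b. \<Phi> (scal b) = scal b))"

lemma
  fixes F G :: "'v radialB" and v :: 'v
  shows q_rescale_add: "q_rescale (F + G) = q_rescale F + q_rescale G"
  and q_rescale_mult: "q_rescale (F * G) = q_rescale F * q_rescale G"
  and q_rescale_vec [simp]: "q_rescale (vec v) = scal q_inv * vec v"
  and q_rescale_scal [simp]: "q_rescale (scal b :: 'v radialB) = scal b"
proof -
  have ac: "anticommutator (scal q_inv * vec u) (scal q_inv * vec v) =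
      scal q_inv * scal q_inv * anticommutator (vec u) (vec v :: 'v radialB)" for u v
    unfolding anticommutator_def by (simp add: distrib_left mult.assoc scal_left_commute[of "vec _"])
  have "\<exists>\<Phi> :: 'v radialB \<Rightarrow> 'v radialB.
    (\<forall>F G. \<Phi> (F + G) = \<Phi> F + \<Phi> G) \<and> (\<forall>F G. \<Phi> (F * G) = \<Phi> F * \<Phi> G) \<and>
    (\<forall>v. \<Phi> (vec v) = scal q_inv * vec v) \<and> (\<forall>b. \<Phi> (scal b) = scal b)"
  proof (rule radialB_universal)
    show "commutator (anticommutator (scal q_inv * vec u) (scal q_inv * vec v)) (scal q_inv * vec w :: 'v radialB) = 0"
      for u v w
      unfolding ac commutator_def
      by (simp add: mult.assoc scal_left_commute[of "anticommutator _ _"] scal_left_commute[of "vec _"]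
          anticommutator_vec_central[of "vec w"] scal_central[of "anticommutator _ _"])
  qed (simp_all add: scal_add scal_mult scal_central[of "vec _"] mult.assoc scal_left_commute[of "scal q_inv", symmetric])
  from someI_ex[OF this, folded q_rescale_def]
  show "q_rescale (F + G) = q_rescale F + q_rescale G" "q_rescale (F * G) = q_rescale F * q_rescale G"
    "q_rescale (vec v) = scal q_inv * vec v" "q_rescale (scal b :: 'v radialB) = scal b" by blast+
qed

section \<open>Skew derivations\<close>

text \<open>The operator \<open>d\<close> is read off from the action of the algebra on \<open>T \<times> T\<close> in which
  \<open>F\<close> acts by the triangular matrix with diagonal entries \<open>\<psi> (grade_inv F)\<close>, \<open>\<psi> F\<close> and
  corner \<open>d F\<close>.\<close>

lemma skew_derivation_exists:
  fixes \<psi> :: "'v radialB \<Rightarrow> 't::{ring_1, nonzero_ab_group}" and h :: "'v \<Rightarrow> 't"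
  assumes add: "\<And>F G. \<psi> (F + G) = \<psi> F + \<psi> G" and mult: "\<And>F G. \<psi> (F * G) = \<psi> F * \<psi> G"
    and one: "\<psi> 1 = 1" and central: "\<And>v a. a * h v = h v * a"
  shows "\<exists>d. (\<forall>F G. d (F + G) = d F + d G) \<and>
    (\<forall>F G. d (F * G) = d F * \<psi> G + \<psi> (grade_inv F) * d G) \<and>
    (\<forall>v. d (vec v) = h v) \<and> (\<forall>b. d (scal b) = 0)"
proof -
  note \<psi>_additive = additive_props[of \<psi>, OF add]
  define V where "V v = Endo (\<lambda>(a, b). (- \<psi> (vec v) * a + h v * b, \<psi> (vec v) * b))" for v
  define B where "B c = Endo (\<lambda>(a::'t, b::'t). (\<psi> (scal c) * a, \<psi> (scal c) * b))" for c
  have V: "app (V v) (a, b) = (- \<psi> (vec v) * a + h v * b, \<psi> (vec v) * b)" for v a b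
    unfolding V_def by (subst app_Endo) (auto simp: algebra_simps)
  have B: "app (B c) (a, b) = (\<psi> (scal c) * a, \<psi> (scal c) * b)" for c a b
    unfolding B_def by (subst app_Endo) (auto simp: algebra_simps)
  \<comment> \<open>The corner of the anticommutator is h(u)v - u h(v) + h(v)u - v h(u), which
    vanishes because the values of \<open>h\<close> are central. Only a scalar matrix remains,
    whence the radial relation.\<close>
  have anti: "app (anticommutator (V u) (V v)) (a, b) =
      (\<psi> (anticommutator (vec u) (vec v)) * a, \<psi> (anticommutator (vec u) (vec v)) * b)" for u v a b
  proof -
    have "\<psi> (vec u) * (h v * b) = h v * (\<psi> (vec u) * b)" for u v
      by (rule commute_left[OF central])
    then show ?thesis
      by (simp add: anticommutator_def V add mult algebra_simps)
  qed
  obtain \<Phi> :: "'v radialB \<Rightarrow> ('t \<times> 't) endo" where \<Phi>: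
    "\<And>F G. \<Phi> (F + G) = \<Phi> F + \<Phi> G" "\<And>F G. \<Phi> (F * G) = \<Phi> F * \<Phi> G"
    "\<And>v. \<Phi> (vec v) = V v" "\<And>b. \<Phi> (scal b) = B b"
  proof -
    have "\<exists>\<Phi> :: 'v radialB \<Rightarrow> ('t \<times> 't) endo.
      (\<forall>F G. \<Phi> (F + G) = \<Phi> F + \<Phi> G) \<and> (\<forall>F G. \<Phi> (F * G) = \<Phi> F * \<Phi> G) \<and>
      (\<forall>v. \<Phi> (vec v) = V v) \<and> (\<forall>b. \<Phi> (scal b) = B b)"
    proof (rule radialB_universal)
      have scal_comm: "\<psi> (scal c) * (\<psi> F * b) = \<psi> F * (\<psi> (scal c) * b)" for c F b
        by (rule commute_left) (simp add: scal_central flip: mult)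
      have scal_h: "\<psi> (scal c) * (h v * b) = h v * (\<psi> (scal c) * b)" for c v b
        by (rule commute_left[OF central])
      have anti_comm: "\<psi> (anticommutator (vec u) (vec v)) * (\<psi> F * b) =
          \<psi> F * (\<psi> (anticommutator (vec u) (vec v)) * b)" for u v F b
        by (rule commute_left) (simp add: anticommutator_vec_central flip: mult)
      have anti_h: "\<psi> (anticommutator (vec u) (vec v)) * (h w * b) =
          h w * (\<psi> (anticommutator (vec u) (vec v)) * b)" for u v w b
        by (rule commute_left[OF central])
      show "V v * B c = B c * V v" for v c
        by (rule endo_eqI) (auto simp: V B scal_comm scal_h distrib_left right_diff_distrib)
      show "commutator (anticommutator (V u) (V v)) (V w) = 0" for u v w
        by (rule endo_eqI) (auto simp: V commutator_def anti anti_comm anti_h distrib_left right_diff_distrib zero_prod_def)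
    qed (auto intro!: endo_eqI simp: B scal_add scal_mult add mult one distrib_right mult.assoc)
    then show thesis using that by blast
  qed
  \<comment> \<open>The universal property does not reveal the shape of \<open>\<Phi> F\<close>;
    triangularity is recovered by induction. The skew product rule for the corner is then matrix
    multiplication.\<close>
  have form: "\<exists>D. \<forall>a b. app (\<Phi> F) (a, b) = (\<psi> (grade_inv F) * a + D * b, \<psi> F * b)" for F
  proof (induction F rule: radialB_induct)
    case one
    show ?case using \<Phi>(4)[of 1] by (intro exI[of _ 0]) (simp add: B \<open>\<psi> 1 = 1\<close>)
  next
    case (add F G)
    then obtain D D' where "\<And>a b. app (\<Phi> F) (a, b) = (\<psi> (grade_inv F) * a + D * b, \<psi> F * b)"
      "\<And>a b. app (\<Phi> G) (a, b) = (\<psi> (grade_inv G) * a + D' * b, \<psi> G * b)" by blast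
    then show ?case
      by (intro exI[of _ "D + D'"]) (simp add: \<Phi> assms(1) grade_inv_add algebra_simps)
  next
    case (scal c F)
    then obtain D where "\<And>a b. app (\<Phi> F) (a, b) = (\<psi> (grade_inv F) * a + D * b, \<psi> F * b)" by blast
    then show ?case
      by (intro exI[of _ "\<psi> (scal c) * D"]) (simp add: \<Phi> B assms(2) grade_inv_mult algebra_simps)
  next
    case (vec v F)
    then obtain D where "\<And>a b. app (\<Phi> F) (a, b) = (\<psi> (grade_inv F) * a + D * b, \<psi> F * b)" by blast
    then show ?case
      by (intro exI[of _ "h v * \<psi> F - \<psi> (vec v) * D"])
        (simp add: \<Phi> V assms(2) grade_inv_mult \<psi>_additive algebra_simps)
  qed
  define d where "d F = fst (app (\<Phi> F) (0, 1))" for F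
  have app_\<Phi>: "app (\<Phi> F) (a, b) = (\<psi> (grade_inv F) * a + d F * b, \<psi> F * b)" for F a b
    using form[of F] by (auto simp: d_def)
  show ?thesis
  proof (intro exI[of _ d] conjI allI)
    show "d (F + G) = d F + d G" for F G by (simp add: d_def \<Phi>)
    show "d (F * G) = d F * \<psi> G + \<psi> (grade_inv F) * d G" for F G
    proof -
      have "d (F * G) = fst (app (\<Phi> F) (app (\<Phi> G) (0, 1)))" by (simp add: d_def \<Phi>)
      then show ?thesis by (simp add: app_\<Phi> add.commute)
    qed
    show "d (vec v) = h v" for v by (simp add: d_def \<Phi> V)
    show "d (scal b) = 0" for b by (simp add: d_def \<Phi> B)
  qed
qed

text \<open>A skew derivation whose values on vectors are even reverses parity;
  \<open>\<beta>\<close> is the grade involution of the target.\<close>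

lemma skew_derivation_grade_inv:
  fixes \<beta> :: "'t::ring_1 \<Rightarrow> 't" and d :: "'v radialB \<Rightarrow> 't"
  assumes "\<And>F G. d (F + G) = d F + d G" "\<And>F G. d (F * G) = d F * \<psi> G + \<psi> (grade_inv F) * d G"
    "\<And>v. d (vec v) = h v" "\<And>b. d (scal b) = 0"
    and "\<And>F G. \<beta> (F + G) = \<beta> F + \<beta> G" "\<And>F G. \<beta> (F * G) = \<beta> F * \<beta> G" "\<And>v. \<beta> (h v) = h v"
    and "\<And>F. \<beta> (\<psi> F) = \<psi> (grade_inv F)" "\<And>F. \<psi> (- F) = - \<psi> F"
  shows "\<beta> (d F) = - d (grade_inv (F :: 'v radialB)) "
proof -
  note \<beta>0 = additive_props[of \<beta>, OF assms(5)]
  note d0 = additive_props[of d, OF assms(1)]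
  show ?thesis
  proof (induction F rule: radialB_induct)
    case one
    show ?case using assms(4)[of 1] by (simp add: \<beta>0)
  qed (simp_all add: assms grade_inv_mult grade_inv_add grade_inv_additive d0 \<beta>0)
qed

section \<open>Exterior and interior products with a vector\<close>

definition ext_mult :: "'v \<Rightarrow> 'v radialB \<Rightarrow> 'v radialB" where
  "ext_mult u F = half * (vec u * F + grade_inv F * vec u)"

definition int_mult :: "'v \<Rightarrow> 'v radialB \<Rightarrow> 'v radialB" where
  "int_mult u F = half * (vec u * F - grade_inv F * vec u)"

lemma vec_mult_eq: "vec u * F = ext_mult u F + int_mult u F"
  unfolding ext_mult_def int_mult_def
  by (simp add: algebra_simps half_mult_add)

lemma ext_mult_add: "ext_mult u (F + G) = ext_mult u F + ext_mult u G"
  by (simp add: ext_mult_def grade_inv_add algebra_simps)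

lemma int_mult_add: "int_mult u (F + G) = int_mult u F + int_mult u G"
  by (simp add: int_mult_def grade_inv_add algebra_simps)

lemmas ext_mult_additive = additive_props[of "ext_mult u" for u, OF ext_mult_add]
lemmas int_mult_additive = additive_props[of "int_mult u" for u, OF int_mult_add]

text \<open>The interior product is half the graded commutator with \<open>vec u\<close>, and graded
  commutators are skew derivations.\<close>

lemma int_mult_mult: "int_mult u (F * G) = int_mult u F * G + grade_inv F * int_mult u G"
  unfolding int_mult_def grade_inv_mult by (simp add: algebra_simps half_central(2)[of "grade_inv F"])

lemma int_mult_vec: "int_mult u (vec v) = half * anticommutator (vec u) (vec v)"
  by (simp add: int_mult_def anticommutator_def)

lemma int_mult_scal: "int_mult u (scal b) = 0"
  by (simp add: int_mult_def scal_central[of "vec u"])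

text \<open>These elements play the role of scalars: exterior multiplication is linear over them and
  interior multiplication annihilates them. All r, s_i and c_ij are of this kind.\<close>

definition even_central :: "'v radialB \<Rightarrow> bool" where
  "even_central Z \<longleftrightarrow> (\<forall>F. F * Z = Z * F) \<and> grade_inv Z = Z"

lemma even_central_scal: "even_central (scal b)"
  unfolding even_central_def by (intro conjI allI scal_central) simp

lemma even_central_anticommutator: "even_central (anticommutator (vec u) (vec v))"
  unfolding even_central_def by (intro conjI allI anticommutator_vec_central) (simp add: anticommutator_def grade_inv_add grade_inv_mult)

lemma even_central_add: "even_central Z \<Longrightarrow> even_central Z' \<Longrightarrow> even_central (Z + Z')"
  by (simp add: even_central_def grade_inv_add algebra_simps)

lemma even_central_mult: "even_central Z \<Longrightarrow> even_central Z' \<Longrightarrow> even_central (Z * Z')"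
proof -
  assume "even_central Z" "even_central Z'"
  then have "F * Z = Z * F" "F * Z' = Z' * F" "grade_inv Z = Z" "grade_inv Z' = Z'" for F
    by (simp_all add: even_central_def)
  then show ?thesis
    unfolding even_central_def by (metis grade_inv_mult mult.assoc)
qed

lemma even_central_power: "even_central Z \<Longrightarrow> even_central (Z ^ k)"
  by (induction k) (use even_central_scal[of 1] in \<open>auto intro: even_central_mult\<close>)

lemma vec_square: "vec u ^ 2 = half * anticommutator (vec u) (vec u)"
  by (simp add: anticommutator_def power2_eq_square distrib_left half_mult_add)

lemma even_central_square: "even_central (vec u ^ 2)"
  using even_central_mult[OF even_central_scal even_central_anticommutator] by (simp add: vec_square half_def)

lemma even_central_uminus: "even_central Z \<Longrightarrow> even_central (- Z)"
  by (simp add: even_central_def grade_inv_additive)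

lemma ext_mult_even_central:
  assumes "even_central Z" shows "ext_mult u (F * Z) = ext_mult u F * Z"
proof -
  from assms have Z: "vec u * Z = Z * vec u" "grade_inv Z = Z" by (simp_all add: even_central_def)
  then show ?thesis
    by (simp add: ext_mult_def grade_inv_mult distrib_left distrib_right mult.assoc)
qed

lemma ext_mult_scal: "ext_mult u (scal b * F) = scal b * ext_mult u F"
  using ext_mult_even_central[OF even_central_scal, of u F b] by (simp only: scal_central)

lemma grade_inv_ext_mult: "grade_inv (ext_mult u F) = - ext_mult u (grade_inv F)"
  by (simp add: ext_mult_def grade_inv_mult grade_inv_add algebra_simps)

lemma grade_inv_int_mult: "grade_inv (int_mult u F) = - int_mult u (grade_inv F)"
  by (simp add: int_mult_def grade_inv_mult grade_inv_additive algebra_simps)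

text \<open>In the sum over both orders the terms with \<open>grade_inv F\<close> in the middle
  cancel. What remains is the commutator of \<open>F\<close> with {u,v}, zero by the defining
  relation.\<close>

lemma ext_mult_anticommute: "ext_mult u (ext_mult v F) = - ext_mult v (ext_mult u F)"
proof -
  have e: "ext_mult u (ext_mult v F) =
      half * (half * (vec u * vec v * F - F * (vec v * vec u) + (vec u * grade_inv F * vec v - vec v * grade_inv F * vec u)))" for u v
    unfolding ext_mult_def by (simp add: grade_inv_mult grade_inv_add algebra_simps half_central[of "vec _"] half_central[of "grade_inv _"] half_central[of F])
  have "ext_mult u (ext_mult v F) + ext_mult v (ext_mult u F) =
      half * (half * (anticommutator (vec u) (vec v) * F - F * anticommutator (vec u) (vec v)))"
    unfolding e anticommutator_def by (simp add: algebra_simps)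
  then show ?thesis
    by (simp add: anticommutator_vec_central eq_neg_iff_add_eq_0)
qed

lemma ext_mult_self: "ext_mult u (ext_mult u F) = 0"
  using half_mult_2(1)[of "ext_mult u (ext_mult u F)"] ext_mult_anticommute[of u u F]
  by (simp add: mult_2 eq_neg_iff_add_eq_0)

text \<open>The rule d(u ^ F) = d(u) F - u ^ dF, over an abstract ring so that it covers interior
  products, the contraction with \<open>x\<close> and the formal contractions on
  polynomials.\<close>

lemma skew_derivation_ext_mult:
  fixes d :: "'a::ring_1 \<Rightarrow> 'a"
  assumes "\<And>F G. d (F + G) = d F + d G" "\<And>F G. d (F * G) = d F * G + \<beta> F * d G"
    "\<And>F. \<beta> (d F) = - d (\<beta> F)" "d h = 0" "\<beta> h = h" "h + h = 1" "\<And>F. h * F = F * h"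
    "\<beta> u = - u" "\<And>F. F * d u = d u * F" "\<And>F. \<beta> (\<beta> F) = F"
  shows "d (h * (u * F + \<beta> F * u)) = d u * F - h * (u * d F + \<beta> (d F) * u)"
proof -
  have "d (h * (u * F + \<beta> F * u)) = h * (d u * F - u * d F + d (\<beta> F) * u + F * d u)"
    by (simp add: assms(1,2,4,5,8,10) add.assoc)
  also have "d (\<beta> F) = - \<beta> (d F)" by (simp add: assms(3))
  also have "h * (d u * F - u * d F + - \<beta> (d F) * u + F * d u) =
      (h + h) * (d u * F) - h * (u * d F + \<beta> (d F) * u)"
    unfolding assms(9) by (simp add: algebra_simps)
  finally show ?thesis by (simp add: assms(6))
qed

lemma int_mult_ext_mult:
  "int_mult v (ext_mult u F) = half * anticommutator (vec v) (vec u) * F - ext_mult u (int_mult v F)"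
  unfolding ext_mult_def
  by (subst skew_derivation_ext_mult[where \<beta> = grade_inv])
    (simp_all add: int_mult_add int_mult_mult grade_inv_int_mult int_mult_vec half_add_half half_central(1)[symmetric],
      simp_all add: half_def int_mult_scal even_central_mult[OF even_central_anticommutator even_central_scal, unfolded even_central_def])

text \<open>In contrast to \<open>int_mult x\<close>, the value on \<open>x\<close> is 1 and on any
  other vector 0, so this operator removes a factor \<open>x\<close> from an exterior product and
  detects its absence.\<close>

definition x_contraction :: "'v \<Rightarrow> 'v radialB \<Rightarrow> 'v radialB" where
  "x_contraction x = (SOME d. (\<forall>F G. d (F + G) = d F + d G) \<and>
    (\<forall>F G. d (F * G) = d F * G + grade_inv F * d G) \<and>
    (\<forall>v. d (vec v) = (if v = x then 1 else 0)) \<and> (\<forall>b. d (scal b) = 0))"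

lemma
  fixes F G :: "'v radialB" and v x :: 'v
  shows x_contraction_add: "x_contraction x (F + G) = x_contraction x F + x_contraction x G"
  and x_contraction_mult: "x_contraction x (F * G) = x_contraction x F * G + grade_inv F * x_contraction x G"
  and x_contraction_vec: "x_contraction x (vec v) = (if v = x then 1 else 0)"
  and x_contraction_scal: "x_contraction x (scal b :: 'v radialB) = 0"
proof -
  have "\<exists>d :: 'v radialB \<Rightarrow> 'v radialB. (\<forall>F G. d (F + G) = d F + d G) \<and>
    (\<forall>F G. d (F * G) = d F * G + grade_inv F * d G) \<and>
    (\<forall>v. d (vec v) = (if v = x then 1 else 0)) \<and> (\<forall>b. d (scal b) = 0)"
    by (rule skew_derivation_exists[of "\<lambda>F. F"]) auto
  from someI_ex[OF this, folded x_contraction_def]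
  show "x_contraction x (F + G) = x_contraction x F + x_contraction x G"
    "x_contraction x (F * G) = x_contraction x F * G + grade_inv F * x_contraction x G"
    "x_contraction x (vec v) = (if v = x then 1 else 0)" "x_contraction x (scal b :: 'v radialB) = 0" by blast+
qed

lemma grade_inv_x_contraction: "grade_inv (x_contraction x F) = - x_contraction x (grade_inv F)"
  by (rule skew_derivation_grade_inv[of "x_contraction x" "\<lambda>F. F" "\<lambda>v. if v = x then 1 else 0"])
    (simp_all add: x_contraction_add x_contraction_mult x_contraction_vec x_contraction_scal
      grade_inv_add grade_inv_mult grade_inv_additive)

lemma x_contraction_ext_mult:
  "x_contraction x (ext_mult u F) = (if u = x then F else 0) - ext_mult u (x_contraction x F)"
  unfolding ext_mult_def
  by (subst skew_derivation_ext_mult[where \<beta> = grade_inv])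
    (simp_all add: x_contraction_add x_contraction_mult grade_inv_x_contraction x_contraction_vec
      half_add_half half_central(1)[symmetric], simp add: half_def x_contraction_scal)

lemma q_rescale_ext_mult: "q_rescale (ext_mult u F) = scal q_inv * ext_mult u (q_rescale F)"
proof -
  have g: "q_rescale (grade_inv F) = grade_inv (q_rescale F)"
    by (induction F rule: radialB_induct)
      (simp_all add: grade_inv_mult grade_inv_add q_rescale_mult q_rescale_add additive_props[of q_rescale, OF q_rescale_add]
        flip: scal_simps)
  have "q_rescale half = half" by (simp add: half_def)
  then show ?thesis
    unfolding ext_mult_def q_rescale_mult q_rescale_add q_rescale_vec g
    by (simp add: distrib_left distrib_right mult.assoc \<open>q_rescale half = half\<close> scal_left_commute[of half] scal_left_commute[of "q_rescale _"]
        scal_left_commute[of "grade_inv _"])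
qed

text \<open>Recursive form of the wedge, suited to induction along the list;
  \<open>wedge_eq_ext_prod\<close> identifies it with the sum over permutations.\<close>

fun ext_prod :: "'v list \<Rightarrow> 'v radialB" where
  "ext_prod [] = 1"
| "ext_prod (u # us) = ext_mult u (ext_prod us)"

lemma grade_inv_ext_prod: "grade_inv (ext_prod us) = (- 1) ^ length us * ext_prod us"
  by (induction us) (simp_all add: grade_inv_ext_mult ext_mult_additive minus_one_power_iff)

lemma q_rescale_ext_prod: "q_rescale (ext_prod us) = scal (q_inv ^ length us) * ext_prod us"
proof (induction us)
  case Nil
  then show ?case using q_rescale_scal[of 1] by simp
next
  case (Cons u us)
  then show ?case
    by (simp add: q_rescale_ext_mult ext_mult_scal[of u "q_inv ^ length us", unfolded scal_power] scal_mult scal_power mult.assoc)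
qed

lemma x_contraction_ext_prod: "x \<notin> set us \<Longrightarrow> x_contraction x (ext_prod us) = 0"
proof (induction us)
  case Nil
  then show ?case using x_contraction_scal[of x 1] by simp
qed (auto simp: x_contraction_ext_mult ext_mult_additive)

lemma ext_mult_sign: "ext_mult u ((- 1) ^ k * F) = (- 1) ^ k * ext_mult u F"
  by (simp add: minus_one_power_iff ext_mult_additive)

lemma ext_prod_move: "ext_prod (us @ x # vs) = (- 1) ^ length us * ext_prod (x # us @ vs)"
proof (induction us)
  case (Cons u us)
  then show ?case by (simp add: ext_mult_sign ext_mult_anticommute[of u x])
qed simp

lemma ext_prod_not_distinct: "\<not> distinct us \<Longrightarrow> ext_prod us = 0"
proof -
  assume "\<not> distinct us"
  then obtain as bs cs y where us: "us = as @ [y] @ bs @ [y] @ cs"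
    using not_distinct_decomp by blast
  have "ext_prod (bs @ [y] @ cs) = (- 1) ^ length bs * ext_prod (y # bs @ cs)"
    using ext_prod_move[of bs y cs] by simp
  then have z: "ext_prod ([y] @ bs @ [y] @ cs) = 0"
    by (simp add: ext_mult_sign ext_mult_self)
  show ?thesis unfolding us by (induction as) (use z in \<open>simp_all add: ext_mult_additive\<close>)
qed

lemma ext_prod_swap: "ext_prod (as @ u # bs @ v # cs) = - ext_prod (as @ v # bs @ u # cs)"
proof -
  have "ext_prod (u # bs @ v # cs) = - ext_prod (v # bs @ u # cs)"
    unfolding ext_prod.simps ext_prod_move
    by (simp add: ext_mult_sign ext_mult_anticommute[of u v])
  then show ?thesis by (induction as) (simp_all add: ext_mult_additive)
qed

section \<open>Antisymmetrized products as iterated exterior products\<close>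

definition drop_nth :: "nat \<Rightarrow> 'a list \<Rightarrow> 'a list" where "drop_nth l us = take l us @ drop (Suc l) us"

lemma drop_nth_simps [simp]: "drop_nth 0 (u # us) = us" "drop_nth (Suc l) (u # us) = u # drop_nth l us"
  by (simp_all add: drop_nth_def)

lemma int_mult_ext_prod:
  "int_mult u (ext_prod us) =
    (\<Sum>l<length us. (- 1) ^ l * (half * anticommutator (vec u) (vec (us ! l)) * ext_prod (drop_nth l us)))"
proof (induction us)
  case Nil
  then show ?case using int_mult_scal[of u 1] by simp
next
  case (Cons v us)
  have e: "ext_mult v (half * anticommutator (vec u) (vec w) * F) = half * anticommutator (vec u) (vec w) * ext_mult v F" for F w
    using ext_mult_even_central[OF even_central_mult[OF even_central_scal even_central_anticommutator], of v F]
    using even_central_mult[OF even_central_scal even_central_anticommutator, unfolded even_central_def] unfolding half_def by metis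
  show ?case
    unfolding ext_prod.simps int_mult_ext_mult Cons.IH
    by (simp add: sum.lessThan_Suc_shift ext_mult_additive(4) ext_mult_sign e sum_negf del: sum.lessThan_Suc)
qed

text \<open>Composition with the transposition permutes the summands and reverses the signs, so the
  sum equals its own negative; \<open>half\<close> then forces it to vanish.\<close>

lemma sum_sign_permutes_swap_invariant:
  fixes f :: "(nat \<Rightarrow> nat) \<Rightarrow> 'v radialB"
  assumes ab: "a < n" "b < n" "a \<noteq> b" and inv: "\<And>\<pi>. \<pi> permutes {..<n} \<Longrightarrow> f (\<pi> \<circ> Transposition.transpose a b) = f \<pi>"
  shows "(\<Sum>\<pi> | \<pi> permutes {..<n}. of_int (sign \<pi>) * f \<pi>) = 0"
proof -
  let ?t = "Transposition.transpose a b" and ?S = "\<Sum>\<pi> | \<pi> permutes {..<n}. of_int (sign \<pi>) * f \<pi>"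
  have t: "?t permutes {..<n}" using ab by (intro permutes_swap_id) auto
  have "?S = (\<Sum>\<pi> | \<pi> permutes {..<n}. of_int (sign (\<pi> \<circ> ?t)) * f (\<pi> \<circ> ?t))"
    by (rule sum_permutations_compose_right[OF t])
  also have "\<dots> = (\<Sum>\<pi> | \<pi> permutes {..<n}. - (of_int (sign \<pi>) * f \<pi>))"
  proof (rule sum.cong)
    fix \<pi> assume "\<pi> \<in> {\<pi>. \<pi> permutes {..<n}}"
    then have \<pi>: "\<pi> permutes {..<n}" by simp
    then have "permutation \<pi>" by (meson finite_lessThan permutation_permutes)
    then have "sign (\<pi> \<circ> ?t) = - sign \<pi>"
      using ab by (simp add: sign_compose permutation_swap_id sign_swap_id)
    then show "of_int (sign (\<pi> \<circ> ?t)) * f (\<pi> \<circ> ?t) = - (of_int (sign \<pi>) * f \<pi>)"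
      using inv[OF \<pi>] by simp
  qed simp
  also have "\<dots> = - ?S" by (simp add: sum_negf)
  finally show ?thesis using half_mult_add[of ?S] half_mult_2(1)[of ?S] by (simp add: mult_2 eq_neg_iff_add_eq_0)
qed

lemma upt_split: "a < b \<Longrightarrow> b < n \<Longrightarrow> [0..<n] = [0..<a] @ a # [Suc a..<b] @ b # [Suc b..<n]"
proof -
  assume ab: "a < b" "b < n"
  then have "[0..<n] = [0..<a] @ [a..<n]" using upt_add_eq_append[of 0 a "n - a"] by simp
  also have "[a..<n] = a # [Suc a..<n]" using ab by (simp add: upt_conv_Cons)
  also have "[Suc a..<n] = [Suc a..<b] @ [b..<n]" using ab upt_add_eq_append[of "Suc a" b "n - b"] by simp
  also have "[b..<n] = b # [Suc b..<n]" using ab by (simp add: upt_conv_Cons)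
  finally show ?thesis .
qed

lemma ext_prod_permute:
  assumes "\<pi> permutes {..<n}"
  shows "ext_prod (map (\<lambda>i. g (\<pi> i)) [0..<n]) = of_int (sign \<pi>) * ext_prod (map g [0..<n])"
  using finite_lessThan assms
proof (induction rule: permutes_rev_induct)
  case id
  then show ?case by simp
next
  case (swap a b \<pi>)
  let ?t = "Transposition.transpose a b"
  have *: "ext_prod (map (\<lambda>i. f (Transposition.transpose a b i)) [0..<n]) = - ext_prod (map f [0..<n])"
    if "a < b" "b < n" for f :: "nat \<Rightarrow> 'a" and a b
  proof -
    let ?t = "Transposition.transpose a b"
    have m: "map (\<lambda>i. f (?t i)) [c..<d] = map f [c..<d]" if "a \<notin> {c..<d}" "b \<notin> {c..<d}" for c d
      using that by (auto simp: Transposition.transpose_def)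
    show ?thesis
      unfolding upt_split[OF that] map_append list.map(2)
      by (subst ext_prod_swap) (use that in \<open>simp add: m\<close>)
  qed
  have **: "ext_prod (map (\<lambda>i. f (?t i)) [0..<n]) = - ext_prod (map f [0..<n])" for f :: "nat \<Rightarrow> 'a"
    using *[of a b f] *[of b a f] swap(1-3) by (cases "a < b") (auto simp: transpose_commute)
  have "permutation \<pi>" using swap by (meson finite_lessThan permutation_permutes)
  then have "sign (\<pi> \<circ> ?t) = - sign \<pi>"
    using swap(3) by (subst sign_compose) (simp_all add: permutation_swap_id sign_swap_id)
  then show ?case using **[of "\<lambda>i. g (\<pi> i)"] swap by (simp add: comp_def)
qed

text \<open>In the antisymmetrized product, left multiplications may be replaced by exterior ones,
  beginning with the rightmost factor: the interior products that arise cancel in pairs.\<close>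

lemma wedge_eq_ext_prod: "wedge us = ext_prod us"
proof -
  let ?n = "length us"
  let ?P = "{\<pi>. \<pi> permutes {..<?n}}"
  define V where "V k \<pi> = prod_list (map (\<lambda>i. vec (us ! \<pi> i)) [0..<k])" for k and \<pi> :: "nat \<Rightarrow> nat"
  define E where "E k \<pi> = ext_prod (map (\<lambda>i. us ! \<pi> i) [k..<?n])" for k and \<pi> :: "nat \<Rightarrow> nat"
  \<comment> \<open>The first \<open>k\<close> factors are multiplied in the ring and the remaining
    ones exteriorly. Hence \<open>S ?n\<close> is the unnormalized antisymmetrization, and every
    summand of \<open>S 0\<close> is \<open>ext_prod us\<close>.\<close>
  define S where "S k = (\<Sum>\<pi>\<in>?P. of_int (sign \<pi>) * (V k \<pi> * E k \<pi>))" for k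
  have step: "S (Suc k) = S k" if k: "k < ?n" for k
  proof -
    \<comment> \<open>Up to the sign \<open>(-1) ^ l\<close>, the term of the interior product that
      pairs positions \<open>k\<close> and \<open>Suc k + l\<close>. These positions occur only in a
      symmetric anticommutator, so exchanging them leaves the term fixed.\<close>
    define W where "W l \<pi> = half * anticommutator (vec (us ! \<pi> k)) (vec (us ! \<pi> (Suc k + l))) *
      ext_prod (drop_nth l (map (\<lambda>i. us ! \<pi> i) [Suc k..<?n]))" for l and \<pi> :: "nat \<Rightarrow> nat"
    have "V (Suc k) \<pi> * E (Suc k) \<pi> = V k \<pi> * E k \<pi> + (\<Sum>l<?n - Suc k. (-1) ^ l * (V k \<pi> * W l \<pi>))" for \<pi>
    proof -
      have "V (Suc k) \<pi> * E (Suc k) \<pi> = V k \<pi> * (vec (us ! \<pi> k) * E (Suc k) \<pi>)"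
        by (simp add: V_def mult.assoc)
      also have "vec (us ! \<pi> k) * E (Suc k) \<pi> = E k \<pi> + int_mult (us ! \<pi> k) (E (Suc k) \<pi>)"
        using k by (simp add: vec_mult_eq E_def upt_conv_Cons)
      also have "int_mult (us ! \<pi> k) (E (Suc k) \<pi>) = (\<Sum>l<?n - Suc k. (-1) ^ l * W l \<pi>)"
        unfolding E_def int_mult_ext_prod W_def by (auto intro!: sum.cong)
      also have "V k \<pi> * (E k \<pi> + (\<Sum>l<?n - Suc k. (-1) ^ l * W l \<pi>)) =
          V k \<pi> * E k \<pi> + (\<Sum>l<?n - Suc k. (-1) ^ l * (V k \<pi> * W l \<pi>))"
        unfolding distrib_left sum_distrib_left by (auto simp: minus_one_power_iff intro!: sum.cong)
      finally show ?thesis .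
    qed
    then have "S (Suc k) = S k + (\<Sum>\<pi>\<in>?P. of_int (sign \<pi>) * (\<Sum>l<?n - Suc k. (-1) ^ l * (V k \<pi> * W l \<pi>)))"
      by (simp add: S_def distrib_left sum.distrib)
    also have "(\<Sum>\<pi>\<in>?P. of_int (sign \<pi>) * (\<Sum>l<?n - Suc k. (-1) ^ l * (V k \<pi> * W l \<pi>))) =
        (\<Sum>l<?n - Suc k. \<Sum>\<pi>\<in>?P. of_int (sign \<pi>) * ((-1) ^ l * (V k \<pi> * W l \<pi>)))"
      unfolding sum_distrib_left by (rule sum.swap)
    also have "\<dots> = (\<Sum>l<?n - Suc k. 0)"
    proof (rule sum.cong)
      fix l assume "l \<in> {..<?n - Suc k}"
      then have l: "Suc k + l < ?n" by simp
      show "(\<Sum>\<pi>\<in>?P. of_int (sign \<pi>) * ((-1) ^ l * (V k \<pi> * W l \<pi>))) = 0"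
      proof (rule sum_sign_permutes_swap_invariant[OF k l])
        fix \<pi> assume "\<pi> permutes {..<?n}"
        let ?t = "Transposition.transpose k (Suc k + l)"
        have "V k (\<pi> \<circ> ?t) = V k \<pi>"
          unfolding V_def by (intro arg_cong[of _ _ prod_list] map_cong) (auto simp: Transposition.transpose_def)
        moreover have "drop_nth l (map (\<lambda>i. us ! (\<pi> \<circ> ?t) i) [Suc k..<?n]) = drop_nth l (map (\<lambda>i. us ! \<pi> i) [Suc k..<?n])"
          unfolding drop_nth_def take_map drop_map
          by (intro arg_cong2[of _ _ _ _ append] map_cong) (use l in \<open>auto simp: Transposition.transpose_def take_upt drop_upt\<close>)
        ultimately show "(-1) ^ l * (V k (\<pi> \<circ> ?t) * W l (\<pi> \<circ> ?t)) = (-1) ^ l * (V k \<pi> * W l \<pi>)"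
          unfolding W_def by (simp add: anticommutator_commute)
      qed simp
    qed simp
    finally show ?thesis by simp
  qed
  have "S k = S 0" if "k \<le> ?n" for k
    using that by (induction k) (simp_all add: step)
  from this[of ?n] have "S ?n = S 0" by blast
  also have "S 0 = (\<Sum>\<pi>\<in>?P. ext_prod us)"
    unfolding S_def
  proof (rule sum.cong)
    fix \<pi> assume "\<pi> \<in> ?P"
    then have "E 0 \<pi> = of_int (sign \<pi>) * ext_prod us"
      unfolding E_def by (subst ext_prod_permute) (simp_all add: map_nth)
    then show "of_int (sign \<pi>) * (V 0 \<pi> * E 0 \<pi>) = ext_prod us"
      by (simp add: V_def sign_def)
  qed simp
  also have "\<dots> = of_nat (fact ?n) * ext_prod us"
    by (simp add: card_permutations)
  finally have S: "S ?n = of_nat (fact ?n) * ext_prod us" .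
  \<comment> \<open>\<open>wedge\<close> antisymmetrizes in the real algebra and tensors afterwards;
    this homomorphism carries the sum over permutations into \<open>radialB\<close>.\<close>
  define \<iota> :: "'a radial \<Rightarrow> 'a radialB" where "\<iota> = tensor 1"
  have \<iota>: "\<iota> (F + G) = \<iota> F + \<iota> G" "\<iota> (F * G) = \<iota> F * \<iota> G" "\<iota> 1 = 1" for F G
    by (simp_all add: \<iota>_def tensor_add_right tensor_mult tensor_1_1)
  note \<iota>_additive = additive_props[of \<iota>, OF \<iota>(1)]
  have \<iota>_prod: "\<iota> (prod_list (map f l)) = prod_list (map (\<lambda>i. \<iota> (f i)) l)" for f :: "nat \<Rightarrow> 'a radial" and l
    by (induction l) (simp_all add: \<iota>)
  have \<iota>_sign: "\<iota> (of_int (sign \<pi>) * F) = of_int (sign \<pi>) * \<iota> F" for \<pi> :: "nat \<Rightarrow> nat" and F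
    by (simp add: sign_def \<iota>_additive)
  have "wedge us = scal ((1 / fact ?n) *\<^sub>R 1) * S ?n"
  proof -
    have "\<iota> (t *\<^sub>R F) = scal (t *\<^sub>R 1) * \<iota> F" for t F
      by (simp add: \<iota>_def scal_def tensor_scaleR tensor_mult)
    moreover have "\<iota> (radial_var v) = vec v" for v by (simp add: \<iota>_def vec_def)
    ultimately show ?thesis
      unfolding wedge_def S_def V_def E_def \<iota>_def[symmetric]
      by (simp only: \<iota>_additive \<iota>_sign \<iota>_prod) simp
  qed
  also have "\<dots> = scal ((1 / fact ?n) *\<^sub>R 1) * scal (of_nat (fact ?n)) * ext_prod us"
  proof -
    have "(scal (of_nat k) :: 'a radialB) = of_nat k" for k
      by (induction k) (simp_all add: scal_add)
    then have "(scal (of_nat (fact ?n)) :: 'a radialB) = of_nat (fact ?n)" .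
    then show ?thesis by (simp only: S mult.assoc)
  qed
  also have "scal ((1 / fact ?n) *\<^sub>R 1) * scal (of_nat (fact ?n)) = 1"
  proof -
    have "((1 / fact ?n :: real) *\<^sub>R 1) * (of_nat (fact ?n) :: coeff) = 1"
    proof -
      have "(of_nat (fact ?n) :: coeff) = fact ?n *\<^sub>R 1"
        using of_real_of_nat_eq[of "fact ?n", where 'a = coeff] by (simp add: of_real_def)
      then show ?thesis by simp
    qed
    then show ?thesis by (simp flip: scal_mult)
  qed
  finally show ?thesis by simp
qed

section \<open>The symbol map\<close>

text \<open>Polynomials over the radial algebra in independent central indeterminates: \<open>{x}\<close> stands for
  \<open>x\<^sup>2\<close> and every other \<open>{u, v}\<close> for the anticommutator of \<open>u\<close> and \<open>v\<close>.\<close>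

type_synonym 'v gpoly = "('v set \<Rightarrow>\<^sub>0 nat) \<Rightarrow>\<^sub>0 'v radialB"

abbreviation cst :: "'v radialB \<Rightarrow> 'v gpoly" where "cst \<equiv> Poly_Mapping.single 0"

abbreviation mon :: "('v set \<Rightarrow>\<^sub>0 nat) \<Rightarrow> 'v gpoly" where "mon n \<equiv> Poly_Mapping.single n 1"

abbreviation gvar :: "'v set \<Rightarrow> 'v gpoly" where "gvar s \<equiv> mon (Poly_Mapping.single s 1)"

lemma cst_add: "cst (F + G) = cst F + cst G" and cst_mult: "cst (F * G) = cst F * cst G"
  and cst_1: "cst 1 = 1" and cst_uminus: "cst (- F) = - cst F"
  by (simp_all add: single_add mult_single single_uminus)

lemma mon_central: "G * mon n = mon n * G"
  by (induction G rule: poly_mapping_single_induct) (simp_all add: distrib_left distrib_right mult_single add.commute)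

lemma cst_half_central: "G * cst half = cst half * G"
  by (induction G rule: poly_mapping_single_induct)
    (simp_all add: distrib_left distrib_right mult_single half_central(1)[of "_ :: 'a radialB"])

lemma cst_scal_central: "G * cst (scal b) = cst (scal b) * G"
  by (induction G rule: poly_mapping_single_induct)
    (simp_all add: distrib_left distrib_right mult_single scal_central)

definition grade_invP :: "'v gpoly \<Rightarrow> 'v gpoly" where
  "grade_invP = monoid_ring_ext (\<lambda>F. cst (grade_inv F)) mon"

lemma grade_invP_add: "grade_invP (F + G) = grade_invP F + grade_invP G"
  unfolding grade_invP_def
  by (rule monoid_ring_ext_add) (simp_all add: grade_inv_add grade_inv_additive single_add)

lemma grade_invP_mult: "grade_invP (F * G) = grade_invP F * grade_invP G"
  unfolding grade_invP_def
  by (rule monoid_ring_ext_mult_commuting)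
    (simp_all add: grade_inv_add grade_inv_additive grade_inv_mult single_add mult_single)

lemma grade_invP_single [simp]: "grade_invP (Poly_Mapping.single n F) = Poly_Mapping.single n (grade_inv F)"
  unfolding grade_invP_def by (subst monoid_ring_ext_single) (simp_all add: grade_inv_additive mult_single)

lemmas grade_invP_additive = additive_props[of grade_invP, OF grade_invP_add]

lemma grade_invP_grade_invP [simp]: "grade_invP (grade_invP F) = F"
  by (induction F rule: poly_mapping_single_induct) (simp_all add: grade_invP_add grade_invP_additive)

text \<open>The formal value of {u,v}/2. For u = v = x this is the indeterminate itself, since r
  stands for x squared; every other indeterminate, c_ii included, stands for a full anticommutator
  and gets the factor one half.\<close>

definition half_gram :: "'v \<Rightarrow> 'v \<Rightarrow> 'v \<Rightarrow> 'v gpoly" where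
  "half_gram x u v = (if u = x \<and> v = x then gvar {x} else cst half * gvar {u, v})"

lemma half_gram_commute: "half_gram x u v = half_gram x v u"
  by (simp add: half_gram_def insert_commute)

lemma half_gram_central: "G * half_gram x u v = half_gram x u v * G"
proof -
  have "G * (cst half * gvar {u, v}) = cst half * gvar {u, v} * G"
    unfolding commute_left[OF cst_half_central[of G]] mon_central[of G] mult.assoc ..
  then show ?thesis by (simp add: half_gram_def mon_central[of G])
qed

text \<open>Formal counterpart of \<open>int_mult u\<close>: the pairing of \<open>u\<close> with a
  vector is an indeterminate instead of an element of the algebra.\<close>

definition gram_contraction :: "'v \<Rightarrow> 'v \<Rightarrow> 'v radialB \<Rightarrow> 'v gpoly" where
  "gram_contraction x u = (SOME d. (\<forall>F G. d (F + G) = d F + d G) \<and>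
    (\<forall>F G. d (F * G) = d F * cst G + cst (grade_inv F) * d G) \<and>
    (\<forall>v. d (vec v) = half_gram x u v) \<and> (\<forall>b. d (scal b) = 0))"

lemma
  fixes F G :: "'v radialB" and u v x :: 'v
  shows gram_contraction_add: "gram_contraction x u (F + G) = gram_contraction x u F + gram_contraction x u G"
    and gram_contraction_mult:
      "gram_contraction x u (F * G) = gram_contraction x u F * cst G + cst (grade_inv F) * gram_contraction x u G"
    and gram_contraction_vec: "gram_contraction x u (vec v) = half_gram x u v"
    and gram_contraction_scal: "gram_contraction x u (scal b :: 'v radialB) = 0"
proof -
  have "\<exists>d :: 'v radialB \<Rightarrow> 'v gpoly. (\<forall>F G. d (F + G) = d F + d G) \<and>
    (\<forall>F G. d (F * G) = d F * cst G + cst (grade_inv F) * d G) \<and>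
    (\<forall>v. d (vec v) = half_gram x u v) \<and> (\<forall>b. d (scal b) = 0)"
    by (rule skew_derivation_exists) (simp_all add: cst_add cst_mult cst_1 half_gram_central)
  from someI_ex[OF this, folded gram_contraction_def]
  show "gram_contraction x u (F + G) = gram_contraction x u F + gram_contraction x u G"
    "gram_contraction x u (F * G) = gram_contraction x u F * cst G + cst (grade_inv F) * gram_contraction x u G"
    "gram_contraction x u (vec v) = half_gram x u v" "gram_contraction x u (scal b :: 'v radialB) = 0"
    by blast+
qed

lemmas gram_contraction_additive = additive_props[of "gram_contraction x u" for x u, OF gram_contraction_add]

lemma grade_invP_half_gram: "grade_invP (half_gram x u v) = half_gram x u v"
  by (simp add: half_gram_def grade_invP_mult flip: scal_simps)

lemma grade_invP_gram_contraction:
  "grade_invP (gram_contraction x u F) = - gram_contraction x u (grade_inv F)"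
  by (rule skew_derivation_grade_inv[of _ cst "half_gram x u"])
    (simp_all add: gram_contraction_add gram_contraction_mult gram_contraction_vec gram_contraction_scal
      grade_invP_add grade_invP_mult grade_invP_half_gram cst_uminus)

definition gram_contractionP :: "'v \<Rightarrow> 'v \<Rightarrow> 'v gpoly \<Rightarrow> 'v gpoly" where
  "gram_contractionP x u = monoid_ring_ext (gram_contraction x u) mon"

lemma gram_contractionP_add: "gram_contractionP x u (F + G) = gram_contractionP x u F + gram_contractionP x u G"
  unfolding gram_contractionP_def
  by (rule monoid_ring_ext_add) (simp_all add: gram_contraction_add gram_contraction_additive)

lemma gram_contractionP_single: "gram_contractionP x u (Poly_Mapping.single n F) = gram_contraction x u F * mon n"
  unfolding gram_contractionP_def by (rule monoid_ring_ext_single) (simp add: gram_contraction_additive)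

lemmas gram_contractionP_additive = additive_props[of "gram_contractionP x u" for x u, OF gram_contractionP_add]

lemma single_eq_cst_mon: "Poly_Mapping.single n F = cst F * mon n"
  by (simp add: mult_single)

lemma gram_contractionP_mult:
  "gram_contractionP x u (F * G) = gram_contractionP x u F * G + grade_invP F * gram_contractionP x u G"
proof (induction F rule: poly_mapping_single_induct)
  case (single_add n a F)
  have "gram_contractionP x u (Poly_Mapping.single n a * G) =
      gram_contractionP x u (Poly_Mapping.single n a) * G + Poly_Mapping.single n (grade_inv a) * gram_contractionP x u G"
  proof (induction G rule: poly_mapping_single_induct)
    case (single_add m b G)
    have "gram_contractionP x u (Poly_Mapping.single n a * Poly_Mapping.single m b) =
      (gram_contraction x u a * cst b + cst (grade_inv a) * gram_contraction x u b) * (mon n * mon m)"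
      by (simp add: mult_single gram_contractionP_single gram_contraction_mult)
    also have "\<dots> = gram_contraction x u a * mon n * (cst b * mon m) +
        (cst (grade_inv a) * mon n) * (gram_contraction x u b * mon m)"
      by (simp only: distrib_right mult.assoc commute_left[OF mon_central[symmetric]])
    finally show ?case
      using single_add by (simp add: distrib_left gram_contractionP_add gram_contractionP_single algebra_simps
          flip: single_eq_cst_mon)
  qed (simp add: gram_contractionP_additive)
  with single_add show ?case
    by (simp add: distrib_right gram_contractionP_add grade_invP_add algebra_simps)
qed (simp add: gram_contractionP_additive grade_invP_additive)

lemma gram_contractionP_cst: "gram_contractionP x u (cst F) = gram_contraction x u F"
  by (simp add: gram_contractionP_single)

lemma gram_contractionP_mon: "gram_contractionP x u (mon n) = 0"
  using gram_contraction_scal[of x u 1] by (simp add: gram_contractionP_single)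

lemma gram_contractionP_cst_scal: "gram_contractionP x u (cst (scal b)) = 0"
  by (simp add: gram_contractionP_cst gram_contraction_scal)

lemma grade_invP_gram_contractionP:
  "grade_invP (gram_contractionP x u F) = - gram_contractionP x u (grade_invP F)"
  by (induction F rule: poly_mapping_single_induct)
    (simp_all add: gram_contractionP_add gram_contractionP_additive grade_invP_add grade_invP_additive
      gram_contractionP_single grade_invP_mult grade_invP_gram_contraction)

text \<open>Formal counterpart of \<open>even_central\<close>. Annihilation by all contractions is
  included, so that the Clifford operators become linear over these polynomials.\<close>

definition gscalar :: "'v \<Rightarrow> 'v gpoly \<Rightarrow> bool" where
  "gscalar x Z \<longleftrightarrow> (\<forall>F. F * Z = Z * F) \<and> grade_invP Z = Z \<and> (\<forall>u. gram_contractionP x u Z = 0)"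

lemma gscalar_mult: "gscalar x Z \<Longrightarrow> gscalar x Z' \<Longrightarrow> gscalar x (Z * Z')"
proof -
  assume "gscalar x Z" "gscalar x Z'"
  then have Z: "F * Z = Z * F" "F * Z' = Z' * F" "grade_invP Z = Z" "grade_invP Z' = Z'"
    "gram_contractionP x u Z = 0" "gram_contractionP x u Z' = 0" for F u
    by (simp_all add: gscalar_def)
  have "F * (Z * Z') = Z * Z' * F" for F by (metis Z(1,2) mult.assoc)
  then show ?thesis
    unfolding gscalar_def using Z(3-6) by (simp add: grade_invP_mult gram_contractionP_mult)
qed

lemma gscalar_mon: "gscalar x (mon n)"
  unfolding gscalar_def by (intro conjI allI mon_central gram_contractionP_mon) (simp flip: scal_simps)

lemma gscalar_cst_scal: "gscalar x (cst (scal b))"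
  unfolding gscalar_def by (intro conjI allI cst_scal_central gram_contractionP_cst_scal) simp

lemma gscalar_half_gram: "gscalar x (half_gram x u v)"
  unfolding half_gram_def half_def by (auto intro!: gscalar_mult gscalar_mon gscalar_cst_scal)

lemma gram_contractionP_gscalar: "gscalar x Z \<Longrightarrow> gram_contractionP x u (Z * F) = Z * gram_contractionP x u F"
  by (simp add: gscalar_def gram_contractionP_mult)

definition ext_multP :: "'v \<Rightarrow> 'v gpoly \<Rightarrow> 'v gpoly" where
  "ext_multP u F = cst half * (cst (vec u) * F + grade_invP F * cst (vec u))"

lemma ext_multP_add: "ext_multP u (F + G) = ext_multP u F + ext_multP u G"
  by (simp add: ext_multP_def grade_invP_add algebra_simps)

lemmas ext_multP_additive = additive_props[of "ext_multP u" for u, OF ext_multP_add]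

lemma ext_multP_single: "ext_multP u (Poly_Mapping.single n F) = Poly_Mapping.single n (ext_mult u F)"
  by (simp add: ext_multP_def ext_mult_def mult_single flip: single_add)

lemma ext_multP_gscalar:
  assumes "gscalar x Z" shows "ext_multP u (Z * F) = Z * ext_multP u F"
proof -
  have Z: "cst G * (Z * F) = Z * (cst G * F)" "grade_invP Z = Z" for F G
    using assms by (auto simp: gscalar_def intro!: commute_left)
  then show ?thesis
    by (simp add: ext_multP_def grade_invP_mult distrib_left mult.assoc)
qed

lemma ext_multP_anticommute: "ext_multP u (ext_multP v F) = - ext_multP v (ext_multP u F)"
  by (induction F rule: poly_mapping_single_induct)
    (simp_all add: ext_multP_add ext_multP_additive ext_multP_single ext_mult_anticommute[of u v] single_uminus)

lemma gram_contractionP_ext_multP: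
  "gram_contractionP x v (ext_multP u F) = half_gram x v u * F - ext_multP u (gram_contractionP x v F)"
  unfolding ext_multP_def
  by (subst skew_derivation_ext_mult[where \<beta> = grade_invP])
    (simp_all add: gram_contractionP_add gram_contractionP_mult grade_invP_gram_contractionP gram_contractionP_cst
      gram_contraction_vec half_gram_central[symmetric] cst_half_central[symmetric] half_add_half cst_uminus flip: single_add,
      simp add: half_def gram_contraction_scal)

text \<open>The sum of the two compositions commutes with multiplication by vectors from the left:
  when a vector is split off, the two Gram terms cancel between the two orders. It vanishes on 1,
  hence everywhere.\<close>

lemma gram_contractionP_anticommute:
  "gram_contractionP x u (gram_contractionP x v F) = - gram_contractionP x v (gram_contractionP x u F)"
proof -
  have *: "gram_contractionP x u (gram_contraction x v W) + gram_contractionP x v (gram_contraction x u W) = 0" for W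
  proof (induction W rule: radialB_induct)
    case one
    then show ?case using gram_contraction_scal[of x _ 1] by (simp add: gram_contractionP_additive)
  next
    case (add F G)
    have "gram_contractionP x u (gram_contraction x v (F + G)) + gram_contractionP x v (gram_contraction x u (F + G)) =
      (gram_contractionP x u (gram_contraction x v F) + gram_contractionP x v (gram_contraction x u F)) +
      (gram_contractionP x u (gram_contraction x v G) + gram_contractionP x v (gram_contraction x u G))"
      by (simp add: gram_contractionP_add gram_contraction_add algebra_simps)
    then show ?case using add by simp
  next
    case (scal b F)
    have "gram_contractionP x u (gram_contraction x v (scal b * F)) + gram_contractionP x v (gram_contraction x u (scal b * F)) =
      cst (scal b) * (gram_contractionP x u (gram_contraction x v F) + gram_contractionP x v (gram_contraction x u F))"
      by (simp add: gram_contraction_mult gram_contraction_scal gram_contractionP_gscalar gscalar_cst_scal distrib_left)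
    then show ?case using scal by simp
  next
    case (vec w F)
    have eq: "gram_contractionP x u (gram_contraction x v (vec w * F)) =
      half_gram x v w * gram_contraction x u F - half_gram x u w * gram_contraction x v F
        + cst (vec w) * gram_contractionP x u (gram_contraction x v F)" for u v
      by (simp add: gram_contraction_mult gram_contraction_vec gram_contractionP_add gram_contractionP_gscalar
          gscalar_half_gram[unfolded gscalar_def] gram_contractionP_cst cst_uminus gram_contractionP_additive gram_contractionP_mult)
    have "gram_contractionP x u (gram_contraction x v (vec w * F)) + gram_contractionP x v (gram_contraction x u (vec w * F)) =
      cst (vec w) * (gram_contractionP x u (gram_contraction x v F) + gram_contractionP x v (gram_contraction x u F))"
      unfolding eq by (simp add: algebra_simps)
    then show ?case using vec by simp
  qed
  have "gram_contractionP x u (gram_contractionP x v F) + gram_contractionP x v (gram_contractionP x u F) = 0"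
  proof (induction F rule: poly_mapping_single_induct)
    case (single_add n a F)
    have "gram_contractionP x u (gram_contractionP x v (Poly_Mapping.single n a)) =
      gram_contractionP x u (gram_contraction x v a) * mon n" for u v
      using gram_contraction_scal[of x u 1] by (simp add: gram_contractionP_single gram_contractionP_mult)
    then have "gram_contractionP x u (gram_contractionP x v (Poly_Mapping.single n a)) +
      gram_contractionP x v (gram_contractionP x u (Poly_Mapping.single n a)) = 0"
      by (simp add: * flip: distrib_right)
    then show ?case
      using single_add by (simp add: gram_contractionP_add algebra_simps)
  qed (simp add: gram_contractionP_additive)
  then show ?thesis by (simp add: eq_neg_iff_add_eq_0)
qed

section \<open>The Clifford action on formal polynomials and the symbol\<close>

definition clifford_op :: "'v \<Rightarrow> 'v \<Rightarrow> 'v gpoly \<Rightarrow> 'v gpoly" where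
  "clifford_op x u F = ext_multP u F + gram_contractionP x u F"

lemma clifford_op_add: "clifford_op x u (F + G) = clifford_op x u F + clifford_op x u G"
  by (simp add: clifford_op_def ext_multP_add gram_contractionP_add)

lemma clifford_op_gscalar: "gscalar x Z \<Longrightarrow> clifford_op x u (Z * F) = Z * clifford_op x u F"
  by (simp add: clifford_op_def ext_multP_gscalar gram_contractionP_gscalar distrib_left)

text \<open>The two exterior and the two contracting parts anticommute; the mixed terms contribute
  the Gram entries. The anticommutator is thus multiplication by a central polynomial, which is the
  radial relation.\<close>

lemma clifford_op_anticommutator:
  "clifford_op x u (clifford_op x v F) + clifford_op x v (clifford_op x u F) =
    half_gram x u v * F + half_gram x u v * F"
  unfolding clifford_op_def
  by (simp add: ext_multP_add gram_contractionP_add gram_contractionP_ext_multP ext_multP_anticommute[of u v]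
      gram_contractionP_anticommute[of x u v] half_gram_commute[of x v u])

lemma app_clifford_op: "app (Endo (clifford_op x v)) = clifford_op x v"
  by (rule app_Endo) (rule clifford_op_add)

definition mult_endo :: "'v gpoly \<Rightarrow> 'v gpoly endo" where "mult_endo Z = Endo (\<lambda>F. Z * F)"

lemma app_mult: "app (mult_endo Z) F = Z * F"
  unfolding mult_endo_def by (subst app_Endo) (simp_all add: distrib_left)

definition clifford_action :: "'v \<Rightarrow> 'v radialB \<Rightarrow> 'v gpoly endo" where
  "clifford_action x = (SOME \<Phi>. (\<forall>F G. \<Phi> (F + G) = \<Phi> F + \<Phi> G) \<and> (\<forall>F G. \<Phi> (F * G) = \<Phi> F * \<Phi> G) \<and>
    (\<forall>v. \<Phi> (vec v) = Endo (clifford_op x v)) \<and> (\<forall>b. \<Phi> (scal b) = mult_endo (cst (scal b))))"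

lemma
  fixes F G :: "'v radialB" and v x :: 'v
  shows clifford_action_add: "clifford_action x (F + G) = clifford_action x F + clifford_action x G"
    and clifford_action_mult: "clifford_action x (F * G) = clifford_action x F * clifford_action x G"
    and clifford_action_vec: "clifford_action x (vec v) = Endo (clifford_op x v)"
    and clifford_action_scal: "clifford_action x (scal b :: 'v radialB) = mult_endo (cst (scal b))"
proof -
  have anti: "app (anticommutator (Endo (clifford_op x u)) (Endo (clifford_op x v))) F =
      half_gram x u v * F + half_gram x u v * F" for u v F
    by (simp add: anticommutator_def app_clifford_op clifford_op_anticommutator)
  have "\<exists>\<Phi> :: 'v radialB \<Rightarrow> 'v gpoly endo. (\<forall>F G. \<Phi> (F + G) = \<Phi> F + \<Phi> G) \<and> (\<forall>F G. \<Phi> (F * G) = \<Phi> F * \<Phi> G) \<and>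
    (\<forall>v. \<Phi> (vec v) = Endo (clifford_op x v)) \<and> (\<forall>b. \<Phi> (scal b) = mult_endo (cst (scal b)))"
    by (rule radialB_universal; (rule endo_eqI)?)
      (simp_all add: app_mult app_clifford_op commutator_def anti clifford_op_gscalar gscalar_cst_scal
        gscalar_half_gram clifford_op_add scal_add scal_mult cst_add cst_mult distrib_right mult.assoc cst_1)
  from someI_ex[OF this, folded clifford_action_def]
  show "clifford_action x (F + G) = clifford_action x F + clifford_action x G"
    "clifford_action x (F * G) = clifford_action x F * clifford_action x G"
    "clifford_action x (vec v) = Endo (clifford_op x v)"
    "clifford_action x (scal b :: 'v radialB) = mult_endo (cst (scal b))"
    by blast+
qed

definition symbol :: "'v \<Rightarrow> 'v radialB \<Rightarrow> 'v gpoly" where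
  "symbol x F = app (clifford_action x F) 1"

lemma symbol_add: "symbol x (F + G) = symbol x F + symbol x G"
  by (simp add: symbol_def clifford_action_add)

lemmas symbol_additive = additive_props[of "symbol x" for x, OF symbol_add]

lemma symbol_scal_mult: "symbol x (scal b * F) = cst (scal b) * symbol x F"
  by (simp add: symbol_def clifford_action_mult clifford_action_scal app_mult)

lemma symbol_vec_mult: "symbol x (vec v * F) = clifford_op x v (symbol x F)"
  by (simp add: symbol_def clifford_action_mult clifford_action_vec app_clifford_op)

lemma symbol_1: "symbol x 1 = 1"
  using clifford_action_scal[of x 1] by (simp add: symbol_def app_mult)

lemma symbol_anticommutator_mult:
  "symbol x (anticommutator (vec u) (vec v) * F) = half_gram x u v * symbol x F + half_gram x u v * symbol x F"
  by (simp add: anticommutator_def distrib_right mult.assoc symbol_add symbol_vec_mult clifford_op_anticommutator)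

lemma symbol_half_mult: "symbol x (half * F) = cst half * symbol x F"
  by (simp add: half_def symbol_scal_mult)

lemma cst_half_mult_add: "cst half * F + cst half * F = F"
  using half_add_half by (metis cst_1 cst_add distrib_right mult_1)

lemma symbol_half_anticommutator_mult:
  "symbol x (half * anticommutator (vec u) (vec v) * F) = half_gram x u v * symbol x F"
  unfolding mult.assoc symbol_half_mult symbol_anticommutator_mult distrib_left by (rule cst_half_mult_add)

text \<open>Both contractions obey the same rule when a vector is split off on the left, so they
  agree by induction. Since left multiplication is exterior plus interior, the symbol then respects
  exterior multiplication too.\<close>

lemma symbol_int_mult: "symbol x (int_mult u F) = gram_contractionP x u (symbol x F)"
proof (induction F rule: radialB_induct)
  case one
  show ?case
    using int_mult_scal[of u 1] gram_contractionP_cst_scal[of x u 1]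
    by (simp add: symbol_additive symbol_1 cst_1)
next
  case (add F G)
  then show ?case by (simp add: int_mult_add symbol_add gram_contractionP_add)
next
  case (scal b F)
  then show ?case
    by (simp add: int_mult_mult int_mult_scal symbol_scal_mult gram_contractionP_gscalar gscalar_cst_scal)
next
  case (vec v F)
  have "int_mult u (vec v * F) = half * anticommutator (vec u) (vec v) * F - vec v * int_mult u F"
    by (simp add: int_mult_mult int_mult_vec)
  then have "symbol x (int_mult u (vec v * F)) =
      half_gram x u v * symbol x F - clifford_op x v (gram_contractionP x u (symbol x F))"
    by (simp only: symbol_additive symbol_half_anticommutator_mult symbol_vec_mult vec)
  also have "\<dots> = gram_contractionP x u (clifford_op x v (symbol x F))"
    by (simp add: clifford_op_def gram_contractionP_add gram_contractionP_ext_multP gram_contractionP_anticommute[of x u v])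
  finally show ?case by (simp add: symbol_vec_mult)
qed

lemma symbol_ext_mult: "symbol x (ext_mult u F) = ext_multP u (symbol x F)"
proof -
  have "symbol x (ext_mult u F) + symbol x (int_mult u F) = symbol x (vec u * F)"
    by (simp add: vec_mult_eq symbol_add)
  then show ?thesis by (simp add: symbol_vec_mult clifford_op_def symbol_int_mult)
qed

lemma symbol_ext_prod: "symbol x (ext_prod us) = cst (ext_prod us)"
  by (induction us) (simp_all add: symbol_ext_mult ext_multP_single symbol_1 cst_1)

section \<open>Scalar polynomials\<close>

lemma monoid_ring_ext_mult_const_left:
  fixes c :: "'c::ring_1 \<Rightarrow> 'd::ring_1"
  assumes c: "c 0 = 0" "\<And>a b. c (a + b) = c a + c b" "\<And>a. c (z * a) = z' * c a"
  shows "monoid_ring_ext c h (Poly_Mapping.single (0::'m::monoid_add) z * p) = z' * monoid_ring_ext c h p"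
  by (induction p rule: poly_mapping_single_induct)
    (simp_all add: monoid_ring_ext_add[of c, OF c(1,2)] monoid_ring_ext_single[of c, OF c(1)] c mult_single
      distrib_left mult.assoc, simp add: monoid_ring_ext_def)

section \<open>Indexed indeterminates and their translation into sets of vectors\<close>

lemma set_svars: "set (svars N) = insert Rvar (Svar ` {..<N} \<union> {Cvar i j | i j. i \<le> j \<and> j < N})"
  by (auto simp: svars_def less_Suc_eq_le image_iff simp del: upt_Suc)

lemma distinct_svars: "distinct (svars N)"
proof -
  have "distinct (concat (map (\<lambda>j. map (\<lambda>i. Cvar i j) [0..<Suc j]) [0..<N]))"
    by (rule distinct_concat) (auto simp: distinct_map inj_on_def dest!: map_eq_imp_length_eq simp del: upt_Suc)
  then show ?thesis
    by (auto simp: svars_def distinct_map inj_on_def simp del: upt_Suc)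
qed

fun svar_set :: "'v \<Rightarrow> 'v list \<Rightarrow> svar \<Rightarrow> 'v set" where
  "svar_set x ys Rvar = {x}"
| "svar_set x ys (Svar i) = {x, ys ! i}"
| "svar_set x ys (Cvar i j) = {ys ! i, ys ! j}"

text \<open>No two indeterminates may be merged: \<open>x \<notin> set ys\<close> separates the
  kinds, \<open>distinct ys\<close> the positions, and the convention i at most j for
  \<open>Cvar i j\<close> makes an unordered pair of vectors determine it.\<close>

lemma inj_on_svar_set:
  assumes "distinct ys" "x \<notin> set ys"
  shows "inj_on (svar_set x ys) (set (svars (length ys)))"
proof -
  have x: "ys ! i \<noteq> x \<and> x \<noteq> ys ! i" if "i < length ys" for i using assms that by (metis nth_mem)
  show ?thesis
    unfolding set_svars inj_on_def
    using assms(1) x by (auto simp: doubleton_eq_iff nth_eq_iff_index_eq singleton_insert_inj_eq)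
qed

text \<open>Exponents outside \<open>svars\<close> are discarded, exactly as evaluation by
  \<open>seval\<close> discards them; the lemmas below therefore hold for every monomial.\<close>

definition svar_set_mon :: "'v \<Rightarrow> 'v list \<Rightarrow> (svar \<Rightarrow>\<^sub>0 nat) \<Rightarrow> 'v set \<Rightarrow>\<^sub>0 nat" where
  "svar_set_mon x ys m =
    (\<Sum>v\<in>set (svars (length ys)). Poly_Mapping.single (svar_set x ys v) (Poly_Mapping.lookup m v))"

lemma lookup_svar_set_mon:
  assumes "distinct ys" "x \<notin> set ys" "v \<in> set (svars (length ys))"
  shows "Poly_Mapping.lookup (svar_set_mon x ys m) (svar_set x ys v) = Poly_Mapping.lookup m v"
proof -
  have "Poly_Mapping.lookup (svar_set_mon x ys m) (svar_set x ys v) =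
    (\<Sum>w\<in>set (svars (length ys)). if w = v then Poly_Mapping.lookup m v else 0)"
    unfolding svar_set_mon_def lookup_sum lookup_single when_def
    by (rule sum.cong) (use inj_on_svar_set[OF assms(1,2)] assms(3) in \<open>auto simp: inj_on_def\<close>)
  then show ?thesis using assms(3) by simp
qed

lemma keys_svar_set_mon: "Poly_Mapping.keys (svar_set_mon x ys m) \<subseteq> svar_set x ys ` set (svars (length ys))"
proof
  fix s assume s: "s \<in> Poly_Mapping.keys (svar_set_mon x ys m)"
  show "s \<in> svar_set x ys ` set (svars (length ys))"
  proof (rule ccontr)
    assume "s \<notin> svar_set x ys ` set (svars (length ys))"
    then have "Poly_Mapping.lookup (svar_set_mon x ys m) s = 0"
      unfolding svar_set_mon_def lookup_sum lookup_single when_def by (intro sum.neutral) auto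
    with s show False by (simp add: in_keys_iff)
  qed
qed

lemma svar_set_mon_minus:
  assumes ys: "distinct ys" "x \<notin> set ys" and u: "u \<in> set (svars (length ys))"
  shows "svar_set_mon x ys (m - Poly_Mapping.single u k) =
    svar_set_mon x ys m - Poly_Mapping.single (svar_set x ys u) k"
proof (rule poly_mapping_eqI)
  fix s
  show "Poly_Mapping.lookup (svar_set_mon x ys (m - Poly_Mapping.single u k)) s =
    Poly_Mapping.lookup (svar_set_mon x ys m - Poly_Mapping.single (svar_set x ys u) k) s"
  proof (cases "s \<in> svar_set x ys ` set (svars (length ys))")
    case True
    then obtain v where v: "v \<in> set (svars (length ys))" and s: "s = svar_set x ys v" by blast
    show ?thesis
      using inj_on_svar_set[OF ys] u v
      by (auto simp: s lookup_minus lookup_svar_set_mon[OF ys v] lookup_single when_def inj_on_def)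
  next
    case False
    have "Poly_Mapping.lookup (svar_set_mon x ys m') s = 0" for m'
      using False keys_svar_set_mon[of x ys m'] by (auto simp: in_keys_iff)
    then show ?thesis by (simp add: lookup_minus)
  qed
qed

text \<open>Products over finite sets require commutativity, which \<open>radialB\<close> lacks; the
  even central elements form a commutative ring that contains all values of scalar
  monomials.\<close>

typedef 'v even_center = "{Z :: 'v radialB. even_central Z}"
  by (rule exI[of _ "scal 0"]) (simp only: mem_Collect_eq even_central_scal)

setup_lifting type_definition_even_center

instantiation even_center :: (type) comm_ring_1
begin
lift_definition zero_even_center :: "'v even_center" is 0 using even_central_scal[of 0] by simp
lift_definition one_even_center :: "'v even_center" is 1 using even_central_scal[of 1] by simp
lift_definition plus_even_center :: "'v even_center \<Rightarrow> 'v even_center \<Rightarrow> 'v even_center" is "(+)"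
  by (rule even_central_add)
lift_definition uminus_even_center :: "'v even_center \<Rightarrow> 'v even_center" is uminus
  by (rule even_central_uminus)
lift_definition minus_even_center :: "'v even_center \<Rightarrow> 'v even_center \<Rightarrow> 'v even_center" is "(-)"
  using even_central_add even_central_uminus by (metis diff_conv_add_uminus)
lift_definition times_even_center :: "'v even_center \<Rightarrow> 'v even_center \<Rightarrow> 'v even_center" is "(*)"
  by (rule even_central_mult)
instance
proof
  fix a b :: "'v even_center"
  show "a * b = b * a" by transfer (unfold even_central_def, blast)
qed (transfer; simp add: algebra_simps)+
end

lemma Rep_even_center_prod_list: "Rep_even_center (prod_list l) = prod_list (map Rep_even_center l)"
  by (induction l) (simp_all add: one_even_center.rep_eq times_even_center.rep_eq)

lemma Rep_even_center_power: "Rep_even_center (Z ^ k) = Rep_even_center Z ^ k"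
  by (induction k) (simp_all add: one_even_center.rep_eq times_even_center.rep_eq)

text \<open>An unordered pair does not name its first element, so some enumeration is chosen;
  symmetry of the anticommutator makes the choice irrelevant.\<close>

definition gvar_value :: "'v \<Rightarrow> 'v set \<Rightarrow> 'v even_center" where
  "gvar_value x s = Abs_even_center (if s = {x} then vec x ^ 2
     else case SOME (u, v). s = {u, v} of (u, v) \<Rightarrow> anticommutator (vec u) (vec v))"

lemma gvar_value_doubleton:
  assumes "{u, v} \<noteq> {x}" shows "gvar_value x {u, v} = Abs_even_center (anticommutator (vec u) (vec v))"
proof -
  obtain u' v' where uv: "(SOME (u', v'). {u, v} = {u', v'}) = (u', v')" by fastforce
  have "case SOME (u', v'). {u, v} = {u', v'} of (u', v') \<Rightarrow> {u, v} = {u', v'}"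
    by (rule someI[of "\<lambda>(u', v'). {u, v} = {u', v'}" "(u, v)"]) simp
  then have "{u, v} = {u', v'}" by (simp add: uv)
  then show ?thesis
    unfolding gvar_value_def using assms uv
    by (auto simp: doubleton_eq_iff anticommutator_commute)
qed

lemma Rep_gvar_value:
  assumes "distinct ys" "x \<notin> set ys" "v \<in> set (svars (length ys))"
  shows "Rep_even_center (gvar_value x (svar_set x ys v)) = sval x ys v"
proof (cases v)
  case Rvar
  then show ?thesis by (simp add: gvar_value_def Abs_even_center_inverse even_central_square)
next
  case (Svar i)
  then have "ys ! i \<noteq> x" using assms by (auto simp: set_svars)
  then show ?thesis
    by (simp add: Svar gvar_value_doubleton Abs_even_center_inverse even_central_anticommutator)
next
  case (Cvar i j)
  then have "ys ! i \<noteq> x" using assms by (auto simp: set_svars)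
  then show ?thesis
    by (simp add: Cvar gvar_value_doubleton Abs_even_center_inverse even_central_anticommutator)
qed

lemma even_central_sval: "even_central (sval x ys v)"
  by (cases v) (simp_all add: even_central_square even_central_anticommutator)

definition gmon_value :: "'v \<Rightarrow> ('v set \<Rightarrow>\<^sub>0 nat) \<Rightarrow> 'v radialB" where
  "gmon_value x n = Rep_even_center (\<Prod>s\<in>Poly_Mapping.keys n. gvar_value x s ^ Poly_Mapping.lookup n s)"

definition smon_value :: "'v \<Rightarrow> 'v list \<Rightarrow> (svar \<Rightarrow>\<^sub>0 nat) \<Rightarrow> 'v radialB" where
  "smon_value x ys m = prod_list (map (\<lambda>v. sval x ys v ^ Poly_Mapping.lookup m v) (svars (length ys)))"

lemma gmon_value_svar_set_mon:
  assumes ys: "distinct ys" "x \<notin> set ys"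
  shows "gmon_value x (svar_set_mon x ys m) = smon_value x ys m"
proof -
  let ?n = "svar_set_mon x ys m" and ?V = "svars (length ys)"
  have "(\<Prod>s\<in>Poly_Mapping.keys ?n. gvar_value x s ^ Poly_Mapping.lookup ?n s) =
      (\<Prod>s\<in>svar_set x ys ` set ?V. gvar_value x s ^ Poly_Mapping.lookup ?n s)"
    by (rule prod.mono_neutral_left) (use keys_svar_set_mon[of x ys m] in \<open>auto simp: in_keys_iff\<close>)
  also have "\<dots> = (\<Prod>v\<in>set ?V. gvar_value x (svar_set x ys v) ^ Poly_Mapping.lookup m v)"
    unfolding prod.reindex[OF inj_on_svar_set[OF ys]] comp_def
    by (rule prod.cong) (simp_all add: lookup_svar_set_mon[OF ys])
  also have "\<dots> = prod_list (map (\<lambda>v. gvar_value x (svar_set x ys v) ^ Poly_Mapping.lookup m v) ?V)"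
    by (rule prod.distinct_set_conv_list[OF distinct_svars])
  finally show ?thesis
    unfolding gmon_value_def smon_value_def
    by (auto simp: Rep_even_center_prod_list Rep_even_center_power Rep_gvar_value[OF ys]
        intro!: arg_cong[of _ _ prod_list])
qed

lemma even_central_smon_value: "even_central (smon_value x ys m)"
proof -
  have "even_central (prod_list (map (\<lambda>v. sval x ys v ^ Poly_Mapping.lookup m v) l))" for l
    by (induction l)
      (use even_central_scal[of 1] in \<open>auto intro: even_central_mult even_central_power even_central_sval\<close>)
  then show ?thesis by (simp add: smon_value_def)
qed

lemma seval_eq: "seval x ys = monoid_ring_ext scal (smon_value x ys)"
  by (rule ext) (simp add: seval_def monoid_ring_ext_def smon_value_def)

lemma seval_add: "seval x ys (f + g) = seval x ys f + seval x ys g"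
  unfolding seval_eq by (rule monoid_ring_ext_add) (simp_all add: scal_add)

lemma seval_single: "seval x ys (Poly_Mapping.single m a) = scal a * smon_value x ys m"
  unfolding seval_eq by (rule monoid_ring_ext_single) simp

lemmas seval_additive = additive_props[of "seval x ys" for x ys, OF seval_add]

lemma even_central_seval: "even_central (seval x ys f)"
proof (induction f rule: poly_mapping_single_induct)
  case zero
  then show ?case using even_central_scal[of 0] by (simp add: seval_additive)
qed (auto simp: seval_add seval_single intro: even_central_add even_central_mult even_central_scal even_central_smon_value)

text \<open>The two Gram terms of an anticommutator add up to one indeterminate, and x squared is
  half of {x,x}; this is what the asymmetric normalization of \<open>half_gram\<close>
  achieves.\<close>

lemma symbol_sval_mult:
  assumes ys: "x \<notin> set ys" "v \<in> set (svars (length ys))"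
  shows "symbol x (sval x ys v * F) = gvar (svar_set x ys v) * symbol x F"
proof -
  have anti: "symbol x (anticommutator (vec u) (vec w) * F) = gvar {u, w} * symbol x F" if "u \<noteq> x \<or> w \<noteq> x" for u w
  proof -
    have "half_gram x u w = cst half * gvar {u, w}" using that by (auto simp: half_gram_def)
    then show ?thesis by (simp only: symbol_anticommutator_mult mult.assoc cst_half_mult_add)
  qed
  show ?thesis
  proof (cases v)
    case Rvar
    then show ?thesis
      by (simp add: vec_square symbol_half_anticommutator_mult half_gram_def)
  next
    case (Svar i)
    then have "ys ! i \<noteq> x" using ys by (auto simp: set_svars)
    then show ?thesis using anti by (simp add: Svar)
  next
    case (Cvar i j)
    then have "ys ! i \<noteq> x" using ys by (auto simp: set_svars)
    then show ?thesis using anti by (simp add: Cvar)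
  qed
qed

lemma symbol_smon_value_mult:
  assumes ys: "x \<notin> set ys"
  shows "symbol x (smon_value x ys m * F) = mon (svar_set_mon x ys m) * symbol x F"
proof -
  let ?e = "Poly_Mapping.lookup m"
  have pow: "symbol x (sval x ys v ^ k * F) = mon (Poly_Mapping.single (svar_set x ys v) k) * symbol x F"
    if "v \<in> set (svars (length ys))" for v k F
  proof (induction k)
    case (Suc k)
    have "symbol x (sval x ys v ^ Suc k * F) = gvar (svar_set x ys v) * mon (Poly_Mapping.single (svar_set x ys v) k) * symbol x F"
      by (simp only: power_Suc mult.assoc symbol_sval_mult[OF ys that] Suc)
    then show ?case by (simp add: mult_single flip: single_add)
  qed simp
  have "symbol x (prod_list (map (\<lambda>v. sval x ys v ^ ?e v) l) * F) =
      mon (sum_list (map (\<lambda>v. Poly_Mapping.single (svar_set x ys v) (?e v)) l)) * symbol x F"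
    if "set l \<subseteq> set (svars (length ys))" for l F
    using that
    by (induction l) (simp_all add: mult.assoc pow, simp add: mult_single flip: mult.assoc)
  from this[of "svars (length ys)" F] show ?thesis
    by (simp add: smon_value_def svar_set_mon_def sum_list_distinct_conv_sum_set[OF distinct_svars])
qed

section \<open>Jackson operators\<close>

text \<open>The number (1 - P^k)/(1 - P), written as a geometric sum so that no division
  occurs.\<close>

definition jackson_num :: "coeff \<Rightarrow> nat \<Rightarrow> coeff" where
  "jackson_num P k = (\<Sum>i<k. P ^ i)"

lemma jackson_num_mult: "(1 - P) * jackson_num P k = 1 - P ^ k"
  unfolding jackson_num_def by (simp add: one_diff_power_eq)

lemma lookup_jackson_shift:
  "Poly_Mapping.lookup (jackson_shift u P f) m = P ^ Poly_Mapping.lookup m u * Poly_Mapping.lookup f m"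
  unfolding jackson_shift_def by (simp add: lookup_mapp when_def in_keys_iff)

lemma jackson_shift_add: "jackson_shift u P (f + g) = jackson_shift u P f + jackson_shift u P g"
  by (rule poly_mapping_eqI) (simp add: lookup_jackson_shift lookup_add distrib_left)

lemma jackson_shift_single:
  "jackson_shift u P (Poly_Mapping.single m a) = Poly_Mapping.single m (P ^ Poly_Mapping.lookup m u * a)"
  by (rule poly_mapping_eqI) (simp add: lookup_jackson_shift lookup_single when_def)

text \<open>Provides the uniqueness that the definite description in \<open>jackson_deriv\<close>
  needs.\<close>

lemma single_mult_cancel:
  fixes f g :: "('a \<Rightarrow>\<^sub>0 nat) \<Rightarrow>\<^sub>0 coeff"
  assumes "c \<noteq> 0" "Poly_Mapping.single k c * f = Poly_Mapping.single k c * g"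
  shows "f = g"
proof (rule poly_mapping_eqI)
  fix m
  have l: "Poly_Mapping.lookup (Poly_Mapping.single k c * f) (k + m) = c * Poly_Mapping.lookup f m" for f
    by (induction f rule: poly_mapping_single_induct)
      (simp_all add: distrib_left lookup_add mult_single lookup_single when_def)
  show "Poly_Mapping.lookup f m = Poly_Mapping.lookup g m"
    using assms l[of f] l[of g] by simp
qed

text \<open>The familiar rule sending u^k to [k]_P u^(k-1) solves the defining equation, and
  multiplication by (1 - P) u is injective.\<close>

lemma jackson_deriv_eq:
  assumes P: "P \<noteq> 1"
  shows "jackson_deriv u P = monoid_ring_ext (Poly_Mapping.single 0)
    (\<lambda>m. Poly_Mapping.single (m - Poly_Mapping.single u 1) (jackson_num P (Poly_Mapping.lookup m u)))"
    (is "_ = ?J")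
proof
  fix f
  let ?M = "Poly_Mapping.single 0 (1 - P) * Poly_Mapping.single (Poly_Mapping.single u 1) (1 :: coeff)"
  have J_add: "?J (f + g) = ?J f + ?J g" for f g
    by (rule monoid_ring_ext_add) (simp_all add: single_add)
  have J_single: "?J (Poly_Mapping.single m a) =
      Poly_Mapping.single (m - Poly_Mapping.single u 1) (a * jackson_num P (Poly_Mapping.lookup m u))" for m a
    by (subst monoid_ring_ext_single) (simp_all add: mult_single)
  have J: "?M * ?J f = f - jackson_shift u P f"
  proof (induction f rule: poly_mapping_single_induct)
    case zero
    show ?case by (rule poly_mapping_eqI) (simp add: lookup_jackson_shift lookup_minus monoid_ring_ext_def)
  next
    case (single_add m a f)
    let ?k = "Poly_Mapping.lookup m u"
    have "?M * ?J (Poly_Mapping.single m a) = Poly_Mapping.single m (1 - P ^ ?k) * Poly_Mapping.single 0 a"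
    \<comment> \<open>For exponent 0 the truncated subtraction leaves the monomial unchanged, but
      the coefficient \<open>jackson_num P 0\<close> is zero.\<close>
    proof (cases "?k = 0")
      case True
      then show ?thesis unfolding J_single by (simp add: jackson_num_def)
    next
      case False
      have m: "Poly_Mapping.single u 1 + (m - Poly_Mapping.single u 1) = m"
        by (rule poly_mapping_eqI) (use False in \<open>auto simp: lookup_add lookup_minus lookup_single when_def\<close>)
      have c: "(1 - P) * (a * jackson_num P ?k) = (1 - P ^ ?k) * a"
        unfolding jackson_num_mult[symmetric] by (simp only: mult_ac)
      show ?thesis unfolding J_single mult_single by (simp only: m c add_0 add_0_right mult_1_right)
    qed
    also have "\<dots> = Poly_Mapping.single m a - jackson_shift u P (Poly_Mapping.single m a)"
      by (simp add: jackson_shift_single mult_single left_diff_distrib flip: single_diff)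
    finally show ?case
      using single_add by (simp only: J_add distrib_left jackson_shift_add) simp
  qed
  show "jackson_deriv u P f = ?J f"
    unfolding jackson_deriv_def
  proof (rule the_equality)
    fix g assume "?M * g = f - jackson_shift u P f"
    then have "?M * g = ?M * ?J f" using J by simp
    then show "g = ?J f"
      using single_mult_cancel[of "1 - P" "Poly_Mapping.single u 1" g "?J f"] P by (simp add: mult_single)
  qed (rule J)
qed

lemma jackson_deriv_add:
  "P \<noteq> 1 \<Longrightarrow> jackson_deriv u P (f + g) = jackson_deriv u P f + jackson_deriv u P g"
  by (simp add: jackson_deriv_eq monoid_ring_ext_add single_add)

lemma jackson_deriv_single:
  "P \<noteq> 1 \<Longrightarrow> jackson_deriv u P (Poly_Mapping.single m a) =
    Poly_Mapping.single (m - Poly_Mapping.single u 1) (jackson_num P (Poly_Mapping.lookup m u) * a)"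
  by (simp add: jackson_deriv_eq monoid_ring_ext_single mult_single mult.commute)

lemma Fract_poly_eq_iff: "Fraction_Field.Fract a 1 = Fraction_Field.Fract b 1 \<longleftrightarrow> a = (b :: 'a::idom)"
  by (simp add: eq_fract)

lemma q_neq_1: "q \<noteq> 1" and q2_neq_1: "q\<^sup>2 \<noteq> 1"
proof -
  have "[:[:0, 1::real:]:] \<noteq> 1" "[:[:0, 1::real:]:] * [:[:0, 1:]:] \<noteq> 1"
    by (simp_all add: one_pCons)
  then show "q \<noteq> 1" "q\<^sup>2 \<noteq> 1"
    unfolding power2_eq_square Rep_coeff_inject[symmetric]
    by (simp_all add: q.rep_eq times_coeff.rep_eq one_coeff.rep_eq One_fract_def Fract_poly_eq_iff)
qed

lemma one_minus_q_inv_mult: "(1 - q) * one_minus_q_inv = 1"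
proof -
  have "1 - q_fract \<noteq> 0"
    using q_neq_1 by (simp add: q.rep_eq one_coeff.rep_eq flip: Rep_coeff_inject)
  then show ?thesis
    by (simp add: q.rep_eq one_coeff.rep_eq times_coeff.rep_eq minus_coeff.rep_eq one_minus_q_inv.rep_eq
        flip: Rep_coeff_inject)
qed

lemma q_pow_nat: "q_pow (int k) = q ^ k" and q_pow_neg: "q_pow (- int k) = q_inv ^ k"
  by (auto simp: q_pow_def)

lemma q_num_nat: "q_num (int k) = jackson_num q k"
proof -
  have "q_num (int k) = (1 - q) * one_minus_q_inv * jackson_num q k"
    unfolding q_num_def q_pow_nat jackson_num_mult[symmetric] by (simp add: mult_ac)
  then show ?thesis by (simp add: one_minus_q_inv_mult)
qed

text \<open>Explains the factor 1 + q in the scalar derivative: it turns the numbers of base q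
  squared, coming from r, into the [2a]_q of the Green factors.\<close>

lemma q_num_double: "q_num (2 * int a) = (1 + q) * jackson_num (q\<^sup>2) a"
proof -
  have "(1 - q) * ((1 + q) * jackson_num (q\<^sup>2) a) = (1 - q\<^sup>2) * jackson_num (q\<^sup>2) a"
    by (simp add: algebra_simps power2_eq_square)
  also have "\<dots> = 1 - q_pow (2 * int a)"
    using q_pow_nat[of "2 * a"] by (simp add: jackson_num_mult power_mult)
  finally have "q_num (2 * int a) = (1 - q) * one_minus_q_inv * ((1 + q) * jackson_num (q\<^sup>2) a)"
    unfolding q_num_def by (simp add: mult_ac)
  then show ?thesis by (simp add: one_minus_q_inv_mult)
qed

text \<open>The scalar derivative of a monomial without an enumeration of Y. The powers of q squared
  come from the shift in r, and the sum ranges only over vectors whose s-variable really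
  occurs.\<close>

definition gmon_deriv :: "'v \<Rightarrow> ('v set \<Rightarrow>\<^sub>0 nat) \<Rightarrow> 'v radialB" where
  "gmon_deriv x n =
     scal ((1 + q) * jackson_num (q\<^sup>2) (Poly_Mapping.lookup n {x})) *
       (vec x * gmon_value x (n - Poly_Mapping.single {x} 1)) +
     2 * (\<Sum>y | y \<noteq> x \<and> {x, y} \<in> Poly_Mapping.keys n.
       scal ((q\<^sup>2) ^ Poly_Mapping.lookup n {x} * jackson_num q (Poly_Mapping.lookup n {x, y})) *
         (vec y * gmon_value x (n - Poly_Mapping.single {x, y} 1)))"

lemma gmon_deriv_svar_set_mon:
  assumes ys: "distinct ys" "x \<notin> set ys"
  shows "gmon_deriv x (svar_set_mon x ys m) =
     scal ((1 + q) * jackson_num (q\<^sup>2) (Poly_Mapping.lookup m Rvar)) *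
       (vec x * smon_value x ys (m - Poly_Mapping.single Rvar 1)) +
     2 * (\<Sum>i<length ys. scal ((q\<^sup>2) ^ Poly_Mapping.lookup m Rvar * jackson_num q (Poly_Mapping.lookup m (Svar i))) *
         (vec (ys ! i) * smon_value x ys (m - Poly_Mapping.single (Svar i) 1)))"
proof -
  let ?n = "svar_set_mon x ys m"
  let ?g = "\<lambda>y. scal ((q\<^sup>2) ^ Poly_Mapping.lookup ?n {x} * jackson_num q (Poly_Mapping.lookup ?n {x, y})) *
         (vec y * gmon_value x (?n - Poly_Mapping.single {x, y} 1))"
  have R: "Rvar \<in> set (svars (length ys))" and S: "i < length ys \<Longrightarrow> Svar i \<in> set (svars (length ys))" for i
    by (auto simp: set_svars)
  have "y \<in> set ys" if yx: "y \<noteq> x" and yk: "{x, y} \<in> Poly_Mapping.keys ?n" for y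
  proof -
    obtain v where "v \<in> set (svars (length ys))" "{x, y} = svar_set x ys v"
      using yk keys_svar_set_mon[of x ys m] by blast
    note v = this
    show ?thesis
      by (cases v) (use v ys yx in \<open>auto simp: set_svars doubleton_eq_iff\<close>)
  qed
  \<comment> \<open>A vanishing exponent gives a vanishing summand, so the sum may be extended from
    the occurring vectors to all of \<open>ys\<close>.\<close>
  moreover have j0: "jackson_num q 0 = 0" by (simp add: jackson_num_def)
  ultimately have "(\<Sum>y | y \<noteq> x \<and> {x, y} \<in> Poly_Mapping.keys ?n. ?g y) = (\<Sum>y\<in>set ys. ?g y)"
    using ys j0 by (intro sum.mono_neutral_left) (auto simp: in_keys_iff intro!: gr0I)
  also have "\<dots> = (\<Sum>i<length ys. ?g (ys ! i))"
    using sum.reindex_bij_betw[OF bij_betw_nth[OF ys(1) refl refl], of ?g] by simp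
  also have "\<dots> = (\<Sum>i<length ys. scal ((q\<^sup>2) ^ Poly_Mapping.lookup m Rvar * jackson_num q (Poly_Mapping.lookup m (Svar i))) *
         (vec (ys ! i) * smon_value x ys (m - Poly_Mapping.single (Svar i) 1)))"
  proof (rule sum.cong)
    fix i assume "i \<in> {..<length ys}"
    then have i: "Svar i \<in> set (svars (length ys))" using S by simp
    show "?g (ys ! i) = scal ((q\<^sup>2) ^ Poly_Mapping.lookup m Rvar * jackson_num q (Poly_Mapping.lookup m (Svar i))) *
         (vec (ys ! i) * smon_value x ys (m - Poly_Mapping.single (Svar i) 1))"
      using lookup_svar_set_mon[OF ys R, of m] lookup_svar_set_mon[OF ys i, of m] svar_set_mon_minus[OF ys i, of m 1]
      by (simp flip: gmon_value_svar_set_mon[OF ys])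
  qed simp
  finally show ?thesis
    unfolding gmon_deriv_def
    using lookup_svar_set_mon[OF ys R, of m] svar_set_mon_minus[OF ys R, of m 1]
    by (simp flip: gmon_value_svar_set_mon[OF ys])
qed

lemma scalar_deriv_add: "scalar_deriv x ys (f + g) = scalar_deriv x ys f + scalar_deriv x ys g"
  unfolding scalar_deriv_def
  by (simp add: jackson_deriv_add q_neq_1 q2_neq_1 jackson_shift_add seval_add distrib_left sum.distrib)

lemma scalar_deriv_single:
  assumes ys: "distinct ys" "x \<notin> set ys"
  shows "scalar_deriv x ys (Poly_Mapping.single m a) = scal a * gmon_deriv x (svar_set_mon x ys m)"
proof -
  have c: "vec v * (scal (b * a) * F) = scal a * (scal b * (vec v * F))" for v b F
    by (metis mult.assoc mult.commute scal_left_commute scal_mult)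
  have "vec (ys ! i) * seval x ys (jackson_shift Rvar (q\<^sup>2) (jackson_deriv (Svar i) q (Poly_Mapping.single m a))) =
      scal a * (scal ((q\<^sup>2) ^ Poly_Mapping.lookup m Rvar * jackson_num q (Poly_Mapping.lookup m (Svar i))) *
         (vec (ys ! i) * smon_value x ys (m - Poly_Mapping.single (Svar i) 1)))" for i
    unfolding jackson_deriv_single[OF q_neq_1] jackson_shift_single seval_single c[symmetric]
    by (simp add: lookup_minus lookup_single mult.assoc)
  moreover have "scal (1 + q) * vec x * seval x ys (jackson_deriv Rvar (q\<^sup>2) (Poly_Mapping.single m a)) =
      scal a * (scal ((1 + q) * jackson_num (q\<^sup>2) (Poly_Mapping.lookup m Rvar)) *
       (vec x * smon_value x ys (m - Poly_Mapping.single Rvar 1)))"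
    unfolding jackson_deriv_single[OF q2_neq_1] seval_single mult.assoc c
    unfolding scal_mult mult.assoc by (rule scal_left_commute)
  ultimately show ?thesis
    unfolding scalar_deriv_def gmon_deriv_svar_set_mon[OF ys]
    by (simp add: distrib_left sum_distrib_left mult_2)
qed

section \<open>Existence of the vector derivative and of exterior creation\<close>

text \<open>These two operators express the coefficients in the defining formulas of the derivative without
  reference to a basis: \<open>q_rescale\<close> multiplies a \<open>p\<close>-vector by \<open>q\<close> to the power \<open>-p\<close>, and contraction
  with \<open>x\<close> annihilates \<open>y\<^sub>I\<close> and takes \<open>x \<and> y\<^sub>I\<close> to \<open>y\<^sub>I\<close>.\<close>

definition vector_part :: "'v \<Rightarrow> 'v radialB \<Rightarrow> 'v radialB" where
  "vector_part x W = grade_inv (scal one_minus_q_inv *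
     (x_contraction x W - scal Q * q_rescale (x_contraction x W)))"

definition grade_weight :: "'v \<Rightarrow> 'v radialB \<Rightarrow> 'v radialB" where
  "grade_weight x W = x_contraction x (ext_mult x W) + ext_mult x (scal Q * q_rescale (x_contraction x W))"

text \<open>A product rule on the symbol: each term consists of a coefficient W and a monomial. The
  first summand acts on W and evaluates the monomial, the second weights W and differentiates the
  monomial.\<close>

definition q_deriv :: "'v \<Rightarrow> 'v radialB \<Rightarrow> 'v radialB" where
  "q_deriv x F = monoid_ring_ext (vector_part x) (gmon_value x) (symbol x F) +
     monoid_ring_ext (grade_weight x) (gmon_deriv x) (symbol x F)"

lemma x_contraction_scal_mult: "x_contraction x (scal b * F) = scal b * x_contraction x F"
  by (simp add: x_contraction_mult x_contraction_scal)

lemma q_rescale_0: "q_rescale 0 = 0"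
  using q_rescale_scal[of 0] unfolding scal_simps .

lemma vector_part_add: "vector_part x (F + G) = vector_part x F + vector_part x G"
  by (simp add: vector_part_def x_contraction_add q_rescale_add grade_inv_add grade_inv_additive algebra_simps
      flip: grade_inv_mult)

lemma vector_part_scal: "vector_part x (scal b * F) = scal b * vector_part x F"
  unfolding vector_part_def x_contraction_scal_mult q_rescale_mult q_rescale_scal scal_left_commute[of "scal Q"]
    right_diff_distrib[symmetric] scal_left_commute[of "scal one_minus_q_inv"] grade_inv_mult[of "scal b"] by simp

lemma grade_weight_add: "grade_weight x (F + G) = grade_weight x F + grade_weight x G"
  by (simp add: grade_weight_def x_contraction_add ext_mult_add q_rescale_add distrib_left)

lemma grade_weight_scal: "grade_weight x (scal b * F) = scal b * grade_weight x F"
  unfolding grade_weight_def x_contraction_scal_mult q_rescale_mult q_rescale_scal ext_mult_scal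
    scal_left_commute[of "scal Q"] distrib_left ..

lemmas vector_part_additive = additive_props[of "vector_part x" for x, OF vector_part_add]
lemmas grade_weight_additive = additive_props[of "grade_weight x" for x, OF grade_weight_add]

lemma q_deriv_add: "q_deriv x (F + G) = q_deriv x F + q_deriv x G"
  unfolding q_deriv_def symbol_add
  by (simp add: monoid_ring_ext_add vector_part_additive vector_part_add grade_weight_additive grade_weight_add)

lemma q_deriv_scal: "q_deriv x (scal b * F) = scal b * q_deriv x F"
  unfolding q_deriv_def symbol_scal_mult
  by (subst (1 2) monoid_ring_ext_mult_const_left[where z' = "scal b"])
    (simp_all add: vector_part_additive vector_part_add grade_weight_additive grade_weight_add
      vector_part_scal grade_weight_scal distrib_left)

lemma q_deriv_ext_prod_seval:
  assumes ys: "distinct ys" "x \<notin> set ys"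
  shows "q_deriv x (ext_prod us * seval x ys A) =
    vector_part x (ext_prod us) * seval x ys A + grade_weight x (ext_prod us) * scalar_deriv x ys A"
proof (induction A rule: poly_mapping_single_induct)
  case zero
  have "scalar_deriv x ys 0 = 0" using scalar_deriv_add[of x ys 0 0] by simp
  then show ?case
    using q_deriv_add[of x 0 0] by (simp add: seval_additive)
next
  case (single_add m a A)
  have "q_deriv x (ext_prod us * seval x ys (Poly_Mapping.single m a)) =
      scal a * q_deriv x (smon_value x ys m * ext_prod us)"
    unfolding seval_single q_deriv_scal[symmetric]
    using even_central_mult[OF even_central_scal even_central_smon_value, of a x ys m]
    by (simp add: even_central_def mult.assoc)
  also have "symbol x (smon_value x ys m * ext_prod us) = Poly_Mapping.single (svar_set_mon x ys m) (ext_prod us)"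
    by (simp add: symbol_smon_value_mult[OF ys(2)] symbol_ext_prod mult_single)
  then have "q_deriv x (smon_value x ys m * ext_prod us) =
      vector_part x (ext_prod us) * smon_value x ys m +
      grade_weight x (ext_prod us) * gmon_deriv x (svar_set_mon x ys m)"
    by (simp add: q_deriv_def monoid_ring_ext_single vector_part_additive grade_weight_additive
        gmon_value_svar_set_mon[OF ys])
  also have "scal a * \<dots> = vector_part x (ext_prod us) * seval x ys (Poly_Mapping.single m a) +
      grade_weight x (ext_prod us) * scalar_deriv x ys (Poly_Mapping.single m a)"
    unfolding seval_single scalar_deriv_single[OF ys] by (simp add: distrib_left scal_left_commute)
  finally show ?case
    using single_add by (simp add: seval_add scalar_deriv_add distrib_left q_deriv_add)
qed

lemma q_pow_m_neg: "q_pow_m (- int p) = Q * q_inv ^ p"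
  by (simp add: q_pow_m_def q_pow_neg)

lemma q_num_m_neg: "q_num_m (- int p) = (1 - Q * q_inv ^ p) * one_minus_q_inv"
  by (simp add: q_num_m_def q_pow_neg)

text \<open>After contraction with \<open>x\<close> the remaining \<open>p\<close> vectors are
  rescaled by \<open>q_inv ^ p\<close>, which yields 1 - Q q^(-p); the outer grade involution
  supplies the sign.\<close>

lemma vector_part_ext_prod:
  assumes "x \<notin> set us"
  shows "vector_part x (ext_prod us) = 0"
    "vector_part x (ext_prod (x # us)) = (- 1) ^ length us * scal (q_num_m (- int (length us))) * ext_prod us"
proof -
  show "vector_part x (ext_prod us) = 0"
    by (simp add: q_rescale_0 vector_part_def x_contraction_ext_prod[OF assms] grade_inv_additive)
  have "x_contraction x (ext_prod (x # us)) = ext_prod us"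
    by (simp add: x_contraction_ext_mult x_contraction_ext_prod[OF assms] ext_mult_additive)
  then have "vector_part x (ext_prod (x # us)) =
      scal one_minus_q_inv * (grade_inv (ext_prod us) - scal Q * (scal (q_inv ^ length us) * grade_inv (ext_prod us)))"
    by (simp add: vector_part_def q_rescale_ext_prod grade_inv_mult grade_inv_additive)
  also have "\<dots> = scal (q_num_m (- int (length us))) * grade_inv (ext_prod us)"
    unfolding q_num_m_neg scal_mult scal_diff mult.commute[of _ one_minus_q_inv] by (simp add: algebra_simps)
  finally show "vector_part x (ext_prod (x # us)) = (- 1) ^ length us * scal (q_num_m (- int (length us))) * ext_prod us"
    by (simp add: grade_inv_ext_prod minus_one_power_iff)
qed

text \<open>The two summands of \<open>grade_weight\<close> live on complementary pieces: the first
  is the identity on products without \<open>x\<close> and kills those beginning with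
  \<open>x\<close>, the second does the reverse with the weight q^(m-p).\<close>

lemma grade_weight_ext_prod:
  assumes "x \<notin> set us"
  shows "grade_weight x (ext_prod us) = ext_prod us"
    "grade_weight x (ext_prod (x # us)) = scal (q_pow_m (- int (length us))) * ext_prod (x # us)"
proof -
  show "grade_weight x (ext_prod us) = ext_prod us"
    by (simp add: q_rescale_0 grade_weight_def x_contraction_ext_prod[OF assms] x_contraction_ext_mult ext_mult_additive)
  have "x_contraction x (ext_prod (x # us)) = ext_prod us"
    by (simp add: x_contraction_ext_mult x_contraction_ext_prod[OF assms] ext_mult_additive)
  moreover have "x_contraction x 0 = 0" by (rule additive_props(1)[OF x_contraction_add])
  ultimately show "grade_weight x (ext_prod (x # us)) = scal (q_pow_m (- int (length us))) * ext_prod (x # us)"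
    by (simp add: grade_weight_def ext_mult_self q_rescale_ext_prod ext_mult_scal q_pow_m_neg scal_mult mult.assoc)
qed

lemma length_nths_card: "I \<subseteq> {..<length ys} \<Longrightarrow> length (nths ys I) = card I"
  by (auto simp: length_nths intro!: arg_cong[of _ _ card])

lemma is_right_q_deriv_q_deriv: "is_right_q_deriv x (q_deriv x)"
  unfolding is_right_q_deriv_def B_linear_def Let_def
proof (intro conjI allI impI ballI q_deriv_add q_deriv_scal; elim conjE)
  fix ys :: "'a list" and I A
  assume ys: "distinct ys" "x \<notin> set ys" and I: "I \<subseteq> {..<length ys}"
  have x: "x \<notin> set (nths ys I)" using ys(2) by (meson in_set_nthsD)
  show "q_deriv x (wedge (nths ys I) * seval x ys A) = wedge (nths ys I) * scalar_deriv x ys A"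
    unfolding wedge_eq_ext_prod q_deriv_ext_prod_seval[OF ys]
    by (simp add: vector_part_ext_prod[OF x] grade_weight_ext_prod[OF x])
  show "q_deriv x (wedge (x # nths ys I) * seval x ys A) =
      (- 1) ^ card I * scal (q_num_m (- int (card I))) * wedge (nths ys I) * seval x ys A +
      scal (q_pow_m (- int (card I))) * wedge (x # nths ys I) * scalar_deriv x ys A"
    unfolding wedge_eq_ext_prod q_deriv_ext_prod_seval[OF ys]
    by (simp add: vector_part_ext_prod[OF x] grade_weight_ext_prod[OF x] length_nths_card[OF I] del: ext_prod.simps)
qed

lemma is_creation_ext_mult: "is_creation x (ext_mult x)"
  unfolding is_creation_def wedge_eq_ext_prod
  by (auto simp: ext_mult_add ext_mult_even_central even_central_seval ext_mult_self)

section \<open>Spanning and uniqueness\<close>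

lemma smon_value_prod:
  "smon_value x ys m = Rep_even_center
     (\<Prod>v\<in>set (svars (length ys)). Abs_even_center (sval x ys v) ^ Poly_Mapping.lookup m v)"
  unfolding smon_value_def prod.distinct_set_conv_list[OF distinct_svars]
  by (simp add: Rep_even_center_prod_list Rep_even_center_power Abs_even_center_inverse even_central_sval comp_def)

lemma smon_value_add: "smon_value x ys (m + m') = smon_value x ys m * smon_value x ys m'"
  unfolding smon_value_prod lookup_add power_add prod.distrib by (rule times_even_center.rep_eq)

lemma smon_value_0: "smon_value x ys 0 = 1"
  unfolding smon_value_prod by (simp add: one_even_center.rep_eq)

lemma smon_value_single:
  assumes "v \<in> set (svars (length ys))"
  shows "smon_value x ys (Poly_Mapping.single v 1) = sval x ys v"
proof -
  have "(\<Prod>w\<in>set (svars (length ys)). Abs_even_center (sval x ys w) ^ Poly_Mapping.lookup (Poly_Mapping.single v 1) w) =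
    (\<Prod>w\<in>set (svars (length ys)). if w = v then Abs_even_center (sval x ys v) else 1)"
    by (rule prod.cong) (simp_all add: lookup_single when_def)
  also have "\<dots> = Abs_even_center (sval x ys v)" using assms by simp
  finally show ?thesis
    unfolding smon_value_prod by (simp add: Abs_even_center_inverse even_central_sval)
qed

lemma smon_value_remove:
  assumes "v \<in> set (svars (length ys))" "Poly_Mapping.lookup m v \<noteq> 0"
  shows "smon_value x ys m = sval x ys v * smon_value x ys (m - Poly_Mapping.single v 1)"
proof -
  have "m = Poly_Mapping.single v 1 + (m - Poly_Mapping.single v 1)"
    by (rule poly_mapping_eqI) (use assms in \<open>auto simp: lookup_add lookup_minus lookup_single when_def\<close>)
  then show ?thesis
    using smon_value_add[of x ys "Poly_Mapping.single v 1" "m - Poly_Mapping.single v 1"] smon_value_single[OF assms(1), of x]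
    by simp
qed

lemma anticommutator_eq_sval:
  assumes "u \<in> insert x (set ys)" "v \<in> insert x (set ys)"
  shows "\<exists>c w. w \<in> set (svars (length ys)) \<and> anticommutator (vec u) (vec v) = scal c * sval x ys w"
proof -
  have one: "\<exists>c w. w \<in> set (svars (length ys)) \<and> anticommutator (vec u) (vec v) = scal c * sval x ys w"
    if "w \<in> set (svars (length ys))" "anticommutator (vec u) (vec v) = sval x ys w" for w
    using that by (intro exI[of _ 1] exI[of _ w]) simp
  have S: "Svar i \<in> set (svars (length ys))" if "i < length ys" for i using that by (auto simp: set_svars)
  have C: "Cvar i j \<in> set (svars (length ys))" if "i \<le> j" "j < length ys" for i j using that by (auto simp: set_svars)
  consider (xx) "u = x" "v = x" | (xy) i where "u = x" "v = ys ! i" "i < length ys"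
    | (yx) i where "v = x" "u = ys ! i" "i < length ys"
    | (yy) i j where "u = ys ! i" "v = ys ! j" "i < length ys" "j < length ys"
    using assms by (auto simp: in_set_conv_nth)
  then show ?thesis
  proof cases
    case xx
    \<comment> \<open>Only {x,x} differs from an indeterminate, being 2 r; this is why the lemma
      allows a coefficient.\<close>
    have "anticommutator (vec x) (vec x) = scal (1 + 1) * sval x ys Rvar"
      by (simp only: anticommutator_def scal_add scal_simps distrib_right mult_1 power2_eq_square sval.simps)
    then show ?thesis
      using xx by (intro exI[of _ "1 + 1"] exI[of _ Rvar]) (simp add: set_svars)
  next
    case xy
    then show ?thesis using one[OF S] by simp
  next
    case yx
    then show ?thesis using one[OF S] by (simp add: anticommutator_commute)
  next
    case yy
    show ?thesis
    proof (cases "i \<le> j")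
      case True
      then show ?thesis using one[OF C[OF True]] yy by simp
    next
      case False
      then show ?thesis using one[OF C[of j i]] yy by (simp add: anticommutator_commute)
    qed
  qed
qed

definition anti_prod :: "('v \<times> 'v) list \<Rightarrow> 'v radialB" where
  "anti_prod l = prod_list (map (\<lambda>(u, v). anticommutator (vec u) (vec v)) l)"

lemma anti_prod_eq_smon_value:
  assumes "\<And>u v. (u, v) \<in> set l \<Longrightarrow> u \<in> insert x (set ys) \<and> v \<in> insert x (set ys)"
  shows "\<exists>c m. Poly_Mapping.keys m \<subseteq> set (svars (length ys)) \<and> anti_prod l = scal c * smon_value x ys m"
  using assms
proof (induction l)
  case Nil
  show ?case by (intro exI[of _ 1] exI[of _ 0]) (simp add: anti_prod_def smon_value_0)
next
  case (Cons uv l)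
  obtain u v where uv: "uv = (u, v)" by (cases uv)
  obtain c m where cm: "Poly_Mapping.keys m \<subseteq> set (svars (length ys))" "anti_prod l = scal c * smon_value x ys m"
    using Cons by (meson list.set_intros(2))
  obtain c' w where w: "w \<in> set (svars (length ys))" "anticommutator (vec u) (vec v) = scal c' * sval x ys w"
    using anticommutator_eq_sval[of u x ys v] Cons.prems[of u v] uv by auto
  have "anti_prod (uv # l) = scal c' * sval x ys w * (scal c * smon_value x ys m)"
    using cm w by (simp add: anti_prod_def uv)
  also have "\<dots> = scal (c' * c) * smon_value x ys (Poly_Mapping.single w 1 + m)"
    unfolding smon_value_add smon_value_single[OF w(1)] scal_mult mult.assoc
    by (simp only: scal_left_commute[of "sval x ys w"])
  finally show ?case
    using cm(1) w(1) keys_add[of "Poly_Mapping.single w 1" m]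
    by (intro exI[of _ "c' * c"] exI[of _ "Poly_Mapping.single w 1 + m"]) auto
qed

text \<open>The lists are arbitrary: repetitions and occurrences of \<open>x\<close> at any place
  are allowed. This makes closure under left multiplication by vectors easy, and the normal form is
  imposed afterwards.\<close>

inductive_set ext_span :: "'v radialB set" where
  base: "scal b * (anti_prod l * ext_prod us) \<in> ext_span"
| add: "F \<in> ext_span \<Longrightarrow> G \<in> ext_span \<Longrightarrow> F + G \<in> ext_span"

lemma ext_span_ext_prod: "ext_prod us \<in> ext_span"
  using ext_span.base[of 1 "[]" us] by (simp add: anti_prod_def)

lemma ext_span_scal: "F \<in> ext_span \<Longrightarrow> scal c * F \<in> ext_span"
proof (induction rule: ext_span.induct)
  case (base b l us)
  show ?case using ext_span.base[of "c * b" l us] by (simp only: scal_mult mult.assoc)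
qed (simp add: distrib_left ext_span.add)

lemma ext_span_anticommutator: "F \<in> ext_span \<Longrightarrow> anticommutator (vec u) (vec v) * F \<in> ext_span"
proof (induction rule: ext_span.induct)
  case (base b l us)
  have "anticommutator (vec u) (vec v) * (scal b * (anti_prod l * ext_prod us)) =
      scal b * (anti_prod ((u, v) # l) * ext_prod us)"
    by (simp add: anti_prod_def mult.assoc scal_left_commute[of "anticommutator _ _"])
  then show ?case by (simp only: ext_span.base)
qed (simp add: distrib_left ext_span.add)

lemma ext_span_anti_prod: "F \<in> ext_span \<Longrightarrow> anti_prod l * F \<in> ext_span"
  by (induction l) (auto simp: anti_prod_def mult.assoc ext_span_anticommutator)

lemma ext_span_sum: "(\<And>i. i \<in> A \<Longrightarrow> f i \<in> ext_span) \<Longrightarrow> sum f A \<in> ext_span"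
proof (induction A rule: infinite_finite_induct)
  case (insert i A)
  then show ?case by (simp add: ext_span.add)
qed (use ext_span.base[of 0 "[]" "[]"] in simp_all)

lemma anti_prod_central: "F * anti_prod l = anti_prod l * F"
proof (induction l)
  case (Cons uv l)
  obtain u v where "uv = (u, v)" by (cases uv)
  then have "anti_prod (uv # l) = anticommutator (vec u) (vec v) * anti_prod l" by (simp add: anti_prod_def)
  then show ?case using Cons by (simp only: mult.assoc commute_left[OF anticommutator_vec_central])
qed (simp add: anti_prod_def)

text \<open>Left multiplication is exterior plus interior; the former lengthens the list, and the
  latter expands into shorter lists with anticommutators as coefficients.\<close>

lemma ext_span_vec: "F \<in> ext_span \<Longrightarrow> vec v * F \<in> ext_span"
proof (induction rule: ext_span.induct)
  case (base b l us)
  have "(- 1) ^ i * (half * anticommutator (vec v) (vec (us ! i)) * ext_prod (drop_nth i us)) =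
      scal ((- 1) ^ i * (1 / 2) *\<^sub>R 1) * (anticommutator (vec v) (vec (us ! i)) * ext_prod (drop_nth i us))" for i
    by (cases "even i") (simp_all add: half_def scal_uminus mult.assoc)
  then have "int_mult v (ext_prod us) \<in> ext_span"
    unfolding int_mult_ext_prod
    by (intro ext_span_sum) (simp add: ext_span_scal ext_span_anticommutator ext_span_ext_prod del: mult_scaleR_right)
  then have "vec v * ext_prod us \<in> ext_span"
    unfolding vec_mult_eq using ext_span_ext_prod[of "v # us"] by (intro ext_span.add) simp_all
  then have "scal b * (anti_prod l * (vec v * ext_prod us)) \<in> ext_span"
    by (intro ext_span_scal ext_span_anti_prod)
  then show ?case
    by (simp only: scal_left_commute[of "vec v"] commute_left[OF anti_prod_central[of "vec v"]])
qed (simp add: distrib_left ext_span.add)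

lemma ext_span_UNIV: "F \<in> ext_span"
proof (induction F rule: radialB_induct)
  case one
  then show ?case using ext_span_ext_prod[of "[]"] by simp
qed (simp_all add: ext_span.add ext_span_scal ext_span_vec)

text \<open>Replaces the basis theorem in all later arguments. The set Y may vary from term to term,
  and the free coefficient \<open>b\<close> absorbs signs and covers zero.\<close>

lemma radialB_span_induct [case_names add even odd]:
  fixes F :: "'v radialB"
  assumes add: "\<And>F G. P F \<Longrightarrow> P G \<Longrightarrow> P (F + G)"
    and even: "\<And>ys I m b. distinct ys \<Longrightarrow> x \<notin> set ys \<Longrightarrow> I \<subseteq> {..<length ys} \<Longrightarrow>
      Poly_Mapping.keys m \<subseteq> set (svars (length ys)) \<Longrightarrow>
      P (ext_prod (nths ys I) * (scal b * smon_value x ys m))"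
    and odd: "\<And>ys I m b. distinct ys \<Longrightarrow> x \<notin> set ys \<Longrightarrow> I \<subseteq> {..<length ys} \<Longrightarrow>
      Poly_Mapping.keys m \<subseteq> set (svars (length ys)) \<Longrightarrow>
      P (ext_prod (x # nths ys I) * (scal b * smon_value x ys m))"
  shows "P F"
proof -
  have P0: "P 0" using even[of "[]" "{}" 0 0] by simp
  have enum: "\<exists>ys I c m. distinct ys \<and> x \<notin> set ys \<and> I \<subseteq> {..<length ys} \<and> us = nths ys I \<and>
      Poly_Mapping.keys m \<subseteq> set (svars (length ys)) \<and> anti_prod l = scal c * smon_value x ys m"
    if us: "distinct us" "x \<notin> set us" for us l
  proof -
    \<comment> \<open>The vectors that occur only in the scalar factor are appended to
      \<open>us\<close>, so that \<open>us\<close> itself sits at the initial positions of the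
      enumeration.\<close>
    define ws where "ws = remdups (filter (\<lambda>v. v \<noteq> x \<and> v \<notin> set us) (map fst l @ map snd l))"
    let ?ys = "us @ ws"
    have "u \<in> insert x (set ?ys) \<and> v \<in> insert x (set ?ys)" if "(u, v) \<in> set l" for u v
      using that by (auto simp: ws_def image_iff Bex_def)
    from anti_prod_eq_smon_value[of l x ?ys, OF this]
    obtain c m where cm: "Poly_Mapping.keys m \<subseteq> set (svars (length ?ys))" "anti_prod l = scal c * smon_value x ?ys m"
      by blast
    show ?thesis
    proof (intro exI[of _ ?ys] exI[of _ "{..<length us}"] exI[of _ c] exI[of _ m] conjI cm)
      show "distinct ?ys" "x \<notin> set ?ys" using us by (auto simp: ws_def)
      show "us = nths ?ys {..<length us}" by (simp only: nths_upt_eq_take) simp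
    qed simp
  qed
  have comm: "scal b * (scal c * smon_value x ys m * E) = E * (scal (b * c) * smon_value x ys m)" for b c E ys m
  proof -
    have "even_central (scal (b * c) * smon_value x ys m)"
      by (intro even_central_mult even_central_scal even_central_smon_value)
    then show ?thesis by (simp add: even_central_def scal_mult mult.assoc)
  qed
  have "F \<in> ext_span" by (rule ext_span_UNIV)
  then show ?thesis
  proof induction
    case (base b l us)
    consider "\<not> distinct us" | "distinct us" "x \<notin> set us" | "distinct us" "x \<in> set us" by blast
    then show ?case
    proof cases
      case 1
      then show ?thesis using P0 by (simp add: ext_prod_not_distinct)
    next
      case 2
      obtain ys I c m where E: "distinct ys" "x \<notin> set ys" "I \<subseteq> {..<length ys}" "us = nths ys I"
        "Poly_Mapping.keys m \<subseteq> set (svars (length ys))" "anti_prod l = scal c * smon_value x ys m"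
        using enum[OF 2, of l] by blast
      show ?thesis
        unfolding E(6) comm E(4) by (rule even[OF E(1-3,5)])
    next
      case 3
      then obtain us1 us2 where us: "us = us1 @ x # us2" by (meson split_list)
      then have "distinct (us1 @ us2)" "x \<notin> set (us1 @ us2)" using 3 by auto
      from enum[OF this, of l]
      obtain ys I c m where E: "distinct ys" "x \<notin> set ys" "I \<subseteq> {..<length ys}" "us1 @ us2 = nths ys I"
        "Poly_Mapping.keys m \<subseteq> set (svars (length ys))" "anti_prod l = scal c * smon_value x ys m"
        by blast
      \<comment> \<open>Moving \<open>x\<close> to the front costs one sign per preceding
        vector.\<close>
      have "scal b * (anti_prod l * ext_prod us) = scal ((- 1) ^ length us1 * b) * (anti_prod l * ext_prod (x # us1 @ us2))"
        unfolding us ext_prod_move by (cases "even (length us1)") (simp_all add: scal_uminus)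
      then show ?thesis
        unfolding E(6) comm E(4) by (simp only: odd[OF E(1-3,5)])
    qed
  qed (rule add)
qed

section \<open>Uniqueness of the derivative and of creation\<close>

lemma single_in_spolys:
  "Poly_Mapping.keys m \<subseteq> set (svars N) \<Longrightarrow> Poly_Mapping.single m b \<in> spolys N"
  by (auto simp: spolys_def)

lemma right_q_deriv_eq: "right_q_deriv x = q_deriv x"
  unfolding right_q_deriv_def
proof (rule the_equality)
  fix D assume D: "is_right_q_deriv x D"
  show "D = q_deriv x"
  proof
    fix F
    note spec = is_right_q_deriv_def Let_def wedge_eq_ext_prod B_linear_def
    show "D F = q_deriv x F"
    proof (induction F rule: radialB_span_induct[where x = x])
      case (add F G)
      then show ?case using D by (simp add: spec q_deriv_add)
    next
      case (even ys I m b)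
      note D' = D[unfolded spec, THEN conjunct2, rule_format, OF conjI[OF even(1) conjI[OF even(2,3)]]]
      note E' = is_right_q_deriv_q_deriv[of x, unfolded spec, THEN conjunct2, rule_format, OF conjI[OF even(1) conjI[OF even(2,3)]]]
      show ?case
        using bspec[OF conjunct1[OF D'] single_in_spolys[OF even(4)], of b] bspec[OF conjunct1[OF E'] single_in_spolys[OF even(4)], of b]
        by (simp add: seval_single)
    next
      case (odd ys I m b)
      note D' = D[unfolded spec, THEN conjunct2, rule_format, OF conjI[OF odd(1) conjI[OF odd(2,3)]]]
      note E' = is_right_q_deriv_q_deriv[of x, unfolded spec, THEN conjunct2, rule_format, OF conjI[OF odd(1) conjI[OF odd(2,3)]]]
      show ?case
        using bspec[OF conjunct2[OF D'] single_in_spolys[OF odd(4)], of b] bspec[OF conjunct2[OF E'] single_in_spolys[OF odd(4)], of b]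
        by (simp add: seval_single del: ext_prod.simps)
    qed
  qed
qed (rule is_right_q_deriv_q_deriv)

lemma creation_eq: "creation x = ext_mult x"
  unfolding creation_def
proof (rule the_equality)
  fix C assume C: "is_creation x C"
  show "C = ext_mult x"
  proof
    fix F
    note spec = is_creation_def wedge_eq_ext_prod
    show "C F = ext_mult x F"
    proof (induction F rule: radialB_span_induct[where x = x])
      case (add F G)
      then show ?case using C by (simp add: spec ext_mult_add)
    next
      case (even ys I m b)
      then show ?case
        using C is_creation_ext_mult[of x] single_in_spolys[OF even(4), of b]
        unfolding spec seval_single[symmetric] by (metis (no_types, lifting))
    next
      case (odd ys I m b)
      then show ?case
        using C is_creation_ext_mult[of x] single_in_spolys[OF odd(4), of b]
        unfolding spec seval_single[symmetric] by (metis (no_types, lifting))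
    qed
  qed
qed (rule is_creation_ext_mult)

section \<open>The \<open>q\<close>-Laplacian\<close>

text \<open>The bracket [2a]_q + q^(2a) ([b_1]_q + ... + [b_N]_q) of the Green factors, where a and
  b_i are the exponents of r and s_i.\<close>

abbreviation deriv_weight :: "'v list \<Rightarrow> (svar \<Rightarrow>\<^sub>0 nat) \<Rightarrow> coeff" where
  "deriv_weight ys m \<equiv> (1 + q) * jackson_num (q\<^sup>2) (Poly_Mapping.lookup m Rvar) +
    (\<Sum>i<length ys. (q\<^sup>2) ^ Poly_Mapping.lookup m Rvar * jackson_num q (Poly_Mapping.lookup m (Svar i)))"

lemma int_mult_even_central: "even_central Z \<Longrightarrow> int_mult u Z = 0"
  by (simp add: int_mult_def even_central_def)

lemma scal_sum: "scal (sum f A) = (\<Sum>i\<in>A. scal (f i))"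
  by (rule additive_props(4)) (rule scal_add)

text \<open>A q-analogue of Euler's identity. Contraction with \<open>x\<close> restores the
  variable that the derivative removed: x with x gives r, and x with y_i gives half of s_i,
  compensated by the factor 2 of the scalar derivative.\<close>

lemma int_mult_gmon_deriv:
  assumes ys: "distinct ys" "x \<notin> set ys"
  shows "int_mult x (gmon_deriv x (svar_set_mon x ys m)) = scal (deriv_weight ys m) * smon_value x ys m"
proof -
  let ?Z = "\<lambda>v. smon_value x ys (m - Poly_Mapping.single v 1)"
  have i: "int_mult x (scal c * (vec v * smon_value x ys m')) =
      scal c * (half * anticommutator (vec x) (vec v) * smon_value x ys m')" for c v m'
    by (simp add: int_mult_mult int_mult_scal int_mult_vec int_mult_even_central even_central_smon_value)
  have R: "scal ((1 + q) * jackson_num (q\<^sup>2) (Poly_Mapping.lookup m Rvar)) *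
      (half * anticommutator (vec x) (vec x) * ?Z Rvar) =
      scal ((1 + q) * jackson_num (q\<^sup>2) (Poly_Mapping.lookup m Rvar)) * smon_value x ys m"
  proof (cases "Poly_Mapping.lookup m Rvar = 0")
    case True
    then show ?thesis by (simp add: jackson_num_def)
  next
    case False
    have "Rvar \<in> set (svars (length ys))" by (auto simp: set_svars)
    from smon_value_remove[OF this False, of x] show ?thesis by (simp add: vec_square)
  qed
  have S: "scal ((q\<^sup>2) ^ Poly_Mapping.lookup m Rvar * jackson_num q (Poly_Mapping.lookup m (Svar i))) *
      (half * anticommutator (vec x) (vec (ys ! i)) * ?Z (Svar i)) =
      half * (scal ((q\<^sup>2) ^ Poly_Mapping.lookup m Rvar * jackson_num q (Poly_Mapping.lookup m (Svar i))) * smon_value x ys m)"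
    if "i < length ys" for i
  proof (cases "Poly_Mapping.lookup m (Svar i) = 0")
    case True
    then show ?thesis by (simp add: jackson_num_def)
  next
    case False
    have "Svar i \<in> set (svars (length ys))" using that by (auto simp: set_svars)
    from smon_value_remove[OF this False, of x] show ?thesis
      by (simp only: mult.assoc half_central sval.simps)
  qed
  have two: "int_mult x (2 * F) = 2 * int_mult x F" for F
    unfolding mult_2 int_mult_add ..
  have "int_mult x (gmon_deriv x (svar_set_mon x ys m)) =
      scal ((1 + q) * jackson_num (q\<^sup>2) (Poly_Mapping.lookup m Rvar)) * smon_value x ys m +
      2 * (half * (\<Sum>i<length ys. scal ((q\<^sup>2) ^ Poly_Mapping.lookup m Rvar * jackson_num q (Poly_Mapping.lookup m (Svar i))) * smon_value x ys m))"
    unfolding gmon_deriv_svar_set_mon[OF ys] int_mult_add two int_mult_additive i R sum_distrib_left[of half]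
    using S by simp
  then show ?thesis
    by (simp only: half_mult_2 scal_add scal_sum distrib_right sum_distrib_right)
qed

text \<open>Associativity of left multiplication by \<open>u\<close>, split into exterior and
  interior parts; subtracting the skew product rule of the interior part leaves this rule.\<close>

lemma ext_mult_mult: "ext_mult u (F * G) = ext_mult u F * G - grade_inv F * int_mult u G"
proof -
  have "ext_mult u (F * G) + int_mult u (F * G) = ext_mult u F * G + int_mult u F * G"
    by (simp only: vec_mult_eq[symmetric] mult.assoc[symmetric] distrib_right[symmetric])
  then show ?thesis by (simp add: int_mult_mult algebra_simps)
qed

lemma ext_mult_mult_gmon_deriv:
  assumes ys: "distinct ys" "x \<notin> set ys"
  shows "ext_mult x (F * gmon_deriv x (svar_set_mon x ys m)) =
    ext_mult x F * gmon_deriv x (svar_set_mon x ys m) -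
    scal (deriv_weight ys m) * (grade_inv F * smon_value x ys m)"
  by (simp only: ext_mult_mult int_mult_gmon_deriv[OF ys] scal_left_commute[of "grade_inv F"])

lemma q_deriv_smon:
  assumes ys: "distinct ys" "x \<notin> set ys" and us: "x \<notin> set us"
  shows "q_deriv x (ext_prod us * smon_value x ys m) = ext_prod us * gmon_deriv x (svar_set_mon x ys m)"
    "q_deriv x (ext_prod (x # us) * smon_value x ys m) =
      scal ((- 1) ^ length us * q_num_m (- int (length us))) * (ext_prod us * smon_value x ys m) +
      scal (q_pow_m (- int (length us))) * (ext_prod (x # us) * gmon_deriv x (svar_set_mon x ys m))"
  using q_deriv_ext_prod_seval[OF ys, of us "Poly_Mapping.single m 1"]
    q_deriv_ext_prod_seval[OF ys, of "x # us" "Poly_Mapping.single m 1"]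
  by (simp_all add: seval_single scalar_deriv_single[OF ys] vector_part_ext_prod[OF us] grade_weight_ext_prod[OF us]
      scal_mult scal_power scal_uminus mult.assoc del: ext_prod.simps)

definition laplace_weight :: "'v list \<Rightarrow> nat \<Rightarrow> (svar \<Rightarrow>\<^sub>0 nat) \<Rightarrow> coeff" where
  "laplace_weight ys p m = q_num_m (- int p) + q_pow_m (- int p) * deriv_weight ys m"

lemma q_laplacian_eq: "q_laplacian x F = q_deriv x (ext_mult x F) + ext_mult x (q_deriv x F)"
  by (simp add: q_laplacian_def right_q_deriv_eq creation_eq)

text \<open>Creation kills the argument, so only creation after the derivative contributes. Of the
  differentiated monomial it leaves just the Euler weight, and the p + 1 factors combine with the
  minus sign of the product rule to give the sign (-1)^p.\<close>

lemma q_laplacian_odd: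
  assumes ys: "distinct ys" "x \<notin> set ys" and us: "x \<notin> set us"
  shows "q_laplacian x (ext_prod (x # us) * smon_value x ys m) =
    scal ((- 1) ^ length us * laplace_weight ys (length us) m) * (ext_prod (x # us) * smon_value x ys m)"
proof -
  let ?Z = "smon_value x ys m" and ?p = "length us"
  have 0: "ext_mult x (ext_prod (x # us) * ?Z) = 0"
    by (simp add: ext_mult_even_central[OF even_central_smon_value] ext_mult_self)
  have e: "ext_mult x (ext_prod us * ?Z) = ext_prod (x # us) * ?Z"
    by (simp add: ext_mult_even_central[OF even_central_smon_value])
  have g: "grade_inv (ext_prod (x # us)) = - (scal ((- 1) ^ ?p) * ext_prod (x # us))"
    by (simp add: grade_inv_ext_prod scal_power scal_uminus del: ext_prod.simps)
  have d: "ext_mult x (ext_prod (x # us) * gmon_deriv x (svar_set_mon x ys m)) =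
      scal ((- 1) ^ ?p) * (scal (deriv_weight ys m) * (ext_prod (x # us) * ?Z))"
    unfolding ext_mult_mult_gmon_deriv[OF ys] g
    by (simp add: ext_mult_self mult.assoc) (rule scal_left_commute)
  have "q_laplacian x (ext_prod (x # us) * ?Z) =
    scal ((- 1) ^ ?p * q_num_m (- int ?p)) * (ext_prod (x # us) * ?Z) +
    scal (q_pow_m (- int ?p)) * (scal ((- 1) ^ ?p) * (scal (deriv_weight ys m) * (ext_prod (x # us) * ?Z)))"
    unfolding q_laplacian_eq 0 q_deriv_smon(2)[OF ys us] ext_mult_add ext_mult_scal e d
    using additive_props(1)[of "q_deriv x", OF q_deriv_add] by simp
  also have "\<dots> = scal ((- 1) ^ ?p * q_num_m (- int ?p) + q_pow_m (- int ?p) * ((- 1) ^ ?p * deriv_weight ys m)) *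
      (ext_prod (x # us) * ?Z)"
    by (simp only: scal_add scal_mult distrib_right mult.assoc)
  also have "(- 1) ^ ?p * q_num_m (- int ?p) + q_pow_m (- int ?p) * ((- 1) ^ ?p * deriv_weight ys m) =
      (- 1) ^ ?p * laplace_weight ys ?p m"
    by (simp add: laplace_weight_def algebra_simps)
  finally show ?thesis .
qed

text \<open>The diagonal part comes from the derivative after creation; pulling \<open>x\<close> out
  of the differentiated term leaves the Euler weight. All else has the form
  \<open>ext_mult x G\<close>.\<close>

lemma q_laplacian_even:
  assumes ys: "distinct ys" "x \<notin> set ys" and us: "x \<notin> set us"
  shows "\<exists>G. q_laplacian x (ext_prod us * smon_value x ys m) =
    scal ((- 1) ^ length us * laplace_weight ys (length us) m) * (ext_prod us * smon_value x ys m) + ext_mult x G"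
proof -
  let ?Z = "smon_value x ys m" and ?p = "length us" and ?d = "gmon_deriv x (svar_set_mon x ys m)"
  have e: "ext_mult x (ext_prod us * ?Z) = ext_prod (x # us) * ?Z"
    by (simp add: ext_mult_even_central[OF even_central_smon_value])
  have g: "grade_inv (ext_prod us) = scal ((- 1) ^ ?p) * ext_prod us"
    by (simp add: grade_inv_ext_prod scal_power scal_uminus)
  have d: "ext_prod (x # us) * ?d = ext_mult x (ext_prod us * ?d) + scal (deriv_weight ys m) * (scal ((- 1) ^ ?p) * (ext_prod us * ?Z))"
    unfolding ext_mult_mult_gmon_deriv[OF ys] g by (simp add: mult.assoc)
  have "q_laplacian x (ext_prod us * ?Z) =
    (scal ((- 1) ^ ?p * q_num_m (- int ?p)) * (ext_prod us * ?Z) +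
      scal (q_pow_m (- int ?p)) * (scal (deriv_weight ys m) * (scal ((- 1) ^ ?p) * (ext_prod us * ?Z)))) +
    ext_mult x (scal (q_pow_m (- int ?p)) * (ext_prod us * ?d) + ext_prod us * ?d)"
    unfolding q_laplacian_eq e q_deriv_smon[OF ys us] ext_mult_add ext_mult_scal d by (simp add: algebra_simps)
  also have "scal ((- 1) ^ ?p * q_num_m (- int ?p)) * (ext_prod us * ?Z) +
      scal (q_pow_m (- int ?p)) * (scal (deriv_weight ys m) * (scal ((- 1) ^ ?p) * (ext_prod us * ?Z))) =
      scal ((- 1) ^ ?p * q_num_m (- int ?p) + q_pow_m (- int ?p) * (deriv_weight ys m * (- 1) ^ ?p)) * (ext_prod us * ?Z)"
    by (simp only: scal_add scal_mult distrib_right mult.assoc)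
  also have "(- 1) ^ ?p * q_num_m (- int ?p) + q_pow_m (- int ?p) * (deriv_weight ys m * (- 1) ^ ?p) =
      (- 1) ^ ?p * laplace_weight ys ?p m"
    by (simp add: laplace_weight_def algebra_simps)
  finally show ?thesis by blast
qed

lemma laplace_weight_Omega:
  assumes ys: "distinct ys" "x \<notin> set ys" and p: "p \<le> length ys" and w: "w \<in> Omega x"
  shows "laplace_weight ys p m * w \<in> Omega x"
proof -
  \<comment> \<open>\<open>green_factor\<close> expects exponents indexed by vectors, whereas a
    monomial indexes them by positions.\<close>
  define \<beta> where "\<beta> y = Poly_Mapping.lookup (svar_set_mon x ys m) {x, y}" for y
  have \<beta>: "\<beta> (ys ! i) = Poly_Mapping.lookup m (Svar i)" if "i < length ys" for i
    using lookup_svar_set_mon[OF ys, of "Svar i" m] that by (auto simp: \<beta>_def set_svars)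
  have "(\<Sum>y\<in>set ys. q_num (int (\<beta> y))) = (\<Sum>i<length ys. q_num (int (\<beta> (ys ! i))))"
    using sum.reindex_bij_betw[OF bij_betw_nth[OF ys(1) refl refl], of "\<lambda>y. q_num (int (\<beta> y))"] by simp
  also have "\<dots> = (\<Sum>i<length ys. jackson_num q (Poly_Mapping.lookup m (Svar i)))"
    by (simp add: \<beta> q_num_nat)
  finally have "green_factor (set ys) p (Poly_Mapping.lookup m Rvar) \<beta> = laplace_weight ys p m"
    using q_pow_nat[of "2 * Poly_Mapping.lookup m Rvar"]
    by (simp add: green_factor_def laplace_weight_def q_num_double sum_distrib_left power_mult)
  then show ?thesis
    using Omega.factor[OF w, of "set ys" p "Poly_Mapping.lookup m Rvar" \<beta>] ys p by (simp add: distinct_card)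
qed

lemma B_linear_additive: "B_linear T \<Longrightarrow> T (F - G) = T F - T G" "B_linear T \<Longrightarrow> T 0 = 0" "B_linear T \<Longrightarrow> T (- F) = - T F"
  unfolding B_linear_def using additive_props(1-3)[of T] by blast+

lemma B_linear_ext_mult: "B_linear (ext_mult x)"
  by (simp add: B_linear_def ext_mult_add ext_mult_scal)

lemma B_linear_q_deriv: "B_linear (q_deriv x)"
  by (simp add: B_linear_def q_deriv_add q_deriv_scal)

lemma B_linear_scal: "B_linear (\<lambda>F. scal b * F)"
  unfolding B_linear_def by (intro conjI allI distrib_left scal_left_commute)

lemma B_linear_q_laplacian: "B_linear (q_laplacian x)"
  by (simp add: B_linear_def q_laplacian_eq q_deriv_add q_deriv_scal ext_mult_add ext_mult_scal distrib_left)

section \<open>Inverting the Laplacian up to a denominator\<close>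

text \<open>The bicommutant is a commutative algebra of operators containing the Laplacian; up to a
  denominator, it will contain the inverse of the Laplacian on every given element.\<close>

definition laplace_bicommutant :: "'v \<Rightarrow> ('v radialB \<Rightarrow> 'v radialB) set" where
  "laplace_bicommutant x = {K. B_linear K \<and>
    (\<forall>L. B_linear L \<and> (\<forall>F. L (q_laplacian x F) = q_laplacian x (L F)) \<longrightarrow> (\<forall>F. K (L F) = L (K F)))}"

lemma laplace_bicommutant_laplacian: "q_laplacian x \<in> laplace_bicommutant x"
  by (simp add: laplace_bicommutant_def B_linear_q_laplacian)

lemma laplace_bicommutant_scal: "(\<lambda>F. scal b * F) \<in> laplace_bicommutant x"
proof -
  have "scal b * L F = L (scal b * F)" if "B_linear L" for L F
    using that by (simp add: B_linear_def)
  then show ?thesis unfolding laplace_bicommutant_def using B_linear_scal by blast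
qed

lemma laplace_bicommutant_diff:
  "K \<in> laplace_bicommutant x \<Longrightarrow> L \<in> laplace_bicommutant x \<Longrightarrow> (\<lambda>F. K F - L F) \<in> laplace_bicommutant x"
  by (auto simp: laplace_bicommutant_def B_linear_additive) (auto simp: B_linear_def right_diff_distrib)

lemma laplace_bicommutant_add:
  "K \<in> laplace_bicommutant x \<Longrightarrow> L \<in> laplace_bicommutant x \<Longrightarrow> (\<lambda>F. K F + L F) \<in> laplace_bicommutant x"
  by (auto simp: laplace_bicommutant_def B_linear_def distrib_left)

lemma laplace_bicommutant_comp:
  "K \<in> laplace_bicommutant x \<Longrightarrow> L \<in> laplace_bicommutant x \<Longrightarrow> (\<lambda>F. K (L F)) \<in> laplace_bicommutant x"
  by (auto simp: laplace_bicommutant_def B_linear_def)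

lemma laplace_bicommutantD:
  assumes "K \<in> laplace_bicommutant x"
  shows "B_linear K" "K (q_laplacian x F) = q_laplacian x (K F)"
  using assms B_linear_q_laplacian[of x] by (auto simp: laplace_bicommutant_def)

lemma laplace_bicommutant_commute:
  assumes "K \<in> laplace_bicommutant x" "L \<in> laplace_bicommutant x"
  shows "K (L F) = L (K F)"
  using assms laplace_bicommutantD[OF assms(2)] by (auto simp: laplace_bicommutant_def)

text \<open>Both the denominator and the operator may depend on \<open>F\<close>. Membership of K in
  the bicommutant makes the property additive and also gives the left-inverse form w F = K (H
  F).\<close>

definition laplace_invertible :: "'v \<Rightarrow> 'v radialB \<Rightarrow> bool" where
  "laplace_invertible x F \<longleftrightarrow>
    (\<exists>w\<in>Omega x. \<exists>K\<in>laplace_bicommutant x. scal w * F = q_laplacian x (K F))"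

lemma Omega_mult: "v \<in> Omega x \<Longrightarrow> w \<in> Omega x \<Longrightarrow> v * w \<in> Omega x"
  by (induction rule: Omega.induct) (auto simp: mult.assoc intro: Omega.factor)

lemma laplace_invertible_add:
  assumes "laplace_invertible x F" "laplace_invertible x G"
  shows "laplace_invertible x (F + G)"
proof -
  let ?H = "q_laplacian x"
  obtain w K where w: "w \<in> Omega x" and K: "K \<in> laplace_bicommutant x" and F: "scal w * F = ?H (K F)"
    using assms(1) by (auto simp: laplace_invertible_def)
  obtain v L where v: "v \<in> Omega x" and L: "L \<in> laplace_bicommutant x" and G: "scal v * G = ?H (L G)"
    using assms(2) by (auto simp: laplace_invertible_def)
  \<comment> \<open>Read off from (w - H K)(v - H L) = w v - H M: the left side annihilates
    \<open>F\<close> as well as \<open>G\<close>, because its factors commute.\<close>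
  define M where "M = (\<lambda>F. (scal w * L F + scal v * K F) - ?H (K (L F)))"
  have M: "M \<in> laplace_bicommutant x"
    unfolding M_def
    by (rule laplace_bicommutant_diff[OF laplace_bicommutant_add[
          OF laplace_bicommutant_comp[OF laplace_bicommutant_scal L]
            laplace_bicommutant_comp[OF laplace_bicommutant_scal K]]
          laplace_bicommutant_comp[OF laplace_bicommutant_laplacian laplace_bicommutant_comp[OF K L]]])
  note lin = laplace_bicommutantD(1)[OF K] laplace_bicommutantD(1)[OF L] B_linear_q_laplacian[of x]
  have add: "?H (A + B) = ?H A + ?H B" and sc: "?H (scal b * A) = scal b * ?H A"
    and Ksc: "K (scal b * A) = scal b * K A" and Lsc: "L (scal b * A) = scal b * L A" for A B b
    using lin by (auto simp: B_linear_def)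
  have HM: "?H (M A) = scal w * ?H (L A) + scal v * ?H (K A) - ?H (?H (K (L A)))" for A
    by (simp add: M_def B_linear_additive[OF B_linear_q_laplacian] add sc)
  have "?H (?H (K (L F))) = ?H (L (scal w * F))"
    unfolding F laplace_bicommutantD(2)[OF L] laplace_bicommutant_commute[OF K L] ..
  then have 1: "?H (M F) = scal (w * v) * F"
    unfolding HM Lsc sc F[symmetric] by (simp add: scal_mult mult.assoc scal_left_commute[of "scal v"])
  have "?H (?H (K (L G))) = ?H (K (scal v * G))"
    unfolding G laplace_bicommutantD(2)[OF K] ..
  then have 2: "?H (M G) = scal (w * v) * G"
    unfolding HM Ksc sc G[symmetric] by (simp add: scal_mult mult.assoc)
  have "M (F + G) = M F + M G" using laplace_bicommutantD(1)[OF M] by (simp add: B_linear_def)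
  then have "scal (w * v) * (F + G) = ?H (M (F + G))" by (simp add: add 1 2 distrib_left)
  then show ?thesis
    unfolding laplace_invertible_def by (rule bexI[OF bexI[OF _ M] Omega_mult[OF w v]])
qed

lemma laplace_invertible_eigen:
  assumes H: "q_laplacian x F = scal ((- 1) ^ k * \<mu>) * F + G" and G: "laplace_invertible x G"
    and \<mu>: "\<And>w. w \<in> Omega x \<Longrightarrow> \<mu> * w \<in> Omega x"
  shows "laplace_invertible x F"
proof -
  let ?H = "q_laplacian x"
  obtain w K where w: "w \<in> Omega x" and K: "K \<in> laplace_bicommutant x" and G: "scal w * G = ?H (K G)"
    using G by (auto simp: laplace_invertible_def)
  \<comment> \<open>Multiplying H F = e \<mu> F + G by w, with e the sign, gives e \<mu> w F = H (w
    F - K G). Writing G as (H - e \<mu>) F makes the solution operator an expression in H, K and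
    scalars, hence an element of the bicommutant.\<close>
  define M where "M = (\<lambda>F. scal ((- 1) ^ k) * (scal w * F - K (?H F - scal ((- 1) ^ k * \<mu>) * F)))"
  have M: "M \<in> laplace_bicommutant x"
    unfolding M_def
    by (rule laplace_bicommutant_comp[OF laplace_bicommutant_scal laplace_bicommutant_diff[
          OF laplace_bicommutant_scal laplace_bicommutant_comp[OF K laplace_bicommutant_diff[
            OF laplace_bicommutant_laplacian laplace_bicommutant_scal]]]])
  have sc: "?H (scal b * A) = scal b * ?H A" for b A
    using B_linear_q_laplacian[of x] by (auto simp: B_linear_def)
  have "M F = scal ((- 1) ^ k) * (scal w * F - K G)" by (simp add: M_def H)
  then have "?H (M F) = scal ((- 1) ^ k) * (scal w * ?H F - scal w * G)"
    by (simp only: sc B_linear_additive[OF B_linear_q_laplacian] G)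
  also have "\<dots> = scal ((- 1) ^ k) * (scal w * (scal ((- 1) ^ k * \<mu>) * F))"
    by (simp add: H distrib_left)
  also have "\<dots> = scal ((- 1) ^ k * (w * ((- 1) ^ k * \<mu>))) * F"
    by (simp only: scal_mult mult.assoc)
  also have "(- 1) ^ k * (w * ((- 1) ^ k * \<mu>)) = \<mu> * w"
    by (cases "even k") simp_all
  finally have "scal (\<mu> * w) * F = ?H (M F)" by (rule sym)
  then show ?thesis
    unfolding laplace_invertible_def by (rule bexI[OF bexI[OF _ M] \<mu>[OF w]])
qed

lemma laplace_invertible_0: "laplace_invertible x 0"
proof -
  have "scal 1 * 0 = q_laplacian x (q_laplacian x 0)"
    by (simp add: B_linear_additive(2)[OF B_linear_q_laplacian])
  then show ?thesis
    unfolding laplace_invertible_def by (rule bexI[OF bexI[OF _ laplace_bicommutant_laplacian] Omega.one])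
qed

lemma laplace_invertible_odd:
  assumes "distinct ys" "x \<notin> set ys" "I \<subseteq> {..<length ys}"
  shows "laplace_invertible x (ext_prod (x # nths ys I) * (scal b * smon_value x ys m))"
proof (rule laplace_invertible_eigen[OF _ laplace_invertible_0 laplace_weight_Omega[OF assms(1,2)]])
  have us: "x \<notin> set (nths ys I)" using assms(2) by (meson in_set_nthsD)
  have sc: "q_laplacian x (scal b * A) = scal b * q_laplacian x A" for A
    using B_linear_q_laplacian[of x] by (auto simp: B_linear_def)
  show "q_laplacian x (ext_prod (x # nths ys I) * (scal b * smon_value x ys m)) =
      scal ((- 1) ^ length (nths ys I) * laplace_weight ys (length (nths ys I)) m) *
        (ext_prod (x # nths ys I) * (scal b * smon_value x ys m)) + 0"
    unfolding scal_left_commute[of "ext_prod _"] sc q_laplacian_odd[OF assms(1,2) us] add_0_right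
    by (rule scal_left_commute)
  show "length (nths ys I) \<le> length ys"
    unfolding length_nths_card[OF assms(3)] using card_mono[OF finite_lessThan assms(3)] by simp
qed

text \<open>The image of creation is spanned by the terms on which H is diagonal; this absorbs the
  off-diagonal remainder in the even case.\<close>

lemma laplace_invertible_ext_mult: "laplace_invertible x (ext_mult x F)"
proof (induction F rule: radialB_span_induct[where x = x])
  case (add F G)
  then show ?case by (simp add: ext_mult_add laplace_invertible_add)
next
  case (even ys I m b)
  have "ext_mult x (ext_prod (nths ys I) * (scal b * smon_value x ys m)) =
      ext_prod (x # nths ys I) * (scal b * smon_value x ys m)"
    by (simp add: ext_mult_even_central even_central_mult even_central_scal even_central_smon_value)
  then show ?case using laplace_invertible_odd[OF even(1-3)] by simp
next
  case (odd ys I m b)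
  have "ext_mult x (ext_prod (x # nths ys I) * (scal b * smon_value x ys m)) = 0"
    by (simp add: ext_mult_even_central even_central_mult even_central_scal even_central_smon_value ext_mult_self)
  then show ?case by (simp add: laplace_invertible_0)
qed

lemma laplace_invertible: "laplace_invertible x F"
proof (induction F rule: radialB_span_induct[where x = x])
  case (add F G)
  then show ?case by (rule laplace_invertible_add)
next
  case (even ys I m b)
  have us: "x \<notin> set (nths ys I)" using even(2) by (meson in_set_nthsD)
  have sc: "q_laplacian x (scal b * A) = scal b * q_laplacian x A" for A
    using B_linear_q_laplacian[of x] by (auto simp: B_linear_def)
  obtain G where G: "q_laplacian x (ext_prod (nths ys I) * smon_value x ys m) =
      scal ((- 1) ^ length (nths ys I) * laplace_weight ys (length (nths ys I)) m) *
        (ext_prod (nths ys I) * smon_value x ys m) + ext_mult x G"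
    using q_laplacian_even[OF even(1,2) us] by blast
  show ?case
  proof (rule laplace_invertible_eigen[OF _ laplace_invertible_ext_mult[of x "scal b * G"] laplace_weight_Omega[OF even(1,2)]])
    show "q_laplacian x (ext_prod (nths ys I) * (scal b * smon_value x ys m)) =
      scal ((- 1) ^ length (nths ys I) * laplace_weight ys (length (nths ys I)) m) *
        (ext_prod (nths ys I) * (scal b * smon_value x ys m)) + ext_mult x (scal b * G)"
      unfolding scal_left_commute[of "ext_prod _"] sc G ext_mult_scal distrib_left
      by (simp only: scal_left_commute[of "scal b"])
    show "length (nths ys I) \<le> length ys"
      unfolding length_nths_card[OF even(3)] using card_mono[OF finite_lessThan even(3)] by simp
  qed
next
  case (odd ys I m b)
  then show ?case by (intro laplace_invertible_odd)
qed

section \<open>Localization\<close>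

lemma scal_scal: "scal a * (scal b * F) = scal (a * b) * F"
  by (simp add: scal_mult mult.assoc)

lemma equiv_frac_rel: "equiv (UNIV \<times> Omega x) (frac_rel x)"
proof (rule equivI)
  show "refl_on (UNIV \<times> Omega x) (frac_rel x)"
    by (auto simp: refl_on_def frac_rel_def intro: Omega.one)
  show "frac_rel x \<subseteq> (UNIV \<times> Omega x) \<times> (UNIV \<times> Omega x)"
    by (auto simp: frac_rel_def)
  show "sym (frac_rel x)"
    by (rule symI) (force simp: frac_rel_def right_diff_distrib)
  show "trans (frac_rel x)"
  proof (rule transI)
    fix a b c assume "(a, b) \<in> frac_rel x" "(b, c) \<in> frac_rel x"
    then obtain F w G v H t u u' where abc: "a = (F, w)" "b = (G, v)" "c = (H, t)"
      and \<Omega>: "w \<in> Omega x" "v \<in> Omega x" "t \<in> Omega x" "u \<in> Omega x" "u' \<in> Omega x"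
      and u: "scal u * (scal v * F - scal w * G) = 0" and u': "scal u' * (scal t * G - scal v * H) = 0"
      by (cases a; cases b; cases c) (auto simp: frac_rel_def)
    \<comment> \<open>The multipliers \<open>t * u'\<close> and \<open>w * u\<close> are chosen so
      that the terms with \<open>G\<close> cancel.\<close>
    have "scal (u * u' * v) * (scal t * F - scal w * H) =
        scal (t * u') * (scal u * (scal v * F - scal w * G)) + scal (w * u) * (scal u' * (scal t * G - scal v * H))"
      by (simp only: right_diff_distrib scal_scal mult_ac) simp
    then have "scal (u * u' * v) * (scal t * F - scal w * H) = 0" by (simp add: u u')
    moreover have "u * u' * v \<in> Omega x" using \<Omega> by (intro Omega_mult)
    ultimately show "(a, c) \<in> frac_rel x" using \<Omega> by (auto simp: abc frac_rel_def)
  qed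
qed

lemma frac_eq_iff:
  assumes "w \<in> Omega x" "v \<in> Omega x"
  shows "frac x F w = frac x G v \<longleftrightarrow> (\<exists>u\<in>Omega x. scal u * (scal v * F - scal w * G) = 0)"
  unfolding frac_def using assms
  by (subst eq_equiv_class_iff[OF equiv_frac_rel]) (auto simp: frac_rel_def)

lemma frac_eqI:
  "w \<in> Omega x \<Longrightarrow> v \<in> Omega x \<Longrightarrow> scal v * F = scal w * G \<Longrightarrow> frac x F w = frac x G v"
  by (subst frac_eq_iff) (auto intro: Omega.one)

lemma frac_self: "w \<in> Omega x \<Longrightarrow> (F, w) \<in> frac x F w"
  unfolding frac_def by (rule equiv_class_self[OF equiv_frac_rel]) simp

lemma in_fracD:
  assumes "(G, v) \<in> frac x F w" "w \<in> Omega x"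
  shows "v \<in> Omega x" "\<exists>u\<in>Omega x. scal u * (scal v * F - scal w * G) = 0"
  using assms by (auto simp: frac_def frac_rel_def)

text \<open>The operations on classes are unions over representatives; a union of equal classes
  collapses to the value at any one of them.\<close>

lemma UN_frac:
  assumes "w \<in> Omega x"
    and "\<And>G v u. v \<in> Omega x \<Longrightarrow> u \<in> Omega x \<Longrightarrow> scal u * (scal v * F - scal w * G) = 0 \<Longrightarrow> f G v = f F w"
  shows "(\<Union>(G, v)\<in>frac x F w. f G v) = f F w"
proof -
  have "f G v = f F w" if "(G, v) \<in> frac x F w" for G v
    using in_fracD[OF that assms(1)] assms(2) by blast
  then have "(\<Union>(G, v)\<in>frac x F w. f G v) = (\<Union>p\<in>frac x F w. f F w)"
    by (intro SUP_cong) (simp_all add: split_def)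
  also have "\<dots> = f F w" using frac_self[OF assms(1), of F] by (simp only: UN_constant) force
  finally show ?thesis .
qed

lemma frac_in_carrier: "w \<in> Omega x \<Longrightarrow> frac x F w \<in> carrier (localized x)"
  by (auto simp: localized_def frac_def intro: quotientI)

lemma carrier_localizedE:
  assumes "\<xi> \<in> carrier (localized x)"
  obtains F w where "w \<in> Omega x" "\<xi> = frac x F w"
  using assms by (auto simp: localized_def frac_def elim!: quotientE)

lemma add_frac:
  assumes w: "w \<in> Omega x" and v: "v \<in> Omega x"
  shows "frac x F w \<oplus>\<^bsub>localized x\<^esub> frac x G v = frac x (scal v * F + scal w * G) (w * v)"
proof -
  \<comment> \<open>Independence is shown one argument at a time: first in the second fraction, for
    every representative of the first.\<close>
  have inner: "(\<Union>(G', v')\<in>frac x G v. frac x (scal v' * F' + scal w' * G') (w' * v')) =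
      frac x (scal v * F' + scal w' * G) (w' * v)" if w': "w' \<in> Omega x" for F' w'
  proof (rule UN_frac[OF v])
    fix G' v' u assume *: "v' \<in> Omega x" "u \<in> Omega x" "scal u * (scal v' * G - scal v * G') = 0"
    have "scal u * (scal (w' * v) * (scal v' * F' + scal w' * G') - scal (w' * v') * (scal v * F' + scal w' * G)) =
        scal (- w' * w') * (scal u * (scal v' * G - scal v * G'))"
      by (simp add: distrib_left right_diff_distrib scal_scal scal_uminus mult_ac del: mult.assoc)
    then show "frac x (scal v' * F' + scal w' * G') (w' * v') = frac x (scal v * F' + scal w' * G) (w' * v)"
      using * w' v by (subst frac_eq_iff) (auto intro: Omega_mult)
  qed
  have "frac x F w \<oplus>\<^bsub>localized x\<^esub> frac x G v =
      (\<Union>(F', w')\<in>frac x F w. \<Union>(G', v')\<in>frac x G v. frac x (scal v' * F' + scal w' * G') (w' * v'))"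
    by (simp add: localized_def)
  also have "\<dots> = (\<Union>(F', w')\<in>frac x F w. frac x (scal v * F' + scal w' * G) (w' * v))"
  proof (rule SUP_cong)
    fix p assume p: "p \<in> frac x F w"
    obtain F' w' where p_eq: "p = (F', w')" by (cases p)
    then have "w' \<in> Omega x" using in_fracD(1)[OF _ w] p by simp
    then show "(case p of (F', w') \<Rightarrow> \<Union>(G', v')\<in>frac x G v. frac x (scal v' * F' + scal w' * G') (w' * v')) =
        (case p of (F', w') \<Rightarrow> frac x (scal v * F' + scal w' * G) (w' * v))"
      by (simp add: p_eq inner)
  qed simp
  also have "\<dots> = frac x (scal v * F + scal w * G) (w * v)"
  proof (rule UN_frac[OF w])
    fix F' w' u assume *: "w' \<in> Omega x" "u \<in> Omega x" "scal u * (scal w' * F - scal w * F') = 0"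
    have "scal u * (scal (w * v) * (scal v * F' + scal w' * G) - scal (w' * v) * (scal v * F + scal w * G)) =
        scal (- v * v) * (scal u * (scal w' * F - scal w * F'))"
      by (simp add: distrib_left right_diff_distrib scal_scal scal_uminus mult_ac del: mult.assoc)
    then show "frac x (scal v * F' + scal w' * G) (w' * v) = frac x (scal v * F + scal w * G) (w * v)"
      using * w v by (subst frac_eq_iff) (auto intro: Omega_mult)
  qed
  finally show ?thesis .
qed

lemma extend_frac:
  assumes "B_linear T" "w \<in> Omega x"
  shows "extend x T (frac x F w) = frac x (T F) w"
  unfolding extend_def
proof (rule UN_frac[OF assms(2)])
  fix G v u assume *: "v \<in> Omega x" "u \<in> Omega x" "scal u * (scal v * F - scal w * G) = 0"
  have sc: "T (scal b * A) = scal b * T A" for b A using assms(1) by (simp add: B_linear_def)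
  have "T (scal u * (scal v * F - scal w * G)) = 0"
    using assms(1) * by (simp add: B_linear_additive)
  then have "scal u * (scal v * T F - scal w * T G) = 0"
    by (simp add: sc B_linear_additive[OF assms(1)])
  then have "scal u * (scal w * T G - scal v * T F) = 0"
    by (simp add: right_diff_distrib)
  then show "frac x (T G) v = frac x (T F) w"
    using * assms(2) by (subst frac_eq_iff) auto
qed

lemma smult_frac:
  assumes "w \<in> Omega x"
  shows "b \<odot>\<^bsub>localized x\<^esub> frac x F w = frac x (scal b * F) w"
proof -
  from extend_frac[OF B_linear_scal assms] show ?thesis by (simp add: localized_def extend_def)
qed

lemma zero_localized: "\<zero>\<^bsub>localized x\<^esub> = frac x 0 1"
  by (simp add: localized_def)

lemma add_frac_same:
  assumes "w \<in> Omega x"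
  shows "frac x F w \<oplus>\<^bsub>localized x\<^esub> frac x G w = frac x (F + G) w"
  unfolding add_frac[OF assms assms]
  by (rule frac_eqI) (simp_all add: assms Omega_mult scal_scal flip: distrib_left)

lemma frac_0: "w \<in> Omega x \<Longrightarrow> frac x 0 w = \<zero>\<^bsub>localized x\<^esub>"
  unfolding zero_localized by (rule frac_eqI) (auto intro: Omega.one)

lemma abelian_group_localized: "abelian_group (localized x)"
proof (rule abelian_groupI)
  fix a b c
  assume "a \<in> carrier (localized x)" "b \<in> carrier (localized x)" "c \<in> carrier (localized x)"
  then obtain F w G v H t where abc: "a = frac x F w" "b = frac x G v" "c = frac x H t"
    and \<Omega>: "w \<in> Omega x" "v \<in> Omega x" "t \<in> Omega x"
    by (metis carrier_localizedE)
  show "a \<oplus>\<^bsub>localized x\<^esub> b \<oplus>\<^bsub>localized x\<^esub> c = a \<oplus>\<^bsub>localized x\<^esub> (b \<oplus>\<^bsub>localized x\<^esub> c)"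
    unfolding abc using \<Omega> by (simp add: add_frac Omega_mult distrib_left scal_scal add.assoc mult_ac del: mult.assoc)
next
  fix a b
  assume "a \<in> carrier (localized x)" "b \<in> carrier (localized x)"
  then obtain F w G v where ab: "a = frac x F w" "b = frac x G v" and \<Omega>: "w \<in> Omega x" "v \<in> Omega x"
    by (metis carrier_localizedE)
  show "a \<oplus>\<^bsub>localized x\<^esub> b \<in> carrier (localized x)"
    unfolding ab using \<Omega> by (simp add: add_frac Omega_mult frac_in_carrier)
  show "a \<oplus>\<^bsub>localized x\<^esub> b = b \<oplus>\<^bsub>localized x\<^esub> a"
    unfolding ab using \<Omega> by (simp add: add_frac add.commute mult.commute)
next
  show "\<zero>\<^bsub>localized x\<^esub> \<in> carrier (localized x)"
    by (simp add: zero_localized frac_in_carrier Omega.one)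
next
  fix a assume "a \<in> carrier (localized x)"
  then obtain F w where a: "a = frac x F w" and w: "w \<in> Omega x" by (rule carrier_localizedE)
  show "\<zero>\<^bsub>localized x\<^esub> \<oplus>\<^bsub>localized x\<^esub> a = a"
    unfolding a frac_0[OF w, symmetric] using w by (simp add: add_frac_same)
  show "\<exists>b\<in>carrier (localized x). b \<oplus>\<^bsub>localized x\<^esub> a = \<zero>\<^bsub>localized x\<^esub>"
    unfolding a using w
    by (intro bexI[of _ "frac x (- F) w"]) (simp_all add: add_frac_same frac_0 frac_in_carrier)
qed

lemma module_localized: "module ring_of_type_algebra (localized x)"
proof (rule moduleI)
  fix b c :: coeff and \<xi> assume "\<xi> \<in> carrier (localized x)"
  then obtain F w where \<xi>: "\<xi> = frac x F w" and w: "w \<in> Omega x" by (rule carrier_localizedE)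
  show "b \<odot>\<^bsub>localized x\<^esub> \<xi> \<in> carrier (localized x)"
    using w by (simp add: \<xi> smult_frac frac_in_carrier)
  show "(b \<oplus>\<^bsub>ring_of_type_algebra\<^esub> c) \<odot>\<^bsub>localized x\<^esub> \<xi> = b \<odot>\<^bsub>localized x\<^esub> \<xi> \<oplus>\<^bsub>localized x\<^esub> c \<odot>\<^bsub>localized x\<^esub> \<xi>"
    using w by (simp add: \<xi> smult_frac add_frac_same ring_of_type_algebra_def scal_add distrib_right)
  show "(b \<otimes>\<^bsub>ring_of_type_algebra\<^esub> c) \<odot>\<^bsub>localized x\<^esub> \<xi> = b \<odot>\<^bsub>localized x\<^esub> (c \<odot>\<^bsub>localized x\<^esub> \<xi>)"
    using w by (simp add: \<xi> smult_frac ring_of_type_algebra_def scal_scal)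
  show "\<one>\<^bsub>ring_of_type_algebra\<^esub> \<odot>\<^bsub>localized x\<^esub> \<xi> = \<xi>"
    using w by (simp add: \<xi> smult_frac ring_of_type_algebra_def)
next
  fix b :: coeff and \<xi> \<eta> assume "\<xi> \<in> carrier (localized x)" "\<eta> \<in> carrier (localized x)"
  then obtain F w G v where ab: "\<xi> = frac x F w" "\<eta> = frac x G v" and \<Omega>: "w \<in> Omega x" "v \<in> Omega x"
    by (metis carrier_localizedE)
  show "b \<odot>\<^bsub>localized x\<^esub> (\<xi> \<oplus>\<^bsub>localized x\<^esub> \<eta>) = b \<odot>\<^bsub>localized x\<^esub> \<xi> \<oplus>\<^bsub>localized x\<^esub> b \<odot>\<^bsub>localized x\<^esub> \<eta>"
    using \<Omega> by (simp add: ab add_frac smult_frac Omega_mult distrib_left) (simp only: scal_scal mult.commute)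
qed (auto intro: abelian_group_localized)

lemma extend_closed:
  "B_linear T \<Longrightarrow> \<xi> \<in> carrier (localized x) \<Longrightarrow> extend x T \<xi> \<in> carrier (localized x)"
  by (metis carrier_localizedE extend_frac frac_in_carrier)

lemma module_endo_extend:
  assumes T: "B_linear T" shows "module_endo ring_of_type_algebra (localized x) (extend x T)"
  unfolding module_endo_def
proof (intro conjI ballI)
  have T': "T (F + G) = T F + T G" "T (scal b * F) = scal b * T F" for F G b
    using T by (auto simp: B_linear_def)
  show "extend x T ` carrier (localized x) \<subseteq> carrier (localized x)"
    using extend_closed[OF T] by blast
  fix \<xi> \<eta> assume "\<xi> \<in> carrier (localized x)" "\<eta> \<in> carrier (localized x)"
  then obtain F w G v where ab: "\<xi> = frac x F w" "\<eta> = frac x G v" and \<Omega>: "w \<in> Omega x" "v \<in> Omega x"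
    by (metis carrier_localizedE)
  show "extend x T (\<xi> \<oplus>\<^bsub>localized x\<^esub> \<eta>) = extend x T \<xi> \<oplus>\<^bsub>localized x\<^esub> extend x T \<eta>"
    using \<Omega> by (simp add: ab add_frac extend_frac[OF T] Omega_mult T')
next
  have T': "T (scal b * F) = scal b * T F" for F b
    using T by (auto simp: B_linear_def)
  fix \<xi> b assume "\<xi> \<in> carrier (localized x)"
  then obtain F w where \<xi>: "\<xi> = frac x F w" and w: "w \<in> Omega x" by (rule carrier_localizedE)
  show "extend x T (b \<odot>\<^bsub>localized x\<^esub> \<xi>) = b \<odot>\<^bsub>localized x\<^esub> extend x T \<xi>"
    using w by (simp add: \<xi> smult_frac extend_frac[OF T] T')
qed

section \<open>Projections and direct sums\<close>

lemma module_endo_comp: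
  assumes "module_endo R M S" "module_endo R M T" shows "module_endo R M (S \<circ> T)"
  using assms unfolding module_endo_def by (auto simp: image_subset_iff)

lemma module_endo_inverse:
  assumes M: "module R M" and T: "module_endo R M T" and bij: "bij_betw T (carrier M) (carrier M)"
  shows "module_endo R M (the_inv_into (carrier M) T)"
proof -
  interpret module R M by (rule M)
  let ?S = "the_inv_into (carrier M) T"
  have inj: "inj_on T (carrier M)" and im: "T ` carrier M = carrier M"
    using bij by (auto simp: bij_betw_def)
  have S: "?S F \<in> carrier M" "T (?S F) = F" if "F \<in> carrier M" for F
    using that im inj by (auto intro: the_inv_into_into f_the_inv_into_f)
  have eq: "?S (T F) = F" if "F \<in> carrier M" for F
    using that inj by (rule the_inv_into_f_f[rotated])
  show ?thesis
    unfolding module_endo_def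
  proof (intro conjI ballI)
    fix F G assume "F \<in> carrier M" "G \<in> carrier M"
    then have "T (?S F \<oplus>\<^bsub>M\<^esub> ?S G) = F \<oplus>\<^bsub>M\<^esub> G"
      using T S by (simp add: module_endo_def)
    then show "?S (F \<oplus>\<^bsub>M\<^esub> G) = ?S F \<oplus>\<^bsub>M\<^esub> ?S G"
      using eq[of "?S F \<oplus>\<^bsub>M\<^esub> ?S G"] S \<open>F \<in> carrier M\<close> \<open>G \<in> carrier M\<close> by simp
  next
    fix b F assume "b \<in> carrier R" "F \<in> carrier M"
    then have "T (b \<odot>\<^bsub>M\<^esub> ?S F) = b \<odot>\<^bsub>M\<^esub> F"
      using T S by (simp add: module_endo_def)
    then show "?S (b \<odot>\<^bsub>M\<^esub> F) = b \<odot>\<^bsub>M\<^esub> ?S F"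
      using eq[of "b \<odot>\<^bsub>M\<^esub> ?S F"] S \<open>b \<in> carrier R\<close> \<open>F \<in> carrier M\<close> by simp
  qed (use S in auto)
qed

lemma module_endo_zero:
  assumes M: "module R M" and T: "module_endo R M T"
  shows "T \<zero>\<^bsub>M\<^esub> = \<zero>\<^bsub>M\<^esub>"
proof -
  interpret module R M by (rule M)
  have "T (\<zero>\<^bsub>R\<^esub> \<odot>\<^bsub>M\<^esub> \<zero>\<^bsub>M\<^esub>) = \<zero>\<^bsub>R\<^esub> \<odot>\<^bsub>M\<^esub> T \<zero>\<^bsub>M\<^esub>" and "T \<zero>\<^bsub>M\<^esub> \<in> carrier M"
    using T by (auto simp: module_endo_def image_subset_iff simp del: smult_l_null smult_r_null)
  then show ?thesis by simp
qed

lemma submodule_image: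
  assumes M: "module R M" and T: "module_endo R M T"
  shows "submodule (T ` carrier M) R M"
proof -
  interpret module R M by (rule M)
  have T': "T F \<in> carrier M" if "F \<in> carrier M" for F using T that by (auto simp: module_endo_def)
  have smult: "b \<odot>\<^bsub>M\<^esub> F \<in> T ` carrier M" if b: "b \<in> carrier R" and F: "F \<in> T ` carrier M" for b F
  proof -
    obtain G where G: "G \<in> carrier M" "F = T G" using F by blast
    then have "b \<odot>\<^bsub>M\<^esub> F = T (b \<odot>\<^bsub>M\<^esub> G)" using T b by (simp add: module_endo_def)
    then show ?thesis using G b by (simp add: image_eqI)
  qed
  show ?thesis
  proof (rule submoduleI)
    show "T ` carrier M \<subseteq> carrier M" using T' by blast
    show "\<zero>\<^bsub>M\<^esub> \<in> T ` carrier M" using module_endo_zero[OF M T] by (metis M.zero_closed image_eqI)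
    show "\<ominus>\<^bsub>M\<^esub> F \<in> T ` carrier M" if "F \<in> T ` carrier M" for F
    proof -
      have F: "F \<in> carrier M" using that T' by blast
      have "\<ominus>\<^bsub>M\<^esub> F = (\<ominus>\<^bsub>R\<^esub> \<one>\<^bsub>R\<^esub>) \<odot>\<^bsub>M\<^esub> F" using F by (simp add: smult_l_minus)
      then show ?thesis using smult[OF _ that] by simp
    qed
    show "F \<oplus>\<^bsub>M\<^esub> G \<in> T ` carrier M" if FG: "F \<in> T ` carrier M" "G \<in> T ` carrier M" for F G
    proof -
      obtain A B where "A \<in> carrier M" "F = T A" "B \<in> carrier M" "G = T B" using FG by blast
      then have "F \<oplus>\<^bsub>M\<^esub> G = T (A \<oplus>\<^bsub>M\<^esub> B)" "A \<oplus>\<^bsub>M\<^esub> B \<in> carrier M" using T by (simp_all add: module_endo_def)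
      then show ?thesis by simp
    qed
  qed (rule smult)
qed

lemma complementary_projections_direct_sum:
  assumes M: "module R M" and P: "complementary_projections R M P P'"
  shows "direct_sum_decomp R M (P ` carrier M) (P' ` carrier M)"
proof -
  interpret module R M by (rule M)
  have endo: "module_endo R M P" "module_endo R M P'"
    using P by (simp_all add: complementary_projections_def)
  have closed: "P F \<in> carrier M" "P' F \<in> carrier M" if "F \<in> carrier M" for F
    using endo that by (auto simp: module_endo_def)
  have add: "P (F \<oplus>\<^bsub>M\<^esub> G) = P F \<oplus>\<^bsub>M\<^esub> P G" "P' (F \<oplus>\<^bsub>M\<^esub> G) = P' F \<oplus>\<^bsub>M\<^esub> P' G"
    if "F \<in> carrier M" "G \<in> carrier M" for F G
    using endo that by (auto simp: module_endo_def)
  have proj: "P (P F) = P F" "P' (P' F) = P' F" "P (P' F) = \<zero>\<^bsub>M\<^esub>" "P' (P F) = \<zero>\<^bsub>M\<^esub>" "P F \<oplus>\<^bsub>M\<^esub> P' F = F"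
    if "F \<in> carrier M" for F
    using P that by (auto simp: complementary_projections_def)
  show ?thesis
    unfolding direct_sum_decomp_def
  proof (intro conjI ballI submodule_image[OF M] endo)
    fix F assume F: "F \<in> carrier M"
    show "\<exists>!w. w \<in> P ` carrier M \<times> P' ` carrier M \<and> F = fst w \<oplus>\<^bsub>M\<^esub> snd w"
    proof (rule ex1I[of _ "(P F, P' F)"])
      show "(P F, P' F) \<in> P ` carrier M \<times> P' ` carrier M \<and> F = fst (P F, P' F) \<oplus>\<^bsub>M\<^esub> snd (P F, P' F)"
        using F proj by simp
      fix w assume w: "w \<in> P ` carrier M \<times> P' ` carrier M \<and> F = fst w \<oplus>\<^bsub>M\<^esub> snd w"
      then obtain A B where AB: "A \<in> carrier M" "B \<in> carrier M" "w = (P A, P' B)" by (cases w) auto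
      then have "F = P A \<oplus>\<^bsub>M\<^esub> P' B" using w by simp
      \<comment> \<open>Applying each projection to the sum isolates one component, which gives
        uniqueness.\<close>
      then have "P F = P A" "P' F = P' B" using AB by (simp_all add: add closed proj)
      then show "w = (P F, P' F)" using AB by simp
    qed
  qed
qed

section \<open>The Hodge decomposition\<close>

text \<open>The identity t A = H (K A) yields the preimage K F / (t w). Rewritten as t A = K (H A),
  it shows that a numerator annihilated by H is itself annihilated by a denominator.\<close>

lemma bij_betw_extend_laplacian:
  "bij_betw (extend x (q_laplacian x)) (carrier (localized x)) (carrier (localized x))"
proof (rule bij_betw_imageI)
  let ?H = "q_laplacian x"
  note lin = B_linear_q_laplacian[of x]
  have add: "?H (A + B) = ?H A + ?H B" and sc: "?H (scal b * A) = scal b * ?H A" for A B b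
    using lin by (auto simp: B_linear_def)
  show "inj_on (extend x ?H) (carrier (localized x))"
  proof (rule inj_onI)
    fix \<xi> \<eta> assume "\<xi> \<in> carrier (localized x)" "\<eta> \<in> carrier (localized x)" and eq: "extend x ?H \<xi> = extend x ?H \<eta>"
    then obtain F w G v where ab: "\<xi> = frac x F w" "\<eta> = frac x G v" and \<Omega>: "w \<in> Omega x" "v \<in> Omega x"
      by (metis carrier_localizedE)
    then obtain u where u: "u \<in> Omega x" "scal u * (scal v * ?H F - scal w * ?H G) = 0"
      using eq by (auto simp: extend_frac[OF lin] frac_eq_iff)
    let ?A = "scal u * (scal v * F - scal w * G)"
    have HA: "?H ?A = 0" using u by (simp add: sc B_linear_additive[OF lin])
    obtain t K where t: "t \<in> Omega x" "K \<in> laplace_bicommutant x" "scal t * ?A = ?H (K ?A)"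
      using laplace_invertible[of x ?A] by (auto simp: laplace_invertible_def)
    have "scal t * ?A = K (?H ?A)" using laplace_bicommutantD(2)[OF t(2)] t(3) by simp
    then have "scal (t * u) * (scal v * F - scal w * G) = 0"
      using HA laplace_bicommutantD(1)[OF t(2)] by (simp add: B_linear_additive scal_mult mult.assoc)
    moreover have "t * u \<in> Omega x" using t u by (simp add: Omega_mult)
    ultimately show "\<xi> = \<eta>" unfolding ab using \<Omega> by (subst frac_eq_iff) auto
  qed
  have "\<xi> \<in> extend x ?H ` carrier (localized x)" if carr: "\<xi> \<in> carrier (localized x)" for \<xi>
  proof -
    obtain F w where \<xi>: "\<xi> = frac x F w" and w: "w \<in> Omega x" using carr by (rule carrier_localizedE)
    obtain t K where t: "t \<in> Omega x" "scal t * F = ?H (K F)"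
      using laplace_invertible[of x F] by (auto simp: laplace_invertible_def)
    have "extend x ?H (frac x (K F) (t * w)) = frac x (scal t * F) (t * w)"
      using t w by (simp add: extend_frac[OF lin] Omega_mult)
    also have "\<dots> = \<xi>"
      unfolding \<xi> by (rule frac_eqI) (simp_all add: t(1) w Omega_mult scal_scal mult.commute)
    finally show ?thesis using frac_in_carrier[OF Omega_mult[OF t(1) w]] by (metis image_eqI)
  qed
  then show "extend x ?H ` carrier (localized x) = carrier (localized x)"
    using extend_closed[OF lin] by blast
qed

lemma B_linear_right_q_deriv: "B_linear (right_q_deriv x)"
  unfolding right_q_deriv_eq by (rule B_linear_q_deriv)

lemma B_linear_creation: "B_linear (creation x)"
  unfolding creation_eq by (rule B_linear_ext_mult)

theorem corollary4p6:
  fixes x :: 'v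
  shows "(\<forall>F\<in>carrier (localized x).
            F = right_q_deriv_loc x (creation_loc x (green x F))
                \<oplus>\<^bsub>localized x\<^esub> creation_loc x (right_q_deriv_loc x (green x F))) \<and>
         complementary_projections ring_of_type_algebra (localized x) (P_deriv x) (P_creation x) \<and>
         direct_sum_decomp ring_of_type_algebra (localized x)
           (P_deriv x ` carrier (localized x)) (P_creation x ` carrier (localized x)) \<and>
         P_deriv x ` carrier (localized x) \<subseteq> right_q_deriv_loc x ` carrier (localized x) \<and>
         P_creation x ` carrier (localized x) \<subseteq> creation_loc x ` carrier (localized x)"
proof -
  let ?M = "localized x" and ?R = "ring_of_type_algebra :: coeff ring"
  let ?d = "right_q_deriv_loc x" and ?c = "creation_loc x" and ?h = "extend x (q_laplacian x)" and ?g = "green x"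
  interpret module ?R ?M by (rule module_localized)
  note lin = B_linear_right_q_deriv[of x] B_linear_creation[of x] B_linear_q_laplacian[of x]
  note bij = bij_betw_extend_laplacian[of x]
  have endo: "module_endo ?R ?M ?d" "module_endo ?R ?M ?c" "module_endo ?R ?M ?g"
    unfolding green_def using lin
    by (auto intro: module_endo_extend module_endo_inverse[OF module_localized] bij)
  have closed: "?d \<xi> \<in> carrier ?M" "?c \<xi> \<in> carrier ?M" "?g \<xi> \<in> carrier ?M" if "\<xi> \<in> carrier ?M" for \<xi>
    using endo that by (auto simp: module_endo_def)
  have hg: "?h (?g \<xi>) = \<xi>" and gh: "?g (?h \<xi>) = \<xi>" if "\<xi> \<in> carrier ?M" for \<xi>
    using that bij unfolding green_def by (auto simp: bij_betw_def f_the_inv_into_f the_inv_into_f_f)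
  have zero: "?d \<zero>\<^bsub>?M\<^esub> = \<zero>\<^bsub>?M\<^esub>" "?g \<zero>\<^bsub>?M\<^esub> = \<zero>\<^bsub>?M\<^esub>"
    by (rule module_endo_zero[OF module_localized endo(1)], rule module_endo_zero[OF module_localized endo(3)])
  \<comment> \<open>The relations hold on numerators, where the square of creation vanishes: both H
    C and C H reduce to C D C.\<close>
  have on_frac: "?h \<xi> = ?d (?c \<xi>) \<oplus>\<^bsub>?M\<^esub> ?c (?d \<xi>)" "?c (?c \<xi>) = \<zero>\<^bsub>?M\<^esub>"
    "?c (?h \<xi>) = ?c (?d (?c \<xi>))" "?h (?c \<xi>) = ?c (?d (?c \<xi>))" if "\<xi> \<in> carrier ?M" for \<xi>
  proof -
    obtain F w where \<xi>: "\<xi> = frac x F w" and w: "w \<in> Omega x" using \<open>\<xi> \<in> carrier ?M\<close> by (rule carrier_localizedE)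
    have d0: "right_q_deriv x 0 = 0" by (rule B_linear_additive(2)[OF lin(1)])
    show "?h \<xi> = ?d (?c \<xi>) \<oplus>\<^bsub>?M\<^esub> ?c (?d \<xi>)" "?c (?c \<xi>) = \<zero>\<^bsub>?M\<^esub>"
      "?c (?h \<xi>) = ?c (?d (?c \<xi>))" "?h (?c \<xi>) = ?c (?d (?c \<xi>))"
      unfolding \<xi> using w
      by (simp_all add: extend_frac lin B_linear_ext_mult q_laplacian_def add_frac_same frac_0 creation_eq ext_mult_self
          ext_mult_add d0)
  qed
  have cg: "?c (?g \<xi>) = ?g (?c \<xi>)" if "\<xi> \<in> carrier ?M" for \<xi>
  proof -
    have "?h (?c (?g \<xi>)) = ?c (?h (?g \<xi>))" using that by (simp only: on_frac(3,4) closed)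
    then have "?h (?c (?g \<xi>)) = ?c \<xi>" using that by (simp add: hg)
    then show ?thesis using gh[of "?c (?g \<xi>)"] that by (simp add: closed)
  qed
  have P: "P_deriv x \<xi> = ?d (?c (?g \<xi>))" "P_creation x \<xi> = ?c (?d (?g \<xi>))" for \<xi>
    by (simp_all add: P_deriv_def P_creation_def)
  have decomp: "\<xi> = P_deriv x \<xi> \<oplus>\<^bsub>?M\<^esub> P_creation x \<xi>" if "\<xi> \<in> carrier ?M" for \<xi>
    using on_frac(1)[of "?g \<xi>"] that by (simp add: P closed hg)
  have P_closed: "P_deriv x \<xi> \<in> carrier ?M" "P_creation x \<xi> \<in> carrier ?M" if "\<xi> \<in> carrier ?M" for \<xi>
    using that by (simp_all add: P closed)
  have PP: "P_deriv x (P_deriv x \<xi>) = P_deriv x \<xi>" if "\<xi> \<in> carrier ?M" for \<xi>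
  proof -
    have "?c (?g (?d (?c (?g \<xi>)))) = ?g (?c (?d (?c (?g \<xi>))))" using that by (simp add: cg closed)
    also have "\<dots> = ?g (?h (?c (?g \<xi>)))" using that by (simp only: on_frac(4) closed)
    also have "\<dots> = ?c (?g \<xi>)" using that by (simp add: gh closed)
    finally show ?thesis by (simp add: P)
  qed
  \<comment> \<open>Once the Green operator is moved past creation, two creation operators
    meet.\<close>
  have PP': "P_deriv x (P_creation x \<xi>) = \<zero>\<^bsub>?M\<^esub>" if "\<xi> \<in> carrier ?M" for \<xi>
    using that by (simp add: P cg closed on_frac zero)
  \<comment> \<open>A direct computation would bring two derivatives together across the Green
    operator. Instead, decomposing \<open>P_deriv x \<xi>\<close> and using idempotence leaves zero
    by cancellation.\<close>
  have P'P: "P_creation x (P_deriv x \<xi>) = \<zero>\<^bsub>?M\<^esub>" if "\<xi> \<in> carrier ?M" for \<xi>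
  proof -
    have "P_deriv x \<xi> \<oplus>\<^bsub>?M\<^esub> P_creation x (P_deriv x \<xi>) = P_deriv x \<xi>"
      using decomp[of "P_deriv x \<xi>"] that by (simp add: P_closed PP)
    then show ?thesis using that by (metis M.add.r_cancel_one' M.a_comm P_closed)
  qed
  have P'P': "P_creation x (P_creation x \<xi>) = P_creation x \<xi>" if "\<xi> \<in> carrier ?M" for \<xi>
    using decomp[of "P_creation x \<xi>"] that by (simp add: P_closed PP')
  have compl: "complementary_projections ?R ?M (P_deriv x) (P_creation x)"
    unfolding complementary_projections_def
    using decomp PP PP' P'P P'P' endo by (auto simp: P_deriv_def P_creation_def intro!: module_endo_comp)
  have sub: "P_deriv x ` carrier ?M \<subseteq> ?d ` carrier ?M" "P_creation x ` carrier ?M \<subseteq> ?c ` carrier ?M"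
    using closed by (auto simp: P)
  have "\<forall>F\<in>carrier ?M. F = ?d (?c (?g F)) \<oplus>\<^bsub>?M\<^esub> ?c (?d (?g F))"
    using decomp by (simp add: P)
  then show ?thesis
    using compl complementary_projections_direct_sum[OF module_localized compl] sub by blast
qed

end
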